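(* Let $d\in\mathbb{N}$ and $\sigma\in(0,1]$, with $\sigma<d/2$ if $d\in\{1,2\}$. Put $\alpha_0=\frac{d/2+\sigma}{2}$. Then $w_{\sigma,\alpha_0}=\kappa_{\sigma-\alpha_0}/\kappa_{-\alpha_0}$ is an optimal Hardy weight for $\Delta^\sigma$ on $\mathbb{Z}^d$, and as $|x|\to\infty$, \[ w_{\sigma,\alpha_0}(x)=\frac{c_{d,\sigma}}{|x|^{2\sigma}}+O\!\left(\frac{1}{|x|^{2\sigma+2}}\right),\qquad c_{d,\sigma}=4^{\sigma}\frac{\Gamma(\frac d4+\frac\sigma2)^2}{\Gamma(\frac d4-\frac\sigma2)^2}. \]
   Context: For $f:\mathbb{Z}^d\to\mathbb{R}$ let $\Delta f(x)=\sum_{y:|y-x|=1}(f(x)-f(y))$, where $|\cdot|$ is the Euclidean norm; $\Delta$ is a bounded nonnegative self-adjoint operator on $\ell^2(\mathbb{Z}^d)$, and $e^{-t\Delta}$ is its heat semigroup. $1_y$ denotes the indicator function of $\{y\}$. For $\sigma\in(0,1)$, $\Delta^\sigma$ is defined on $\ell^2(\mathbb{Z}^d)$ by the spectral theorem (equivalently $\Delta^\sigma f=\frac{1}{|\Gamma(-\sigma)|}\int_0^\infty (I-e^{-t\Delta})f\,\frac{dt}{t^{1+\sigma}}$), and $\Delta^1=\Delta$. For $\alpha\in(-d/2,1]$ the Riesz kernel $\kappa_\alpha:\mathbb{Z}^d\to[0,\infty)$ is defined by $\kappa_0=1_0$, $\kappa_1(x)=1_{\{|x|=1\}}$, $\kappa_\alpha(0)=0$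 if $\alpha\in(0,1)$, and otherwise $\kappa_\alpha(x)=\frac{1}{|\Gamma(-\alpha)|}\int_0^\infty e^{-t\Delta}1_0(x)\,\frac{dt}{t^{1+\alpha}}$. For $\sigma\in(0,1]$ and $\alpha\in(\sigma,d/2)$ set $w_{\sigma,\alpha}=\kappa_{\sigma-\alpha}/\kappa_{-\alpha}$. Let $Q^\sigma(f)=\frac12\sum_{x,y\in\mathbb{Z}^d}\kappa_\sigma(x-y)(f(x)-f(y))^2$ (which equals $\langle\Delta^\sigma\varphi,\varphi\rangle$ for finitely supported $\varphi$), and let $\mathcal{D}_0^\sigma$ be the closure of the finitely supported functions $C_c(\mathbb{Z}^d)$ with respect to the norm $\|\varphi\|_{\sigma,0}=\sqrt{Q^\sigma(\varphi)+|\varphi(0)|^2}$. A function $w:\mathbb{Z}^d\to[0,\infty)$ is a Hardy weight if $\langle\Delta^\sigma\varphi,\varphi\rangle\ge\sum_x w(x)|\varphi(x)|^2$ for all $\varphi\in C_c(\mathbb{Z}^d)$ (the inequality then extends to $\mathcal{D}_0^\sigma$). A Hardy weight $w$ is optimal if every Hardy weight $w'\ge w$ satisfies $w'=w$, and there is no nonzero $v\in\mathcal{D}_0^\sigma$ with $Q^\sigma(v)=\sum_x w(x)v(x)^2$ (no minimizer). *)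

theory Defs
  imports "HOL-Analysis.Analysis"
begin

text \<open>The lattice Z^d is modelled as int^'n with d = CARD('n).\<close>

definition zsqnorm :: "int^'n \<Rightarrow> int" where
  "zsqnorm x = (\<Sum>i\<in>UNIV. (x$i)^2)"

definition znorm :: "int^'n \<Rightarrow> real" where
  "znorm x = sqrt (real_of_int (zsqnorm x))"

definition nbrs :: "int^'n \<Rightarrow> (int^'n) set" where
  "nbrs x = {y. zsqnorm (y - x) = 1}"

definition lap :: "(int^'n \<Rightarrow> real) \<Rightarrow> int^'n \<Rightarrow> real" where
  "lap f x = (\<Sum>y\<in>nbrs x. f x - f y)"

text \<open>Heat semigroup exp(-t Delta), given by the exponential series of the bounded
  operator Delta, evaluated pointwise.\<close>
definition heat :: "real \<Rightarrow> (int^'n \<Rightarrow> real) \<Rightarrow> int^'n \<Rightarrow> real" where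
  "heat t f x = (\<Sum>k. (-t)^k / fact k * (lap ^^ k) f x)"

definition delta0 :: "int^'n \<Rightarrow> real" where
  "delta0 y = (if y = 0 then 1 else 0)"

definition heat_kernel :: "real \<Rightarrow> int^'n \<Rightarrow> real" where
  "heat_kernel t x = heat t delta0 x"

text \<open>Riesz kernel kappa_alpha (meaningful for alpha in (-d/2,1]).\<close>
definition kappa :: "real \<Rightarrow> int^'n \<Rightarrow> real" where
  "kappa \<alpha> x =
     (if \<alpha> = 0 then delta0 x
      else if \<alpha> = 1 then (if zsqnorm x = 1 then 1 else 0)
      else if 0 < \<alpha> \<and> \<alpha> < 1 \<and> x = 0 then 0
      else (1 / \<bar>Gamma (-\<alpha>)\<bar>) *
             (LINT t:{0<..}|lborel. heat_kernel t x / t powr (1 + \<alpha>)))"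

definition wsa :: "real \<Rightarrow> real \<Rightarrow> int^'n \<Rightarrow> real" where
  "wsa \<sigma> \<alpha> x = kappa (\<sigma> - \<alpha>) x / kappa (-\<alpha>) x"

text \<open>Fractional Laplacian Delta^sigma, sigma in (0,1], applied to a finitely
  supported function, via the Bochner/Balakrishnan formula (evaluated pointwise).\<close>
definition fraclap :: "real \<Rightarrow> (int^'n \<Rightarrow> real) \<Rightarrow> int^'n \<Rightarrow> real" where
  "fraclap \<sigma> f x =
     (if \<sigma> = 1 then lap f x
      else (1 / \<bar>Gamma (-\<sigma>)\<bar>) *
             (LINT t:{0<..}|lborel. (f x - heat t f x) / t powr (1 + \<sigma>)))"

definition fin_supp :: "(int^'n \<Rightarrow> real) \<Rightarrow> bool" where
  "fin_supp f \<longleftrightarrow> finite {x. f x \<noteq> 0}"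

definition Qform :: "real \<Rightarrow> (int^'n \<Rightarrow> real) \<Rightarrow> ennreal" where
  "Qform \<sigma> f = (\<integral>\<^sup>+ p. ennreal (kappa \<sigma> (fst p - snd p) * (f (fst p) - f (snd p))^2 / 2)
                  \<partial>count_space UNIV)"

text \<open>D_0^sigma: closure of C_c w.r.t. the norm sqrt(Q^sigma(phi) + phi(0)^2).\<close>
definition D0 :: "real \<Rightarrow> (int^'n \<Rightarrow> real) set" where
  "D0 \<sigma> = {v. \<exists>\<phi>::nat \<Rightarrow> int^'n \<Rightarrow> real. (\<forall>n. fin_supp (\<phi> n)) \<and>
      ((\<lambda>n. Qform \<sigma> (\<lambda>x. v x - \<phi> n x) + ennreal ((v 0 - \<phi> n 0)^2)) \<longlongrightarrow> 0) sequentially}"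

definition hardy_weight :: "real \<Rightarrow> (int^'n \<Rightarrow> real) \<Rightarrow> bool" where
  "hardy_weight \<sigma> w \<longleftrightarrow> (\<forall>x. 0 \<le> w x) \<and>
     (\<forall>\<phi>. fin_supp \<phi> \<longrightarrow>
        (\<Sum>x\<in>{x. \<phi> x \<noteq> 0}. w x * (\<phi> x)^2) \<le> (\<Sum>x\<in>{x. \<phi> x \<noteq> 0}. fraclap \<sigma> \<phi> x * \<phi> x))"

definition optimal_hardy_weight :: "real \<Rightarrow> (int^'n \<Rightarrow> real) \<Rightarrow> bool" where
  "optimal_hardy_weight \<sigma> w \<longleftrightarrow> hardy_weight \<sigma> w \<and>
     (\<forall>w'. hardy_weight \<sigma> w' \<and> (\<forall>x. w x \<le> w' x) \<longrightarrow> w' = w) \<and>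
     \<not> (\<exists>v\<in>D0 \<sigma>. v \<noteq> (\<lambda>_. 0) \<and>
          Qform \<sigma> v = (\<integral>\<^sup>+ x. ennreal (w x * (v x)^2) \<partial>count_space UNIV))"

end

theory Submission
  imports Defs "HOL-Probability.Probability"
begin

text \<open>
  The heat kernel of $\mathbb{Z}^d$ is a product of one-dimensional kernels
  $e^{-2t} I_{|n|}(2t)$. Shifting the contour of the Fourier inversion integral by $1/\sqrt t$
  compares the latter with the Gaussian up to $O(t^{-3/2} e^{-|n|/\sqrt t})$, and integration in
  time yields $\kappa_{-\beta}(x) = A_\beta |x|^{2\beta-d} + O(|x|^{2\beta-d-2})$, hence the
  asymptotics of the weight.

  The function $u = \kappa_{-\alpha_0}$ satisfies $\Delta^\sigma u = f$ with
  $f = \kappa_{\sigma-\alpha_0}$, so the ground state transform gives the Hardy inequality with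
  weight $f/u$ and identifies its defect as
  $\frac12\sum \kappa_\sigma(x-y) u(x) u(y) (\varphi(x)/u(x) - \varphi(y)/u(y))^2$. For
  $\alpha_0$ the product $f u$ is comparable to $|x|^{-d}$. Its logarithmic divergence makes the
  defect of a logarithmic cutoff of $u$ along its level sets tend to zero, so no larger weight is
  possible; and it excludes minimizers, since a minimizer would be a multiple of $u$ while
  $\sum (f/u) u^2 = \infty$.
\<close>

section \<open>The heat kernel of the line\<close>

no_notation Infinite_Sum.abs_summable_on (infixr \<open>abs'_summable'_on\<close> 46)

text \<open>The choice of \<alpha>_0 is dictated by exponents: f u decays with exponent 4\<alpha> -
  2\<sigma> - 2d, which is -d exactly at \<alpha>_0. For smaller \<alpha> the sum of f u converges;
  for larger \<alpha> its mass in a ball grows like a power of the radius, which a squared logarithm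
  cannot absorb.

  For \<sigma> < 1 the kernel of the form links all pairs of sites, so a cutoff in |x| would require
  bounds on it. A cutoff along level sets of u requires none: a scalar inequality between two values
  of u reduces the defect to a Green pairing of u with (u - l)_+, and only symmetry, positivity and
  summable rows of the kernel enter.

  Since u is of order |x|^(\<sigma> - d/2), it is not square summable, and the equation for u cannot
  be read off from the spectral calculus. It is obtained pointwise in the time variable of the heat
  kernel, as a fractional derivative of s^(\<alpha>-1) for \<sigma> < 1 and by parts for \<sigma> =
  1.

  The Gaussian is of size t^(-1/2) on the line, so an error t^(-3/2) gains 1/t, that is |x|^(-2) on
  the scale t = |x|^2. This is the origin of the remainder of relative order |x|^(-2).\<close>

definition bessel_coeff :: "nat \<Rightarrow> nat \<Rightarrow> real" where
  "bessel_coeff n k = 1 / (fact k * fact (k + n))"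

text \<open>This is I_n(2 sqrt w) / w^(n/2). With the power split off it is entire in w, and
  termwise differentiation raises the index by one, which keeps all later derivatives inside one
  family.\<close>

definition bessel_series :: "nat \<Rightarrow> real \<Rightarrow> real" where
  "bessel_series n w = (\<Sum>k. bessel_coeff n k * w ^ k)"

definition bessel :: "nat \<Rightarrow> real \<Rightarrow> real" where
  "bessel n t = t ^ n * bessel_series n (t\<^sup>2)"

definition line_kernel :: "real \<Rightarrow> int \<Rightarrow> real" where
  "line_kernel t n = exp (-2 * t) * bessel (nat \<bar>n\<bar>) t"

lemma bessel_coeff_pos: "0 < bessel_coeff n k"
  by (simp add: bessel_coeff_def)

lemma bessel_coeff_le: "bessel_coeff n k \<le> 1 / fact k"
  unfolding bessel_coeff_def
  by (intro divide_left_mono) (auto simp: mult_le_cancel_left1)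

lemma summable_norm_bessel: "summable (\<lambda>k. norm (bessel_coeff n k * w ^ k))"
proof (rule summable_comparison_test')
  show "summable (\<lambda>k. norm (w ^ k /\<^sub>R fact k))" by (rule summable_norm_exp)
  show "norm (norm (bessel_coeff n k * w ^ k)) \<le> norm (w ^ k /\<^sub>R fact k)" for k
    using mult_right_mono[OF bessel_coeff_le[of n k], of "\<bar>w\<bar> ^ k"] bessel_coeff_pos[of n k]
    by (simp add: abs_mult power_abs divide_simps)
qed

lemmas summable_bessel = summable_norm_cancel[OF summable_norm_bessel]

lemma diffs_bessel_coeff: "diffs (bessel_coeff n) = bessel_coeff (Suc n)"
  by (rule ext) (simp add: diffs_def bessel_coeff_def divide_simps)

lemma DERIV_bessel_series:
  "(bessel_series n has_real_derivative bessel_series (Suc n) w) (at w)"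
  using termdiffs_strong_converges_everywhere[OF summable_bessel, of n w]
  by (simp add: diffs_bessel_coeff bessel_series_def[abs_def])

lemma bessel_series_pos: "0 \<le> w \<Longrightarrow> 0 < bessel_series n w"
  unfolding bessel_series_def
proof (rule suminf_pos2[OF summable_bessel])
  show "0 \<le> w \<Longrightarrow> 0 \<le> bessel_coeff n k * w ^ k" for k
    using bessel_coeff_pos[of n k] by simp
  show "0 < bessel_coeff n 0 * w ^ 0" using bessel_coeff_pos[of n 0] by simp
qed

text \<open>The three-term recurrence of the Bessel functions. Coefficientwise it is the splitting
  (n + 1) + k = k + n + 1 of the last factor of the factorial of k + n + 1.\<close>

lemma bessel_series_rec:
  "bessel_series n w = real (Suc n) * bessel_series (Suc n) w + w * bessel_series (Suc (Suc n)) w"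
proof -
  define d where "d = (\<lambda>k. case k of 0 \<Rightarrow> 0 | Suc j \<Rightarrow> bessel_coeff (Suc (Suc n)) j * w ^ Suc j)"
  have "(\<lambda>k. bessel_coeff (Suc (Suc n)) k * w ^ k) sums bessel_series (Suc (Suc n)) w"
    unfolding bessel_series_def by (rule summable_sums[OF summable_bessel])
  then have "(\<lambda>k. w * (bessel_coeff (Suc (Suc n)) k * w ^ k)) sums (w * bessel_series (Suc (Suc n)) w)"
    by (rule sums_mult)
  then have "(\<lambda>k. d (Suc k)) sums (w * bessel_series (Suc (Suc n)) w)"
    by (simp add: d_def algebra_simps)
  then have 1: "d sums (w * bessel_series (Suc (Suc n)) w)"
    by (subst (asm) sums_Suc_iff) (simp add: d_def)
  have 2: "(\<lambda>k. real (Suc n) * (bessel_coeff (Suc n) k * w ^ k)) sums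
      (real (Suc n) * bessel_series (Suc n) w)"
    unfolding bessel_series_def by (intro sums_mult summable_sums[OF summable_bessel])
  have "real (Suc n) * (bessel_coeff (Suc n) k * w ^ k) + d k = bessel_coeff n k * w ^ k" for k
  proof (cases k)
    case (Suc j)
    have "(fact (Suc (Suc (j + n))) :: real) = (real (Suc n) + real (Suc j)) * fact (Suc (j + n))"
      by (simp add: algebra_simps)
    moreover have "(fact (Suc j) :: real) = real (Suc j) * fact j" by simp
    ultimately show ?thesis
      unfolding Suc d_def bessel_coeff_def
      by (simp add: divide_simps del: fact_Suc of_nat_Suc) (simp add: algebra_simps)
  qed (simp add: d_def bessel_coeff_def divide_simps)
  then have "(\<lambda>k. bessel_coeff n k * w ^ k) sums
      (real (Suc n) * bessel_series (Suc n) w + w * bessel_series (Suc (Suc n)) w)"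
    using sums_add[OF 2 1] by simp
  then show ?thesis
    by (simp add: bessel_series_def sums_iff)
qed

text \<open>The product rule gives the term n t^(n-1) from the power and the index n + 1 from the
  series; \<open>bessel_series_rec\<close> turns the former into index n - 1 plus another half of
  index n + 1. The case n = 0 encodes I_(-1) = I_1.\<close>

lemma DERIV_bessel:
  "(bessel n has_real_derivative
     (if n = 0 then 2 * bessel 1 t else bessel (n - 1) t + bessel (Suc n) t)) (at t)"
proof -
  have D: "((\<lambda>t. bessel_series n (t\<^sup>2)) has_real_derivative bessel_series (Suc n) (t\<^sup>2) * (2 * t)) (at t)"
    by (rule DERIV_chain2[OF DERIV_bessel_series]) (auto intro!: derivative_eq_intros)
  show ?thesis
  proof (cases n)
    case 0
    then show ?thesis using D by (simp add: bessel_def[abs_def] mult_ac)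
  next
    case (Suc m)
    have "(bessel n has_real_derivative real n * t ^ m * bessel_series n (t\<^sup>2) +
        t ^ n * (bessel_series (Suc n) (t\<^sup>2) * (2 * t))) (at t)"
      unfolding bessel_def[abs_def]
      using DERIV_mult[OF DERIV_pow[of n t] D] Suc by (simp add: add.commute mult_ac)
    moreover have "real n * t ^ m * bessel_series n (t\<^sup>2) + t ^ n * (bessel_series (Suc n) (t\<^sup>2) * (2 * t))
       = bessel (n - 1) t + bessel (Suc n) t"
      using bessel_series_rec[of m "t\<^sup>2"]
      by (simp add: Suc bessel_def power2_eq_square algebra_simps)
    ultimately show ?thesis using Suc by simp
  qed
qed

lemma DERIV_line_kernel:
  "((\<lambda>t. line_kernel t n) has_real_derivative
     line_kernel t (n + 1) + line_kernel t (n - 1) - 2 * line_kernel t n) (at t)"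
proof -
  let ?m = "nat \<bar>n\<bar>"
  have *: "(if ?m = 0 then 2 * bessel 1 t else bessel (?m - 1) t + bessel (Suc ?m) t)
     = bessel (nat \<bar>n + 1\<bar>) t + bessel (nat \<bar>n - 1\<bar>) t"
  proof -
    consider "n = 0" | "n > 0" | "n < 0" by linarith
    then show ?thesis
    proof cases
      case 2
      then have "nat \<bar>n + 1\<bar> = Suc ?m" "nat \<bar>n - 1\<bar> = ?m - 1" by auto
      then show ?thesis using 2 by simp
    next
      case 3
      then have "nat \<bar>n - 1\<bar> = Suc ?m" "nat \<bar>n + 1\<bar> = ?m - 1" by auto
      then show ?thesis using 3 by simp
    qed simp
  qed
  show ?thesis
    unfolding line_kernel_def
    apply (rule derivative_eq_intros DERIV_bessel refl)+
    unfolding * by (simp add: algebra_simps)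
qed

lemma line_kernel_pos: "0 < t \<Longrightarrow> 0 < line_kernel t n"
  by (simp add: line_kernel_def bessel_def bessel_series_pos)

lemma line_kernel_nonneg: "0 \<le> t \<Longrightarrow> 0 \<le> line_kernel t n"
  by (simp add: line_kernel_def bessel_def bessel_series_pos less_imp_le)

lemma line_kernel_minus [simp]: "line_kernel t (- n) = line_kernel t n"
  by (simp add: line_kernel_def)

lemma line_kernel_0: "line_kernel 0 n = (if n = 0 then 1 else 0)"
proof -
  have "bessel_series 0 0 = 1"
    using powser_zero[of "bessel_coeff 0"] by (simp add: bessel_series_def bessel_coeff_def)
  then show ?thesis by (simp add: line_kernel_def bessel_def)
qed

lemma line_kernel_0_ge: "exp (-2 * t) \<le> line_kernel t 0"
proof -
  have "bessel_coeff 0 0 * (t\<^sup>2) ^ 0 \<le> bessel_series 0 (t\<^sup>2)"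
    unfolding bessel_series_def
    using sum_le_suminf[OF summable_bessel[of 0 "t\<^sup>2"], of "{0}"] bessel_coeff_pos[of 0]
    by (simp add: less_imp_le)
  then show ?thesis by (simp add: line_kernel_def bessel_def bessel_coeff_def)
qed

lemma continuous_on_line_kernel [continuous_intros]:
  "continuous_on A (\<lambda>t. line_kernel t n)"
  by (rule DERIV_continuous_on, rule has_field_derivative_at_within, rule DERIV_line_kernel)

lemma borel_measurable_line_kernel [measurable]: "(\<lambda>t. line_kernel t n) \<in> borel_measurable borel"
  by (intro borel_measurable_continuous_onI continuous_intros)

section \<open>Generating function, Fourier inversion and the semigroup law on the line\<close>

lemma exp_abs_summable:
  fixes z :: complex
  shows "(\<lambda>n. z ^ n / fact n) abs_summable_on UNIV" "(\<Sum>\<^sub>an. z ^ n / fact n) = exp z"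
proof -
  have eq: "(\<lambda>n. z ^ n / fact n) = (\<lambda>n. z ^ n /\<^sub>R fact n)"
    by (rule ext) (simp add: scaleR_conv_of_real field_simps)
  show 1: "(\<lambda>n. z ^ n / fact n) abs_summable_on UNIV"
    unfolding eq abs_summable_on_nat_iff' by (rule summable_norm_exp)
  show "(\<Sum>\<^sub>an. z ^ n / fact n) = exp z"
    unfolding infsetsum_nat'[OF 1] unfolding eq exp_def ..
qed

text \<open>The kernel is the law of the difference of two independent Poisson variables, so its
  generating function is a product of two exponential series, regrouped along diagonals.\<close>

lemma line_kernel_generating:
  fixes \<zeta> :: complex
  assumes t: "0 \<le> t"
  shows "(\<lambda>n. of_real (line_kernel t n) * exp (of_int n * \<zeta>)) abs_summable_on UNIV"
    and "(\<Sum>\<^sub>an. of_real (line_kernel t n) * exp (of_int n * \<zeta>)) =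
      exp (of_real t * (exp \<zeta> + exp (- \<zeta>) - 2))"
proof -
  define a where "a = of_real t * exp \<zeta>"
  define b where "b = of_real t * exp (- \<zeta>)"
  define f where "f = (\<lambda>(j, k). (a ^ j / fact j) * (b ^ k / fact k))"
  \<comment> \<open>A pair of exponents is coded by its difference n and its minimum k, so that a
    diagonal of the double exponential series becomes the row of a fixed n.\<close>
  define h where "h = (\<lambda>(n::int, k::nat). (nat n + k, nat (- n) + k))"
  have fs: "f abs_summable_on UNIV"
    unfolding f_def UNIV_Times_UNIV[symmetric]
    by (intro abs_summable_on_product exp_abs_summable) auto
  have fe: "infsetsum f UNIV = exp a * exp b"
    unfolding f_def UNIV_Times_UNIV[symmetric]
    by (subst infsetsum_product) (auto intro!: exp_abs_summable simp: exp_abs_summable)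
  have h: "bij h"
  proof (rule o_bij)
    let ?g = "\<lambda>(j::nat, k::nat). (int j - int k, min j k)"
    show "?g \<circ> h = id" "h \<circ> ?g = id" by (auto simp: h_def fun_eq_iff)
  qed
  define g where "g = f \<circ> h"
  have gs: "g abs_summable_on UNIV"
    using fs h abs_summable_on_reindex_bij_betw[of h UNIV UNIV f] by (simp add: g_def o_def)
  have ge: "infsetsum g UNIV = exp a * exp b"
    using fe h infsetsum_reindex_bij_betw[of h UNIV UNIV f] by (simp add: g_def o_def)
  have cancel: "exp \<zeta> ^ k * exp (- \<zeta>) ^ k = 1" for k
    by (simp add: power_mult_distrib[symmetric] mult_exp_exp)
  have gval: "g (n, k) = exp (of_int n * \<zeta>) * of_real (t ^ nat \<bar>n\<bar> * (bessel_coeff (nat \<bar>n\<bar>) k * (t\<^sup>2) ^ k))"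
    for n k
  proof (cases "n \<ge> 0")
    case True
    then obtain m where m: "n = int m" using nonneg_int_cases by blast
    have "exp (of_int n * \<zeta>) = exp \<zeta> ^ m" by (simp add: m exp_of_nat_mult)
    moreover have "g (n, k) = of_real (t ^ m * bessel_coeff m k * (t\<^sup>2) ^ k) * exp \<zeta> ^ m * (exp \<zeta> ^ k * exp (- \<zeta>) ^ k)"
      by (simp add: g_def h_def f_def m a_def b_def bessel_coeff_def power_mult_distrib power_add
          power2_eq_square add.commute mult_ac)
    ultimately show ?thesis by (simp only: cancel m) (simp add: mult_ac)
  next
    case False
    then have "n = - int (nat (- n))" by simp
    then obtain m where m: "n = - int m" ..
    have "exp (of_int n * \<zeta>) = exp (- \<zeta>) ^ m"
      using exp_of_nat_mult[of m "- \<zeta>"] by (simp add: m)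
    moreover have "g (n, k) = of_real (t ^ m * bessel_coeff m k * (t\<^sup>2) ^ k) * exp (- \<zeta>) ^ m * (exp \<zeta> ^ k * exp (- \<zeta>) ^ k)"
      by (simp add: g_def h_def f_def m a_def b_def bessel_coeff_def power_mult_distrib power_add
          power2_eq_square add.commute mult_ac)
    ultimately show ?thesis by (simp only: cancel m) (simp add: mult_ac)
  qed
  have gin: "(\<Sum>\<^sub>ak. g (n, k)) = exp (of_int n * \<zeta>) * of_real (bessel (nat \<bar>n\<bar>) t)" for n
  proof -
    let ?c = "\<lambda>k. t ^ nat \<bar>n\<bar> * (bessel_coeff (nat \<bar>n\<bar>) k * (t\<^sup>2) ^ k)"
    have s: "?c abs_summable_on UNIV"
      unfolding abs_summable_on_nat_iff'
      using summable_mult[OF summable_norm_bessel[of "nat \<bar>n\<bar>" "t\<^sup>2"], of "\<bar>t ^ nat \<bar>n\<bar>\<bar>"] by (simp add: abs_mult mult_ac)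
    have "(\<Sum>\<^sub>ak. of_real (?c k)) = (of_real (\<Sum>\<^sub>ak. ?c k) :: complex)"
      unfolding infsetsum_def by (rule integral_complex_of_real)
    also have "(\<Sum>\<^sub>ak. ?c k) = bessel (nat \<bar>n\<bar>) t"
      by (subst infsetsum_nat'[OF s]) (simp add: bessel_def bessel_series_def suminf_mult[OF summable_bessel])
    finally show ?thesis
      unfolding gval by (subst infsetsum_cmult_right) (use s in \<open>auto simp: abs_summable_on_def simp del: of_real_mult\<close>)
  qed
  have S: "(\<lambda>n. \<Sum>\<^sub>ak. g (n, k)) abs_summable_on UNIV"
    using abs_summable_on_Sigma_project1'[of "\<lambda>n k. g (n, k)" UNIV "\<lambda>_. UNIV"] gs by simp
  have eq: "(\<lambda>n. of_real (line_kernel t n) * exp (of_int n * \<zeta>)) =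
      (\<lambda>n. of_real (exp (-2 * t)) * (\<Sum>\<^sub>ak. g (n, k)))"
    unfolding gin by (simp add: line_kernel_def mult_ac)
  show "(\<lambda>n. of_real (line_kernel t n) * exp (of_int n * \<zeta>)) abs_summable_on UNIV"
    unfolding eq by (intro abs_summable_on_cmult_right S)
  have "(\<Sum>\<^sub>an. \<Sum>\<^sub>ak. g (n, k)) = exp a * exp b"
    using infsetsum_Sigma[of UNIV "\<lambda>_. UNIV" g] gs ge by simp
  then have "(\<Sum>\<^sub>an. of_real (line_kernel t n) * exp (of_int n * \<zeta>)) =
      of_real (exp (-2 * t)) * (exp a * exp b)"
    unfolding eq by (subst infsetsum_cmult_right) (use S in auto)
  also have "\<dots> = exp (of_real t * (exp \<zeta> + exp (- \<zeta>) - 2))"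
    by (simp add: a_def b_def exp_of_real[symmetric] mult_exp_exp algebra_simps)
  finally show "(\<Sum>\<^sub>an. of_real (line_kernel t n) * exp (of_int n * \<zeta>)) =
      exp (of_real t * (exp \<zeta> + exp (- \<zeta>) - 2))" .
qed

lemma abs_summable_line_kernel_exp:
  assumes "0 \<le> t"
  shows "(\<lambda>n. line_kernel t n * exp (s * of_int n)) abs_summable_on UNIV"
    and "(\<Sum>\<^sub>an. line_kernel t n * exp (s * of_int n)) = exp (t * (exp s + exp (- s) - 2))"
proof -
  have eq: "of_real (line_kernel t n) * exp (of_int n * of_real s) =
      (of_real (line_kernel t n * exp (s * of_int n)) :: complex)" for n
    by (simp add: exp_of_real[symmetric] mult.commute)
  note gen = line_kernel_generating[OF assms, of "of_real s", unfolded eq]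
  show "(\<lambda>n. line_kernel t n * exp (s * of_int n)) abs_summable_on UNIV"
    using gen(1) by (simp only: abs_summable_complex_of_real)
  have "of_real (\<Sum>\<^sub>an. line_kernel t n * exp (s * of_int n)) =
      (of_real (exp (t * (exp s + exp (- s) - 2))) :: complex)"
    using gen(2) unfolding infsetsum_def integral_complex_of_real
    by (simp add: exp_of_real[symmetric])
  then show "(\<Sum>\<^sub>an. line_kernel t n * exp (s * of_int n)) = exp (t * (exp s + exp (- s) - 2))"
    by (simp only: of_real_eq_iff)
qed

lemma abs_summable_line_kernel: "0 \<le> t \<Longrightarrow> line_kernel t abs_summable_on UNIV"
  using abs_summable_line_kernel_exp(1)[of t 0] by simp

lemma infsetsum_line_kernel: "0 \<le> t \<Longrightarrow> infsetsum (line_kernel t) UNIV = 1"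
  using abs_summable_line_kernel_exp(2)[of t 0] by simp

text \<open>The exponentials have modulus 1 and h is bounded by H, so norm (c m) * H is a majorant:
  the net of finite partial sums converges uniformly on the interval, and its integrals converge
  with it.\<close>

lemma infsetsum_swap_Icc:
  fixes c :: "int \<Rightarrow> complex" and h :: "real \<Rightarrow> complex"
  assumes c: "c abs_summable_on UNIV" and h: "continuous_on {a..b} h"
  shows "(\<Sum>\<^sub>am. c m * integral {a..b} (\<lambda>\<theta>. h \<theta> * exp (- \<i> * of_int m * of_real \<theta>))) =
    integral {a..b} (\<lambda>\<theta>. h \<theta> * (\<Sum>\<^sub>am. c m * exp (- \<i> * of_int m * of_real \<theta>)))"
proof -
  let ?e = "\<lambda>m \<theta>. exp (- \<i> * of_int m * of_real \<theta>) :: complex"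
  have ne: "norm (?e m \<theta>) = 1" for m \<theta> by simp
  obtain H where H: "\<And>\<theta>. \<theta> \<in> {a..b} \<Longrightarrow> norm (h \<theta>) \<le> H" and H0: "0 \<le> H"
  proof -
    have "bounded (h ` {a..b})" by (intro compact_imp_bounded compact_continuous_image h) auto
    then obtain H where "0 < H" "\<forall>x\<in>h ` {a..b}. norm x \<le> H" unfolding bounded_pos by blast
    then show ?thesis by (intro that[of H]) auto
  qed
  have c': "(\<lambda>m. norm (c m)) summable_on UNIV"
    using c abs_summable_equivalent by blast
  have cont: "continuous_on {a..b} (\<lambda>\<theta>. h \<theta> * ?e m \<theta>)" for m
    by (intro continuous_intros h)
  have csum: "(\<lambda>m. c m * ?e m \<theta>) abs_summable_on UNIV" for \<theta>
    by (rule abs_summable_on_comparison_test[OF c]) (simp add: norm_mult)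
  have U: "uniform_limit {a..b} (\<lambda>X \<theta>. \<Sum>m\<in>X. c m * (h \<theta> * ?e m \<theta>))
     (\<lambda>\<theta>. \<Sum>\<^sub>\<infinity>m. c m * (h \<theta> * ?e m \<theta>)) (finite_subsets_at_top UNIV)"
  proof (rule Weierstrass_m_test_general)
    show "norm (c m * (h \<theta> * ?e m \<theta>)) \<le> norm (c m) * H" if "\<theta> \<in> {a..b}" for m \<theta>
      using H[OF that] by (simp add: norm_mult mult_left_mono)
    show "(\<lambda>m. norm (c m) * H) summable_on UNIV"
      by (intro summable_on_cmult_left c')
  qed
  have eq: "(\<Sum>\<^sub>\<infinity>m. c m * (h \<theta> * ?e m \<theta>)) = h \<theta> * (\<Sum>\<^sub>am. c m * ?e m \<theta>)" for \<theta>
  proof -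
    have "(\<Sum>\<^sub>\<infinity>m. c m * (h \<theta> * ?e m \<theta>)) = (\<Sum>\<^sub>\<infinity>m. h \<theta> * (c m * ?e m \<theta>))"
      by (simp add: mult_ac)
    also have "\<dots> = (\<Sum>\<^sub>am. h \<theta> * (c m * ?e m \<theta>))"
      by (rule infsetsum_infsum[symmetric]) (intro abs_summable_on_cmult_right csum)
    also have "\<dots> = h \<theta> * (\<Sum>\<^sub>am. c m * ?e m \<theta>)"
      by (rule infsetsum_cmult_right) (use csum in auto)
    finally show ?thesis .
  qed
  have csum': "continuous_on {a..b} (\<lambda>\<theta>. \<Sum>m\<in>X. c m * (h \<theta> * ?e m \<theta>))" for X
    by (intro continuous_on_sum continuous_on_mult_left cont)
  obtain I J where
    IJ: "\<And>X. ((\<lambda>\<theta>. \<Sum>m\<in>X. c m * (h \<theta> * ?e m \<theta>)) has_integral I X) {a..b}"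
      "((\<lambda>\<theta>. \<Sum>\<^sub>\<infinity>m. c m * (h \<theta> * ?e m \<theta>)) has_integral J) {a..b}"
      "(I \<longlongrightarrow> J) (finite_subsets_at_top UNIV)"
    by (rule uniform_limit_integral[OF U csum' finite_subsets_at_top_neq_bot]) (rule that)
  let ?I = "\<lambda>m. integral {a..b} (\<lambda>\<theta>. h \<theta> * ?e m \<theta>)"
  have int: "((\<lambda>\<theta>. h \<theta> * ?e m \<theta>) has_integral ?I m) {a..b}" for m
    using integrable_continuous_real[OF cont] by (rule integrable_integral)
  have "I X = (\<Sum>m\<in>X. c m * ?I m)" if "finite X" for X
  proof (rule has_integral_unique[OF IJ(1)])
    show "((\<lambda>\<theta>. \<Sum>m\<in>X. c m * (h \<theta> * ?e m \<theta>)) has_integral (\<Sum>m\<in>X. c m * ?I m)) {a..b}"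
      using that by (intro has_integral_sum has_integral_mult_right int)
  qed
  then have "eventually (\<lambda>X. I X = (\<Sum>m\<in>X. c m * ?I m)) (finite_subsets_at_top UNIV)"
    by (intro eventually_finite_subsets_at_top_weakI) auto
  then have "((\<lambda>m. c m * ?I m) has_sum J) UNIV"
    unfolding has_sum_def using IJ(3) by (rule Lim_transform_eventually[rotated])
  then have J: "(\<Sum>\<^sub>\<infinity>m. c m * ?I m) = J" by (rule infsumI)
  have "norm (?I m) \<le> H * (b - a)" if "a \<le> b" for m
    using that by (rule integral_bound) (use cont H in \<open>auto simp: norm_mult\<close>)
  moreover have "norm (?I m) \<le> 0" if "\<not> a \<le> b" for m using that by simp
  ultimately obtain B where B: "\<And>m. norm (?I m) \<le> B" by metis
  have "(\<lambda>m. c m * ?I m) abs_summable_on UNIV"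
  proof (rule abs_summable_on_comparison_test)
    show "(\<lambda>m. norm (c m) * B) abs_summable_on UNIV"
      using abs_summable_on_cmult_left[of B "\<lambda>m. norm (c m)"] c by simp
    show "norm (c m * ?I m) \<le> norm (norm (c m) * B)" for m
      using mult_left_mono[OF B[of m], of "norm (c m)"] by (simp add: norm_mult)
  qed
  then have "(\<Sum>\<^sub>am. c m * ?I m) = (\<Sum>\<^sub>\<infinity>m. c m * ?I m)" by (rule infsetsum_infsum)
  also have "\<dots> = integral {a..b} (\<lambda>\<theta>. h \<theta> * (\<Sum>\<^sub>am. c m * ?e m \<theta>))"
    using J integral_unique[OF IJ(2)] unfolding eq by simp
  finally show ?thesis .
qed

lemma integral_exp_int:
  "integral {-pi..pi} (\<lambda>\<theta>. exp (\<i> * of_int k * of_real \<theta>)) = (if k = 0 then of_real (2 * pi) else 0)"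
proof (cases "k = 0")
  case False
  let ?F = "\<lambda>\<theta>::real. exp (\<i> * of_int k * of_real \<theta>) / (\<i> * of_int k)"
  have "((\<lambda>\<theta>. exp (\<i> * of_int k * of_real \<theta>)) has_integral ?F pi - ?F (-pi)) {-pi..pi}"
  proof (rule fundamental_theorem_of_calculus)
    fix x :: real
    have "((\<lambda>z. exp (\<i> * of_int k * z) / (\<i> * of_int k)) has_field_derivative exp (\<i> * of_int k * of_real x))
        (at (of_real x))"
      using False by (auto intro!: derivative_eq_intros simp: field_simps)
    then show "(?F has_vector_derivative exp (\<i> * of_int k * of_real x)) (at x within {-pi..pi})"
      using has_vector_derivative_real_field has_vector_derivative_at_within by fast
  qed auto
  moreover have "exp (\<i> * of_int k * of_real pi) = exp (\<i> * of_int k * of_real (- pi))"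
    unfolding exp_eq by (rule exI[of _ k]) (simp add: algebra_simps)
  ultimately show ?thesis using False by (auto intro: integral_unique)
qed (simp add: scaleR_conv_of_real)

text \<open>At s - i\<theta> the generating function is a Fourier series whose coefficients are the
  tilted kernel \<open>line_kernel t n * exp (s * n)\<close>; orthogonality extracts one of them.
  Because the series converges for every complex argument, the shifted contour costs no appeal to
  Cauchy's theorem.\<close>

lemma line_kernel_fourier:
  fixes s t :: real
  assumes "0 \<le> t"
  defines "\<zeta> \<equiv> \<lambda>\<theta>. complex_of_real s - \<i> * of_real \<theta>"
  shows "of_real (2 * pi * (line_kernel t n * exp (s * of_int n))) =
    integral {-pi..pi} (\<lambda>\<theta>. exp (of_real t * (exp (\<zeta> \<theta>) + exp (- \<zeta> \<theta>) - 2)) * exp (\<i> * of_int n * of_real \<theta>))"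
proof -
  let ?c = "\<lambda>m. complex_of_real (line_kernel t m * exp (s * of_int m))"
  let ?h = "\<lambda>\<theta>. exp (\<i> * of_int n * of_real \<theta>)"
  have c: "?c abs_summable_on UNIV"
    using abs_summable_line_kernel_exp(1)[OF assms(1)] by (simp only: abs_summable_complex_of_real)
  have eq: "?c m * exp (- \<i> * of_int m * of_real \<theta>) = of_real (line_kernel t m) * exp (of_int m * \<zeta> \<theta>)" for m \<theta>
    by (simp add: \<zeta>_def exp_of_real[symmetric] mult_exp_exp algebra_simps)
  have orth: "integral {-pi..pi} (\<lambda>\<theta>. ?h \<theta> * exp (- \<i> * of_int m * of_real \<theta>)) =
      (if m = n then of_real (2 * pi) else 0)" for m
    using integral_exp_int[of "n - m"] by (simp add: mult_exp_exp algebra_simps)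
  have "(\<Sum>\<^sub>am. ?c m * (if m = n then of_real (2 * pi) else 0)) =
     integral {-pi..pi} (\<lambda>\<theta>. ?h \<theta> * exp (of_real t * (exp (\<zeta> \<theta>) + exp (- \<zeta> \<theta>) - 2)))"
    using infsetsum_swap_Icc[OF c, of "-pi" pi ?h]
    unfolding orth eq line_kernel_generating(2)[OF assms(1)]
    by (simp add: continuous_intros)
  moreover have "(\<Sum>\<^sub>am. ?c m * (if m = n then of_real (2 * pi) else 0)) = ?c n * of_real (2 * pi)"
  proof -
    have "(\<Sum>\<^sub>am. ?c m * (if m = n then of_real (2 * pi) else 0)) =
        (\<Sum>\<^sub>am\<in>{n}. ?c m * (if m = n then of_real (2 * pi) else 0))"
      by (rule infsetsum_cong_neutral) auto
    then show ?thesis by simp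
  qed
  ultimately show ?thesis by (simp add: mult_ac)
qed

text \<open>Convolution becomes multiplication of the Fourier symbols, and the symbols are
  exponentials linear in time. Only the untilted representation s = 0 is used.\<close>

lemma line_kernel_semigroup:
  assumes "0 \<le> t" "0 \<le> s"
  shows "(\<Sum>\<^sub>am. line_kernel t (n - m) * line_kernel s m) = line_kernel (t + s) n"
proof -
  let ?c = "\<lambda>m. complex_of_real (line_kernel s m)"
  let ?E = "\<lambda>t \<theta>. exp (of_real t * (exp (- (\<i> * of_real \<theta>)) + exp (\<i> * of_real \<theta>) - 2)) :: complex"
  let ?h = "\<lambda>\<theta>. ?E t \<theta> * exp (\<i> * of_int n * of_real \<theta>)"
  have F: "of_real (2 * pi * line_kernel t n) = integral {-pi..pi} (\<lambda>\<theta>. ?E t \<theta> * exp (\<i> * of_int n * of_real \<theta>))"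
    if "0 \<le> t" for t n
    using line_kernel_fourier[OF that, of n 0] by simp
  have c: "?c abs_summable_on UNIV"
    using abs_summable_line_kernel[OF assms(2)] by (simp only: abs_summable_complex_of_real)
  have G: "(\<Sum>\<^sub>am. ?c m * exp (- \<i> * of_int m * of_real \<theta>)) = ?E s \<theta>" for \<theta>
    using line_kernel_generating(2)[OF assms(2), of "- \<i> * of_real \<theta>"] by (simp add: mult_ac)
  have I: "integral {-pi..pi} (\<lambda>\<theta>. ?h \<theta> * exp (- \<i> * of_int m * of_real \<theta>)) = of_real (2 * pi * line_kernel t (n - m))" for m
  proof -
    have "(\<lambda>\<theta>. ?h \<theta> * exp (- \<i> * of_int m * of_real \<theta>)) = (\<lambda>\<theta>. ?E t \<theta> * exp (\<i> * of_int (n - m) * of_real \<theta>))"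
      by (rule ext) (simp add: mult_exp_exp algebra_simps)
    then show ?thesis using F[OF assms(1), of "n - m"] by simp
  qed
  have "(\<Sum>\<^sub>am. ?c m * of_real (2 * pi * line_kernel t (n - m))) = integral {-pi..pi} (\<lambda>\<theta>. ?h \<theta> * ?E s \<theta>)"
    using infsetsum_swap_Icc[OF c, of "-pi" pi ?h] unfolding G I by (simp add: continuous_intros)
  also have "(\<lambda>\<theta>. ?h \<theta> * ?E s \<theta>) = (\<lambda>\<theta>. ?E (t + s) \<theta> * exp (\<i> * of_int n * of_real \<theta>))"
    by (rule ext) (simp add: mult_exp_exp algebra_simps)
  also have "integral {-pi..pi} \<dots> = of_real (2 * pi * line_kernel (t + s) n)"
    using F[of "t + s" n] assms by simp
  finally have "of_real (\<Sum>\<^sub>am. 2 * pi * (line_kernel t (n - m) * line_kernel s m)) =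
      complex_of_real (2 * pi * line_kernel (t + s) n)"
    unfolding infsetsum_def integral_complex_of_real[symmetric] by (simp add: mult_ac)
  then have "(\<Sum>\<^sub>am. 2 * pi * (line_kernel t (n - m) * line_kernel s m)) = 2 * pi * line_kernel (t + s) n"
    by (simp only: of_real_eq_iff)
  then show ?thesis unfolding infsetsum_def by simp
qed

lemma line_kernel_le_1: "0 \<le> t \<Longrightarrow> line_kernel t n \<le> 1"
proof -
  assume t: "0 \<le> t"
  have "(\<Sum>\<^sub>am\<in>{n}. line_kernel t m) \<le> infsetsum (line_kernel t) UNIV"
    by (rule infsetsum_mono_neutral_left) (use abs_summable_line_kernel[OF t] line_kernel_nonneg[OF t] in auto)
  then show ?thesis using infsetsum_line_kernel[OF t] by simp
qed

text \<open>A bound on the tilted values becomes two-sided decay: it is applied at n or at -n,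
  whichever gives the tilt the favourable sign.\<close>

lemma abs_le_exp_mult_le:
  fixes f :: "int \<Rightarrow> real"
  assumes "\<And>n. f (- n) = f n" "\<And>n. f n * exp (s * of_int n) \<le> K"
  shows "f n \<le> K * exp (- (s * \<bar>of_int n\<bar>))"
proof -
  have "f n * exp (s * \<bar>of_int n\<bar>) \<le> K"
    using assms(2)[of n] assms(2)[of "- n"] assms(1)[of n] by (cases "n \<ge> 0") auto
  then show ?thesis by (simp add: exp_minus field_simps)
qed

text \<open>The odd Taylor terms cancel. Each cubic remainder is at most exp \<bar>Re \<zeta>\<bar>
  times the fourth power over 6, hence at most one half of the fourth power because e \<le>
  3.\<close>

lemma exp_sum_minus_square:
  fixes \<zeta> :: complex
  assumes "\<bar>Re \<zeta>\<bar> \<le> 1"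
  shows "norm (exp \<zeta> + exp (- \<zeta>) - 2 - \<zeta>\<^sup>2) \<le> norm \<zeta> ^ 4"
proof -
  have T: "norm (exp z - (1 + z + z\<^sup>2 / 2 + z ^ 3 / 6)) \<le> norm z ^ 4 / 2" if "\<bar>Re z\<bar> \<le> 1" for z :: complex
  proof -
    have "norm (exp z - (1 + z + z\<^sup>2 / 2 + z ^ 3 / 6)) \<le> exp \<bar>Re z\<bar> * norm z ^ 4 / 6"
      using Taylor_exp[of z 3] by (simp add: eval_nat_numeral)
    also have "\<dots> \<le> 3 * norm z ^ 4 / 6"
      using that exp_le by (intro divide_right_mono mult_right_mono) (auto intro: order_trans[of _ "exp 1"])
    finally show ?thesis by simp
  qed
  have "exp \<zeta> + exp (- \<zeta>) - 2 - \<zeta>\<^sup>2 = (exp \<zeta> - (1 + \<zeta> + \<zeta>\<^sup>2 / 2 + \<zeta> ^ 3 / 6)) +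
      (exp (- \<zeta>) - (1 + (- \<zeta>) + (- \<zeta>)\<^sup>2 / 2 + (- \<zeta>) ^ 3 / 6))"
    by simp
  also have "norm \<dots> \<le> norm \<zeta> ^ 4 / 2 + norm (- \<zeta>) ^ 4 / 2"
    using assms by (intro norm_triangle_le add_mono T) auto
  finally show ?thesis by simp
qed

lemma exp_sum_le_square:
  fixes s :: real
  assumes "\<bar>s\<bar> \<le> 1"
  shows "exp s + exp (- s) - 2 \<le> 2 * s\<^sup>2"
proof -
  have "norm (exp (of_real s) + exp (- of_real s) - 2 - (of_real s)\<^sup>2 :: complex) \<le> norm (of_real s :: complex) ^ 4"
    by (rule exp_sum_minus_square) (use assms in simp)
  also have "exp (of_real s) + exp (- of_real s) - 2 - (of_real s)\<^sup>2 =
      (of_real (exp s + exp (- s) - 2 - s\<^sup>2) :: complex)"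
    by (simp add: exp_of_real[symmetric])
  finally have "\<bar>exp s + exp (- s) - 2 - s\<^sup>2\<bar> \<le> \<bar>s\<bar> ^ 4" by (simp only: norm_of_real)
  also have "\<bar>s\<bar> ^ 4 = s\<^sup>2 * s\<^sup>2" by (simp add: eval_nat_numeral)
  also have "\<dots> \<le> s\<^sup>2 * 1"
    using assms by (intro mult_left_mono) (auto simp: abs_square_le_1)
  finally show ?thesis by simp
qed

text \<open>Taylor to fourth order: on this interval \<theta>^2 \<le> pi^2 \<le> 10, so \<theta>^4 /
  24 is at most (10/24) \<theta>^2, and 1/2 - 10/24 = 1/12.\<close>

lemma cos_le_parabola:
  assumes "\<bar>\<theta>\<bar> \<le> pi"
  shows "cos \<theta> \<le> 1 - \<theta>\<^sup>2 / 12"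
proof -
  obtain u where u: "cos \<theta> = (\<Sum>m<4. cos_coeff m * \<theta> ^ m) + cos (u + 1/2 * real 4 * pi) / fact 4 * \<theta> ^ 4"
    using Maclaurin_cos_expansion[of \<theta> 4] by auto
  have "(\<Sum>m<4. cos_coeff m * \<theta> ^ m) = 1 - \<theta>\<^sup>2 / 2"
  proof -
    have "{..<4} = {0, 1, 2, 3::nat}" by auto
    then show ?thesis by (simp add: cos_coeff_def)
  qed
  moreover have "cos (u + 1/2 * real 4 * pi) / fact 4 * \<theta> ^ 4 \<le> 1 / 24 * \<theta> ^ 4"
    by (intro mult_right_mono) (auto simp: fact_numeral)
  moreover have "\<theta> ^ 4 \<le> 10 * \<theta>\<^sup>2"
  proof -
    have "\<theta>\<^sup>2 \<le> pi\<^sup>2" using power_mono[OF assms, of 2] by simp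
    also have "pi\<^sup>2 \<le> 3.15 ^ 2" using pi_approx by (intro power_mono) auto
    also have "\<dots> \<le> (10::real)" by (simp add: power2_eq_square)
    finally have "\<theta>\<^sup>2 * \<theta>\<^sup>2 \<le> 10 * \<theta>\<^sup>2" by (intro mult_right_mono) auto
    then show ?thesis by (simp add: eval_nat_numeral)
  qed
  ultimately show ?thesis using u by linarith
qed

text \<open>Factoring out the exponential with the smaller real part leaves exp (a - b) - 1, whose
  bound exp \<bar>Re (a - b)\<bar> restores exactly the larger real part.\<close>

lemma norm_exp_diff_le:
  fixes a b :: complex
  assumes "Re a \<le> M" "Re b \<le> M"
  shows "norm (exp a - exp b) \<le> norm (a - b) * exp M"
proof -
  have *: "norm (exp a - exp b) \<le> norm (a - b) * exp M" if "Re b \<le> Re a" "Re a \<le> M" for a b :: complex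
  proof -
    have "exp a - exp b = exp b * (exp (a - b) - 1)" by (simp add: algebra_simps mult_exp_exp)
    then have "norm (exp a - exp b) = exp (Re b) * norm (exp (a - b) - 1)" by (simp add: norm_mult)
    also have "\<dots> \<le> exp (Re b) * (exp \<bar>Re (a - b)\<bar> * norm (a - b))"
      using Taylor_exp[of "a - b" 0] by (intro mult_left_mono) auto
    also have "\<dots> = exp (Re a) * norm (a - b)"
      using that by (simp add: mult_exp_exp flip: mult.assoc)
    also have "\<dots> \<le> exp M * norm (a - b)" using that by (intro mult_right_mono) auto
    finally show ?thesis by (simp add: mult.commute)
  qed
  show ?thesis
    using *[of b a] *[of a b] assms by (cases "Re b \<le> Re a") (auto simp: norm_minus_commute)
qed

section \<open>Comparison with the Gaussian\<close>

definition gauss :: "real \<Rightarrow> real \<Rightarrow> real" where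
  "gauss t x = exp (- (x\<^sup>2 / (4 * t))) / sqrt (4 * pi * t)"

lemma integral_exp_square:
  assumes t: "0 < t"
  shows "integrable lborel (\<lambda>\<theta>::real. exp (- (t * \<theta>\<^sup>2)))"
    and "(LINT \<theta>|lborel. exp (- (t * \<theta>\<^sup>2))) = sqrt (pi / t)"
proof -
  let ?s = "sqrt (1 / (2 * t))"
  have s: "0 < ?s" using t by simp
  have s2: "?s\<^sup>2 = 1 / (2 * t)" using t by simp
  have eq: "(\<lambda>\<theta>. exp (- (t * \<theta>\<^sup>2))) = (\<lambda>\<theta>. sqrt (pi / t) * normal_density 0 ?s \<theta>)"
  proof (rule ext)
    fix \<theta> :: real
    have "normal_density 0 ?s \<theta> = 1 / sqrt (pi / t) * exp (- (t * \<theta>\<^sup>2))"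
      unfolding normal_density_def s2 using t by (simp add: field_simps)
    then show "exp (- (t * \<theta>\<^sup>2)) = sqrt (pi / t) * normal_density 0 ?s \<theta>"
      using t by simp
  qed
  show "integrable lborel (\<lambda>\<theta>::real. exp (- (t * \<theta>\<^sup>2)))"
    unfolding eq using integrable_normal_density[OF s] by simp
  show "(LINT \<theta>|lborel. exp (- (t * \<theta>\<^sup>2))) = sqrt (pi / t)"
    unfolding eq using integral_normal_density[OF s] by simp
qed

text \<open>The characteristic function of the standard normal law, rescaled by c = 1 / sqrt
  (2t).\<close>

lemma integral_exp_square_fourier:
  assumes t: "0 < t"
  shows "(CLINT \<theta>|lborel. exp (- (of_real (t * \<theta>\<^sup>2))) * exp (\<i> * of_real (a * \<theta>))) =
    of_real (sqrt (pi / t) * exp (- (a\<^sup>2 / (4 * t))))"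
proof -
  define c where "c = 1 / sqrt (2 * t)"
  have c: "0 < c" "c\<^sup>2 = 1 / (2 * t)" using t by (auto simp: c_def power_divide)
  have "of_real (exp (- ((a * c)\<^sup>2 / 2))) = char std_normal_distribution (a * c)"
    by (simp add: char_std_normal_distribution)
  also have "\<dots> = (CLINT x|lborel. std_normal_density x *\<^sub>R exp (\<i> * of_real (a * c * x)))"
    unfolding char_def by (subst integral_density) auto
  \<comment> \<open>The summand 0 is kept so that the integrand has the literal shape of the affine
    substitution \<theta> = 0 + c * x.\<close>
  also have "(\<lambda>x. std_normal_density x *\<^sub>R exp (\<i> * of_real (a * c * x))) =
     (\<lambda>x. of_real (1 / sqrt (2 * pi)) * (exp (- (of_real (t * (0 + c * x)\<^sup>2))) * exp (\<i> * of_real (a * (0 + c * x)))))"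
  proof (rule ext)
    fix x :: real
    have "t * (c * x)\<^sup>2 = x\<^sup>2 / 2" using t c by (simp add: power_mult_distrib)
    then show "std_normal_density x *\<^sub>R exp (\<i> * of_real (a * c * x)) =
       of_real (1 / sqrt (2 * pi)) * (exp (- (of_real (t * (0 + c * x)\<^sup>2))) * exp (\<i> * of_real (a * (0 + c * x))))"
      unfolding add_0
      by (simp only:) (simp add: std_normal_density_def scaleR_conv_of_real exp_of_real[symmetric] mult_ac)
  qed
  also have "(CLINT x|lborel. of_real (1 / sqrt (2 * pi)) * (exp (- (of_real (t * (0 + c * x)\<^sup>2))) * exp (\<i> * of_real (a * (0 + c * x))))) =
     of_real (1 / sqrt (2 * pi)) * (CLINT x|lborel. exp (- (of_real (t * (0 + c * x)\<^sup>2))) * exp (\<i> * of_real (a * (0 + c * x))))"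
    by (rule integral_mult_right_zero)
  also have "(CLINT x|lborel. exp (- (of_real (t * (0 + c * x)\<^sup>2))) * exp (\<i> * of_real (a * (0 + c * x)))) =
     (CLINT \<theta>|lborel. exp (- (of_real (t * \<theta>\<^sup>2))) * exp (\<i> * of_real (a * \<theta>))) /\<^sub>R c"
    using lborel_integral_real_affine[of c "\<lambda>\<theta>. exp (- (of_real (t * \<theta>\<^sup>2))) * exp (\<i> * of_real (a * \<theta>)) :: complex" 0] c
    by simp
  finally have "(CLINT \<theta>|lborel. exp (- (of_real (t * \<theta>\<^sup>2))) * exp (\<i> * of_real (a * \<theta>))) =
     of_real (c * sqrt (2 * pi) * exp (- ((a * c)\<^sup>2 / 2)))"
    using c by (simp add: scaleR_conv_of_real field_simps)
  also have "c * sqrt (2 * pi) = sqrt (pi / t)"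
    using t by (simp add: c_def real_sqrt_mult real_sqrt_divide)
  also have "(a * c)\<^sup>2 / 2 = a\<^sup>2 / (4 * t)" using c by (simp add: power_mult_distrib)
  finally show ?thesis .
qed

text \<open>The Gaussian counterpart of \<open>line_kernel_fourier\<close> with the same tilt, so
  that the two can be subtracted under one integral. Completing the square moves the frequency from
  x to x - 2ts.\<close>

lemma gauss_fourier:
  fixes s t x :: real
  assumes t: "0 < t"
  defines "\<zeta> \<equiv> \<lambda>\<theta>. complex_of_real s - \<i> * of_real \<theta>"
  shows "integrable lborel (\<lambda>\<theta>. exp (of_real t * (\<zeta> \<theta>)\<^sup>2) * exp (\<i> * of_real x * of_real \<theta>))"
    and "(CLINT \<theta>|lborel. exp (of_real t * (\<zeta> \<theta>)\<^sup>2) * exp (\<i> * of_real x * of_real \<theta>)) =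
      of_real (2 * pi * (gauss t x * exp (s * x)))"
proof -
  let ?a = "x - 2 * t * s"
  have eq: "(\<lambda>\<theta>. exp (of_real t * (\<zeta> \<theta>)\<^sup>2) * exp (\<i> * of_real x * of_real \<theta>)) =
     (\<lambda>\<theta>. of_real (exp (t * s\<^sup>2)) * (exp (- (of_real (t * \<theta>\<^sup>2))) * exp (\<i> * of_real (?a * \<theta>))))"
    by (rule ext) (simp add: \<zeta>_def exp_of_real[symmetric] mult_exp_exp power2_eq_square algebra_simps)
  have n: "norm (of_real (exp (t * s\<^sup>2)) * (exp (- (of_real (t * \<theta>\<^sup>2))) * exp (\<i> * of_real (?a * \<theta>))) :: complex)
      = exp (t * s\<^sup>2) * exp (- (t * \<theta>\<^sup>2))" for \<theta>
    by (simp add: norm_mult)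
  have i: "integrable lborel (\<lambda>\<theta>. exp (t * s\<^sup>2) * exp (- (t * \<theta>\<^sup>2)))"
    using integral_exp_square(1)[OF t] by simp
  show "integrable lborel (\<lambda>\<theta>. exp (of_real t * (\<zeta> \<theta>)\<^sup>2) * exp (\<i> * of_real x * of_real \<theta>))"
    unfolding eq
    by (rule Bochner_Integration.integrable_bound[OF i]) (use n in auto)
  have "(CLINT \<theta>|lborel. exp (of_real t * (\<zeta> \<theta>)\<^sup>2) * exp (\<i> * of_real x * of_real \<theta>)) =
     of_real (exp (t * s\<^sup>2)) * of_real (sqrt (pi / t) * exp (- (?a\<^sup>2 / (4 * t))))"
    unfolding eq integral_mult_right_zero integral_exp_square_fourier[OF t] ..
  also have "\<dots> = of_real (sqrt (pi / t) * exp (t * s\<^sup>2 - ?a\<^sup>2 / (4 * t)))"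
    by (simp add: exp_diff exp_minus field_simps)
  also have "t * s\<^sup>2 - ?a\<^sup>2 / (4 * t) = s * x - x\<^sup>2 / (4 * t)"
    using t by (simp add: power2_eq_square field_simps)
  also have "sqrt (pi / t) = 2 * pi / sqrt (4 * pi * t)"
    using t by (simp add: real_sqrt_mult real_sqrt_divide field_simps)
  also have "2 * pi / sqrt (4 * pi * t) * exp (s * x - x\<^sup>2 / (4 * t)) = 2 * pi * (gauss t x * exp (s * x))"
  proof -
    have "exp (s * x - z) = exp (- z) * exp (s * x)" for z by (simp add: mult_exp_exp)
    then show ?thesis by (simp add: gauss_def)
  qed
  finally show "(CLINT \<theta>|lborel. exp (of_real t * (\<zeta> \<theta>)\<^sup>2) * exp (\<i> * of_real x * of_real \<theta>)) =
      of_real (2 * pi * (gauss t x * exp (s * x)))" .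
qed

text \<open>Lets the exponential decay swallow a quadratic factor; only half of the decay rate y/6
  available in the next estimate is spent.\<close>

lemma square_le_exp: "0 \<le> y \<Longrightarrow> (1 + y)\<^sup>2 \<le> 576 * exp (y / 12)" for y :: real
proof -
  assume y: "0 \<le> y"
  have "1 + y \<le> 24 * exp (y / 24)"
    using y exp_ge_add_one_self[of "y / 24"] by linarith
  then have "(1 + y)\<^sup>2 \<le> (24 * exp (y / 24))\<^sup>2"
    using y by (intro power_mono) auto
  also have "\<dots> = 576 * exp (y / 12)"
    by (simp add: power_mult_distrib exp_double[symmetric])
  finally show ?thesis .
qed

text \<open>Shifting the contour of the inversion integral by $s = 1/\sqrt t$ keeps all exponents
  bounded and produces the decay $e^{-|n|/\sqrt t}$.\<close>

lemma line_kernel_gauss_pointwise: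
  fixes t \<theta> :: real
  assumes t: "1 \<le> t"
  defines "\<zeta> \<equiv> complex_of_real (1 / sqrt t) - \<i> * of_real \<theta>"
  shows "norm (indicator {-pi..pi} \<theta> *\<^sub>R exp (of_real t * (exp \<zeta> + exp (- \<zeta>) - 2)) - exp (of_real t * \<zeta>\<^sup>2))
    \<le> 576 * exp 2 / t * exp (- (t / 12 * \<theta>\<^sup>2))"
proof -
  define s where "s = 1 / sqrt t"
  have s: "0 < s" "s \<le> 1" "s\<^sup>2 = 1 / t" using t by (auto simp: s_def power_divide)
  have ts: "s * (s * t) = 1" using s(3) t by (simp add: power2_eq_square flip: mult.assoc)
  define y where "y = t * \<theta>\<^sup>2"
  have y: "0 \<le> y" using t by (simp add: y_def)
  have Re\<zeta>: "Re \<zeta> = s" by (simp add: \<zeta>_def s_def)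
  have Reb: "Re (of_real t * \<zeta>\<^sup>2) = 1 - y"
    using ts by (simp add: \<zeta>_def s_def[symmetric] power2_eq_square y_def algebra_simps)
  \<comment> \<open>It suffices to reach the left-hand side in both ranges of \<theta>. The
    quadratic factor takes exp (y/12) out of exp (-y/6).\<close>
  have main: "(1 + y)\<^sup>2 / t * exp (2 - y / 6) \<le> 576 * exp 2 / t * exp (- (t / 12 * \<theta>\<^sup>2))"
  proof -
    have "(1 + y)\<^sup>2 / t * exp (2 - y / 6) \<le> 576 * exp (y / 12) / t * exp (2 - y / 6)"
      using t square_le_exp[OF y] by (intro mult_right_mono divide_right_mono) auto
    also have "\<dots> = 576 / t * (exp (y / 12) * exp (2 - y / 6))" by simp
    also have "exp (y / 12) * exp (2 - y / 6) = exp 2 * exp (- (y / 12))"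
      by (simp add: mult_exp_exp)
    finally show ?thesis by (simp add: y_def)
  qed
  show ?thesis
  proof (cases "\<bar>\<theta>\<bar> \<le> pi")
    case True
    then have ind: "indicator {-pi..pi} \<theta> = (1::real)" by (auto simp: indicator_def)
    have "norm \<zeta> ^ 2 = s\<^sup>2 + \<theta>\<^sup>2" by (simp add: cmod_power2 \<zeta>_def s_def)
    moreover have "norm \<zeta> ^ 4 = (norm \<zeta> ^ 2)\<^sup>2" by (simp flip: power_mult)
    ultimately have "norm \<zeta> ^ 4 = (s\<^sup>2 + \<theta>\<^sup>2)\<^sup>2" by simp
    also have "\<dots> = (1 + y)\<^sup>2 / t\<^sup>2"
      using t s by (simp add: y_def power2_eq_square field_simps)
    finally have n4: "norm \<zeta> ^ 4 = (1 + y)\<^sup>2 / t\<^sup>2" .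
    \<comment> \<open>The exponents differ by at most t times the fourth power of the modulus of
      \<zeta>, and that power is (1 + y)^2 / t^2 since s^2 = 1/t.\<close>
    have "norm (of_real t * (exp \<zeta> + exp (- \<zeta>) - 2) - of_real t * \<zeta>\<^sup>2) =
        t * norm (exp \<zeta> + exp (- \<zeta>) - 2 - \<zeta>\<^sup>2)"
      using t by (simp add: right_diff_distrib[symmetric] norm_mult)
    also have "\<dots> \<le> t * ((1 + y)\<^sup>2 / t\<^sup>2)"
      using t s Re\<zeta> n4 exp_sum_minus_square[of \<zeta>] by (intro mult_left_mono) auto
    finally have d: "norm (of_real t * (exp \<zeta> + exp (- \<zeta>) - 2) - of_real t * \<zeta>\<^sup>2) \<le> (1 + y)\<^sup>2 / t"
      using t by (simp add: power2_eq_square)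
    have e1: "exp s + exp (- s) \<le> 2 + 2 * s\<^sup>2"
      using exp_sum_le_square[of s] s by simp
    have "0 \<le> \<theta>\<^sup>2 / 12" by simp
    have e2: "2 \<le> exp s + exp (- s)"
      using exp_ge_add_one_self[of s] exp_ge_add_one_self[of "-s"] by linarith
    have "Re (exp \<zeta> + exp (- \<zeta>) - 2) = (exp s + exp (- s)) * cos \<theta> - 2"
      by (simp add: Re_exp \<zeta>_def s_def algebra_simps)
    also have "\<dots> \<le> (exp s + exp (- s)) * (1 - \<theta>\<^sup>2 / 12) - 2"
      using cos_le_parabola[OF True] e2 by (intro diff_right_mono mult_left_mono) auto
    also have "\<dots> \<le> 2 * s\<^sup>2 - \<theta>\<^sup>2 / 6"
      using e1 mult_right_mono[OF e2 \<open>0 \<le> \<theta>\<^sup>2 / 12\<close>]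
      unfolding right_diff_distrib mult_1_right by linarith
    finally have aux: "t * Re (exp \<zeta> + exp (- \<zeta>) - 2) \<le> t * (2 * s\<^sup>2 - \<theta>\<^sup>2 / 6)"
      using t by (intro mult_left_mono) simp_all
    then have a: "Re (of_real t * (exp \<zeta> + exp (- \<zeta>) - 2)) \<le> 2 - y / 6"
    proof -
      have "t * (2 * s\<^sup>2 - \<theta>\<^sup>2 / 6) = 2 * (s * (s * t)) - y / 6"
        by (simp add: y_def power2_eq_square algebra_simps)
      with aux show ?thesis unfolding ts by simp
    qed
    have b: "Re (of_real t * \<zeta>\<^sup>2) \<le> 2 - y / 6" using Reb y by simp
    have "norm (exp (of_real t * (exp \<zeta> + exp (- \<zeta>) - 2)) - exp (of_real t * \<zeta>\<^sup>2)) \<le>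
       (1 + y)\<^sup>2 / t * exp (2 - y / 6)"
      by (rule order_trans[OF norm_exp_diff_le[OF a b] mult_right_mono[OF d]]) simp
    then show ?thesis using main ind by simp
  next
    case False
    then have ind: "indicator {-pi..pi} \<theta> = (0::real)" by (auto simp: indicator_def)
    \<comment> \<open>Outside [-pi, pi] only the Gaussian term is left. It already fits the bound,
      because there y \<ge> t \<ge> 1 makes the prefactor (1 + y)^2 / t at least 1.\<close>
    have "1 \<le> \<bar>\<theta>\<bar>" using False pi_gt3 by linarith
    then have "1 \<le> \<theta>\<^sup>2" using one_le_power[of "\<bar>\<theta>\<bar>" 2] by simp
    then have "t * 1 \<le> y" unfolding y_def using t by (intro mult_left_mono) auto
    then have "t * 1 \<le> y * y" using t y by (intro order_trans[of "t * 1" "y * 1" "y * y"] mult_left_mono) auto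
    then have one: "1 \<le> (1 + y)\<^sup>2 / t" using t y by (simp add: power2_eq_square algebra_simps)
    have "norm (exp (of_real t * \<zeta>\<^sup>2)) \<le> 1 * exp (2 - y / 6)"
      using Reb y by simp
    also have "\<dots> \<le> (1 + y)\<^sup>2 / t * exp (2 - y / 6)"
      using one by (rule mult_right_mono) simp
    finally show ?thesis using main ind by simp
  qed
qed

text \<open>With tilt 1 / sqrt t, integrating the pointwise bound gives one factor 1/t from its
  prefactor and one factor 1 / sqrt t from the width of the Gaussian in \<theta>. The tilt itself
  then becomes the spatial decay.\<close>

lemma line_kernel_minus_gauss:
  obtains K where "0 < K" "\<And>t n. 1 \<le> t \<Longrightarrow>
    \<bar>line_kernel t n - gauss t (of_int n)\<bar> \<le> K / (t * sqrt t) * exp (- (\<bar>of_int n\<bar> / sqrt t))"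
proof -
  define K where "K = 576 * exp 2 * sqrt (12 * pi) / (2 * pi)"
  have K: "0 < K" by (simp add: K_def)
  have main: "\<bar>line_kernel t n - gauss t (of_int n)\<bar> * exp (1 / sqrt t * of_int n) \<le> K / (t * sqrt t)"
    if t: "1 \<le> t" for t n
  proof -
    define s where "s = 1 / sqrt t"
    define \<zeta> where "\<zeta> = (\<lambda>\<theta>. complex_of_real s - \<i> * of_real \<theta>)"
    let ?a = "\<lambda>\<theta>. exp (of_real t * (exp (\<zeta> \<theta>) + exp (- \<zeta> \<theta>) - 2)) * exp (\<i> * of_int n * of_real \<theta>)"
    let ?b = "\<lambda>\<theta>. exp (of_real t * (\<zeta> \<theta>)\<^sup>2) * exp (\<i> * of_real (of_int n) * of_real \<theta>)"
    have t0: "0 \<le> t" "0 < t" using t by auto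
    have ia: "set_integrable lborel {-pi..pi} ?a"
      unfolding \<zeta>_def set_integrable_def
      by (intro borel_integrable_compact continuous_intros) auto
    have a: "(CLINT \<theta>|lborel. indicator {-pi..pi} \<theta> *\<^sub>R ?a \<theta>) = of_real (2 * pi * (line_kernel t n * exp (s * of_int n)))"
      using set_borel_integral_eq_integral(2)[OF ia] line_kernel_fourier[OF t0(1), of n s]
      unfolding \<zeta>_def set_lebesgue_integral_def by simp
    have b: "integrable lborel ?b" "(CLINT \<theta>|lborel. ?b \<theta>) = of_real (2 * pi * (gauss t (of_int n) * exp (s * of_int n)))"
      using gauss_fourier[OF t0(2), of s "of_int n"] unfolding \<zeta>_def by auto
    have i: "integrable lborel (\<lambda>\<theta>. 576 * exp 2 / t * exp (- (t / 12 * \<theta>\<^sup>2)))"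
      using integral_exp_square(1)[of "t / 12"] t by simp
    have bd: "norm (indicator {-pi..pi} \<theta> *\<^sub>R ?a \<theta> - ?b \<theta>) \<le> 576 * exp 2 / t * exp (- (t / 12 * \<theta>\<^sup>2))" for \<theta>
    proof -
      have "indicator {-pi..pi} \<theta> *\<^sub>R ?a \<theta> - ?b \<theta> =
        (indicator {-pi..pi} \<theta> *\<^sub>R exp (of_real t * (exp (\<zeta> \<theta>) + exp (- \<zeta> \<theta>) - 2)) - exp (of_real t * (\<zeta> \<theta>)\<^sup>2))
          * exp (\<i> * of_int n * of_real \<theta>)"
        by (simp add: algebra_simps)
      then show ?thesis
        using line_kernel_gauss_pointwise[OF t, of \<theta>]
        by (simp add: norm_mult \<zeta>_def s_def)
    qed
    have "(CLINT \<theta>|lborel. indicator {-pi..pi} \<theta> *\<^sub>R ?a \<theta> - ?b \<theta>) =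
      of_real (2 * pi * ((line_kernel t n - gauss t (of_int n)) * exp (s * of_int n)))"
      unfolding Bochner_Integration.integral_diff[OF ia[unfolded set_integrable_def] b(1)] a b(2)
      by (simp add: algebra_simps)
    then have "norm (complex_of_real (2 * pi * ((line_kernel t n - gauss t (of_int n)) * exp (s * of_int n)))) \<le>
      (LINT \<theta>|lborel. 576 * exp 2 / t * exp (- (t / 12 * \<theta>\<^sup>2)))"
      using order_trans[OF integral_norm_bound integral_mono[OF integrable_norm[OF
          Bochner_Integration.integrable_diff[OF ia[unfolded set_integrable_def] b(1)]] i bd]]
      by (simp only:)
    also have "\<dots> = 576 * exp 2 / t * sqrt (12 * pi / t)"
      using integral_exp_square(2)[of "t / 12"] t by (simp add: mult.commute)
    also have "\<dots> = 2 * pi * (K / (t * sqrt t))"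
      by (simp add: K_def real_sqrt_divide)
    finally have "\<bar>2 * pi * ((line_kernel t n - gauss t (of_int n)) * exp (s * of_int n))\<bar> \<le> 2 * pi * (K / (t * sqrt t))"
      by (simp only: norm_of_real)
    also have "\<bar>2 * pi * ((line_kernel t n - gauss t (of_int n)) * exp (s * of_int n))\<bar> =
        2 * pi * (\<bar>line_kernel t n - gauss t (of_int n)\<bar> * exp (s * of_int n))"
      by (simp add: abs_mult)
    finally show ?thesis
      unfolding s_def by (rule mult_left_le_imp_le) simp
  qed
  show ?thesis
  proof (rule that[OF K])
    fix t :: real and n :: int assume "1 \<le> t"
    from abs_le_exp_mult_le[of "\<lambda>n. \<bar>line_kernel t n - gauss t (of_int n)\<bar>", OF _ main[OF this], of n]
    show "\<bar>line_kernel t n - gauss t (of_int n)\<bar> \<le> K / (t * sqrt t) * exp (- (\<bar>of_int n\<bar> / sqrt t))"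
      by (simp add: gauss_def)
  qed
qed

text \<open>For y = \<bar>x\<bar> / sqrt t, the square (y/2 - 1)^2 \<ge> 0 gives -y^2/4 \<le> 1 - y;
  the factor 3 bounds e.\<close>

lemma gauss_le:
  assumes "0 < t"
  shows "gauss t x \<le> 3 / sqrt t * exp (- (\<bar>x\<bar> / sqrt t))"
proof -
  define y where "y = \<bar>x\<bar> / sqrt t"
  have y2: "x\<^sup>2 / (4 * t) = y\<^sup>2 / 4" using assms by (simp add: y_def power_divide)
  have "0 \<le> (y / 2 - 1)\<^sup>2" by simp
  then have "- (y\<^sup>2 / 4) \<le> 1 + - y" by (simp add: power2_eq_square algebra_simps)
  then have "exp (- (y\<^sup>2 / 4)) \<le> exp (1 + - y)" by simp
  also have "\<dots> = exp 1 * exp (- y)" by (rule exp_add)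
  also have "\<dots> \<le> 3 * exp (- y)" using exp_le by (intro mult_right_mono) auto
  finally have e: "exp (- (y\<^sup>2 / 4)) \<le> 3 * exp (- y)" .
  have "1 * t \<le> 4 * pi * t" using assms pi_gt3 by (intro mult_right_mono) auto
  then have "sqrt t \<le> sqrt (4 * pi * t)" by simp
  then have "gauss t x \<le> 3 * exp (- y) / sqrt t"
    unfolding gauss_def y2 using e assms by (intro frac_le) auto
  then show ?thesis by (simp add: y_def)
qed

lemma line_kernel_le:
  obtains K where "0 < K"
    "\<And>t n. 1 \<le> t \<Longrightarrow> line_kernel t n \<le> K / sqrt t * exp (- (\<bar>of_int n\<bar> / sqrt t))"
proof -
  obtain K where K: "0 < K" "\<And>t n. 1 \<le> t \<Longrightarrow>
    \<bar>line_kernel t n - gauss t (of_int n)\<bar> \<le> K / (t * sqrt t) * exp (- (\<bar>of_int n\<bar> / sqrt t))"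
    using line_kernel_minus_gauss by blast
  show ?thesis
  proof (rule that[of "K + 3"])
    fix t :: real and n :: int assume t: "1 \<le> t"
    let ?e = "exp (- (\<bar>of_int n\<bar> / sqrt t))"
    have "1 * sqrt t \<le> t * sqrt t" using t by (intro mult_right_mono) auto
    then have "K / (t * sqrt t) * ?e \<le> K / sqrt t * ?e"
      using t K(1) by (intro mult_right_mono divide_left_mono) auto
    then have "line_kernel t n \<le> K / sqrt t * ?e + 3 / sqrt t * ?e"
      using K(2)[OF t, of n] gauss_le[of t "of_int n"] t by linarith
    then show "line_kernel t n \<le> (K + 3) / sqrt t * ?e" by (simp add: algebra_simps add_divide_distrib)
  qed (use K in simp)
qed

text \<open>A single term of the generating series at tilt 1 is at most its sum, which is at most
  exp 2 because e + 1/e - 2 \<le> 2.\<close>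

lemma line_kernel_le_small:
  assumes "0 \<le> t" "t \<le> 1"
  shows "line_kernel t n \<le> exp 2 * exp (- \<bar>of_int n\<bar>)"
proof -
  have "line_kernel t n * exp (1 * of_int n) \<le> exp 2" for n
  proof -
    have "(\<Sum>\<^sub>am\<in>{n}. line_kernel t m * exp (1 * of_int m)) \<le> (\<Sum>\<^sub>am. line_kernel t m * exp (1 * of_int m))"
      by (rule infsetsum_mono_neutral_left)
        (use abs_summable_line_kernel_exp(1)[OF assms(1), of 1] line_kernel_nonneg[OF assms(1)] in auto)
    also have "\<dots> = exp (t * (exp 1 + exp (- 1) - 2))"
      by (rule abs_summable_line_kernel_exp(2)[OF assms(1)])
    also have "\<dots> \<le> exp (1 * 2)"
    proof -
      have "exp 1 + exp (- 1) - 2 \<le> (2::real)" using exp_sum_le_square[of 1] by simp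
      moreover have "0 \<le> exp 1 + exp (- 1) - (2::real)"
        using exp_ge_add_one_self[of "1::real"] exp_ge_add_one_self[of "-1::real"] by linarith
      ultimately show ?thesis using assms unfolding exp_le_cancel_iff by (intro mult_mono) auto
    qed
    finally show ?thesis by simp
  qed
  from abs_le_exp_mult_le[of "line_kernel t" 1, OF _ this, of n] show ?thesis by simp
qed

section \<open>The heat kernel of the lattice\<close>

definition lattice_kernel :: "real \<Rightarrow> int^'n \<Rightarrow> real" where
  "lattice_kernel t x = (\<Prod>i\<in>UNIV. line_kernel t (x $ i))"

lemma zsqnorm_axis [simp]: "zsqnorm (axis i k :: int^'n) = k\<^sup>2"
proof -
  have "zsqnorm (axis i k :: int^'n) = (\<Sum>j\<in>UNIV. if j = i then k\<^sup>2 else 0)"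
    unfolding zsqnorm_def by (intro sum.cong) (auto simp: axis_def)
  then show ?thesis by simp
qed

lemma zsqnorm_eq_1D:
  fixes z :: "int^'n"
  assumes "zsqnorm z = 1"
  obtains i where "z = axis i 1 \<or> z = axis i (-1)"
proof -
  obtain i where i: "z $ i \<noteq> 0"
    using assms unfolding zsqnorm_def by (metis sum.neutral zero_neq_one zero_power2)
  have split: "(z $ i)\<^sup>2 + (\<Sum>j\<in>UNIV - {i}. (z $ j)\<^sup>2) = 1"
    using assms unfolding zsqnorm_def by (subst (asm) sum.remove[of _ i]) auto
  have nn: "0 \<le> (\<Sum>j\<in>UNIV - {i}. (z $ j)\<^sup>2)" by (intro sum_nonneg) auto
  have "1 \<le> (z $ i)\<^sup>2" using i by (simp add: int_one_le_iff_zero_less)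
  then have one: "(z $ i)\<^sup>2 = 1" and "(\<Sum>j\<in>UNIV - {i}. (z $ j)\<^sup>2) = 0" using split nn by linarith+
  then have "\<And>j. j \<noteq> i \<Longrightarrow> z $ j = 0"
    by (subst (asm) sum_nonneg_eq_0_iff) auto
  then have "z = axis i (z $ i)" by (auto simp: vec_eq_iff axis_def)
  then show ?thesis using that one by (metis power2_eq_1_iff)
qed

lemma nbrs_eq: "nbrs (x :: int^'n) = (\<lambda>i. x + axis i 1) ` UNIV \<union> (\<lambda>i. x - axis i 1) ` UNIV"
proof -
  have m: "- axis i 1 = (axis i (-1) :: int^'n)" for i by (auto simp: vec_eq_iff axis_def)
  show ?thesis
  proof (intro equalityI subsetI)
    fix y assume "y \<in> nbrs x"
    then have "zsqnorm (y - x) = 1" by (simp add: nbrs_def)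
    then obtain i where "y - x = axis i 1 \<or> y - x = axis i (-1)" by (rule zsqnorm_eq_1D)
    then have "y = x + axis i 1 \<or> y = x - axis i 1"
      unfolding m[symmetric] by (auto simp: algebra_simps)
    then show "y \<in> (\<lambda>i. x + axis i 1) ` UNIV \<union> (\<lambda>i. x - axis i 1) ` UNIV" by auto
  qed (auto simp: nbrs_def m)
qed

lemma finite_nbrs [simp]: "finite (nbrs (x :: int^'n))"
  by (simp add: nbrs_eq)

lemma axis_1_inj: "axis i 1 = (axis j 1 :: int^'n) \<longleftrightarrow> i = j"
  by (auto simp: vec_eq_iff axis_def split: if_splits)

lemma axis_1_neq: "axis i 1 \<noteq> (- axis j 1 :: int^'n)"
proof
  assume "axis i 1 = (- axis j 1 :: int^'n)"
  then have "(axis i 1 :: int^'n) $ i = (- axis j 1 :: int^'n) $ i" by simp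
  then show False by (simp add: axis_def split: if_splits)
qed

lemma lap_eq:
  "lap f (x :: int^'n) = (\<Sum>i\<in>UNIV. 2 * f x - f (x + axis i 1) - f (x - axis i 1))"
proof -
  have "lap f x = (\<Sum>y\<in>(\<lambda>i. x + axis i 1) ` UNIV. f x - f y) + (\<Sum>y\<in>(\<lambda>i. x - axis i 1) ` UNIV. f x - f y)"
    unfolding lap_def nbrs_eq
  proof (rule sum.union_disjoint)
    have "x + axis i 1 \<noteq> x - axis j 1" for i j
      using axis_1_neq[of i j] by (metis add_left_cancel diff_conv_add_uminus)
    then show "(\<lambda>i. x + axis i 1) ` UNIV \<inter> (\<lambda>i. x - axis i 1) ` UNIV = {}" by blast
  qed auto
  also have "\<dots> = (\<Sum>i\<in>UNIV. f x - f (x + axis i 1)) + (\<Sum>i\<in>UNIV. f x - f (x - axis i 1))"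
    by (subst (1 2) sum.reindex) (auto simp: inj_on_def axis_1_inj)
  also have "\<dots> = (\<Sum>i\<in>UNIV. 2 * f x - f (x + axis i 1) - f (x - axis i 1))"
    by (simp add: sum.distrib[symmetric] algebra_simps)
  finally show ?thesis .
qed

lemma abs_lap_le:
  fixes f :: "int^'n \<Rightarrow> real" and M :: real
  assumes "\<And>x. \<bar>f x\<bar> \<le> M"
  shows "\<bar>lap f x\<bar> \<le> 4 * real CARD('n) * M"
proof -
  have "\<bar>lap f x\<bar> \<le> (\<Sum>i\<in>(UNIV::'n set). \<bar>2 * f x - f (x + axis i 1) - f (x - axis i 1)\<bar>)"
    unfolding lap_eq by (rule sum_abs)
  also have "\<dots> \<le> (\<Sum>i\<in>(UNIV::'n set). 4 * M)"
  proof (rule sum_mono)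
    fix i
    show "\<bar>2 * f x - f (x + axis i 1) - f (x - axis i 1)\<bar> \<le> 4 * M"
      using assms[of x] assms[of "x + axis i 1"] assms[of "x - axis i 1"] by linarith
  qed
  finally show ?thesis by (simp add: mult_ac)
qed

lemma abs_funpow_lap_le:
  fixes f :: "int^'n \<Rightarrow> real" and M :: real
  assumes "\<And>x. \<bar>f x\<bar> \<le> M"
  shows "\<bar>(lap ^^ k) f x\<bar> \<le> (4 * real CARD('n)) ^ k * M"
proof (induction k arbitrary: x)
  case (Suc k)
  then show ?case using abs_lap_le[of "(lap ^^ k) f" "(4 * real CARD('n)) ^ k * M" x] by (simp add: mult_ac)
qed (use assms in simp)

text \<open>Uniqueness of bounded solutions of the heat equation, by Taylor expansion in time.\<close>

lemma heat_series_sums: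
  fixes F :: "real \<Rightarrow> int^'n \<Rightarrow> real"
  assumes deriv: "\<And>t x. ((\<lambda>t. F t x) has_real_derivative - lap (F t) x) (at t)"
    and bd: "\<And>t x. 0 \<le> t \<Longrightarrow> \<bar>F t x\<bar> \<le> M"
    and t: "0 \<le> t"
  shows "(\<lambda>k. (- t) ^ k / fact k * (lap ^^ k) (F 0) x) sums F t x"
proof (cases "t = 0")
  case True
  then show ?thesis
    using sums_If_finite_set[of "{0}" "\<lambda>k. (- t) ^ k / fact k * (lap ^^ k) (F 0) x"]
    by (auto simp: power_0_left intro: sums_cong[THEN iffD1, rotated])
next
  case False
  have D: "((\<lambda>t. (lap ^^ m) (F t) x) has_real_derivative - (lap ^^ Suc m) (F t) x) (at t)" for m t x
  proof (induction m arbitrary: x)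
    case 0
    show ?case using deriv by simp
  next
    case (Suc m)
    have "((\<lambda>t. \<Sum>y\<in>nbrs x. (lap ^^ m) (F t) x - (lap ^^ m) (F t) y) has_real_derivative
       (\<Sum>y\<in>nbrs x. - (lap ^^ Suc m) (F t) x - - (lap ^^ Suc m) (F t) y)) (at t)"
      by (intro DERIV_sum DERIV_diff Suc)
    moreover have "(\<Sum>y\<in>nbrs x. - (lap ^^ Suc m) (F t) x - - (lap ^^ Suc m) (F t) y) =
        - lap ((lap ^^ Suc m) (F t)) x"
      unfolding lap_def[of "(lap ^^ Suc m) (F t)"] sum_negf[symmetric] by (intro sum.cong) auto
    moreover have "(lap ^^ Suc m) (F t) x = (\<Sum>y\<in>nbrs x. (lap ^^ m) (F t) x - (lap ^^ m) (F t) y)" for t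
      by (simp add: lap_def[of "(lap ^^ m) (F t)"])
    ultimately show ?case
      unfolding funpow.simps(2)[of "Suc m"] o_apply by (simp only:)
  qed
  define diff where "diff = (\<lambda>m t. (-1) ^ m * (lap ^^ m) (F t) x)"
  have "DERIV (diff m) t :> diff (Suc m) t" for m t
    unfolding diff_def by (rule derivative_eq_intros D refl)+ simp
  then have MC: "\<exists>u. 0 < u \<and> u \<le> t \<and> F t x = (\<Sum>m<n. diff m 0 / fact m * t ^ m) + diff n u / fact n * t ^ n" for n
    using Maclaurin2[of t diff "\<lambda>t. F t x" n] t False by (auto simp: diff_def)
  let ?S = "\<lambda>n. \<Sum>m<n. (- t) ^ m / fact m * (lap ^^ m) (F 0) x"
  have S: "(\<Sum>m<n. diff m 0 / fact m * t ^ m) = ?S n" for n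
    by (intro sum.cong) (auto simp: diff_def power_minus[of t])
  \<comment> \<open>The Taylor remainder: on bounded functions \<open>lap\<close> has norm at most
    4d, so the n-th time derivative is at most (4d)^n M at every nonnegative time.\<close>
  let ?R = "\<lambda>n. M * (inverse (fact n) * (4 * real CARD('n) * t) ^ n)"
  have bound: "norm (?S n - F t x) \<le> ?R n" for n
  proof -
    obtain u where u: "0 < u" "F t x = ?S n + diff n u / fact n * t ^ n"
      using MC[of n] unfolding S by auto
    have "\<bar>(lap ^^ n) (F u) x\<bar> \<le> (4 * real CARD('n)) ^ n * M"
      by (rule abs_funpow_lap_le) (use bd u in auto)
    then have "\<bar>(lap ^^ n) (F u) x\<bar> * (t ^ n / fact n) \<le> ((4 * real CARD('n)) ^ n * M) * (t ^ n / fact n)"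
      using t by (intro mult_right_mono) auto
    moreover have "norm (?S n - F t x) = \<bar>(lap ^^ n) (F u) x\<bar> * (t ^ n / fact n)"
      using t unfolding u(2) diff_def by (simp add: abs_mult power_abs)
    ultimately show ?thesis by (simp add: power_mult_distrib field_simps)
  qed
  have R: "?R \<longlonglongrightarrow> M * 0"
    by (intro tendsto_mult tendsto_const summable_LIMSEQ_zero summable_exp)
  have "(\<lambda>n. ?S n - F t x) \<longlonglongrightarrow> 0"
  proof (rule Lim_null_comparison)
    show "\<forall>\<^sub>F n in sequentially. norm (?S n - F t x) \<le> ?R n"
      by (intro always_eventually allI bound)
    show "?R \<longlonglongrightarrow> 0" using R by (simp only: mult_zero_right)
  qed
  then show ?thesis
    unfolding sums_def using LIM_zero_iff by blast
qed

lemma DERIV_prod: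
  fixes f :: "'i \<Rightarrow> real \<Rightarrow> real"
  assumes "finite I" "\<And>i. i \<in> I \<Longrightarrow> (f i has_real_derivative f' i) (at t)"
  shows "((\<lambda>t. \<Prod>i\<in>I. f i t) has_real_derivative (\<Sum>i\<in>I. f' i * (\<Prod>j\<in>I - {i}. f j t))) (at t)"
  using assms
proof (induction I)
  case (insert i I)
  have "((\<lambda>t. f i t * (\<Prod>i\<in>I. f i t)) has_real_derivative
     f' i * (\<Prod>i\<in>I. f i t) + (\<Sum>k\<in>I. f' k * (\<Prod>j\<in>I - {k}. f j t)) * f i t) (at t)"
    using insert by (intro DERIV_mult) auto
  moreover have "(\<Sum>k\<in>I. f' k * (\<Prod>j\<in>I - {k}. f j t)) * f i t =
      (\<Sum>k\<in>I. f' k * (\<Prod>j\<in>insert i I - {k}. f j t))"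
    unfolding sum_distrib_right
  proof (rule sum.cong[OF refl])
    fix k assume k: "k \<in> I"
    have "insert i I - {k} = insert i (I - {k})" using insert k by auto
    then show "f' k * (\<Prod>j\<in>I - {k}. f j t) * f i t = f' k * (\<Prod>j\<in>insert i I - {k}. f j t)"
      using insert by simp
  qed
  moreover have "insert i I - {i} = I" using insert by auto
  ultimately show ?case using insert by (simp add: mult_ac)
qed simp

lemma lattice_kernel_remove:
  "lattice_kernel t (x :: int^'n) = line_kernel t (x $ i) * (\<Prod>j\<in>UNIV - {i}. line_kernel t (x $ j))"
  unfolding lattice_kernel_def by (rule prod.remove) auto

lemma DERIV_lattice_kernel:
  "((\<lambda>t. lattice_kernel t (x :: int^'n)) has_real_derivative - lap (lattice_kernel t) x) (at t)"
proof -
  let ?r = "\<lambda>i. \<Prod>j\<in>UNIV - {i}. line_kernel t (x $ j)"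
  have "((\<lambda>t. lattice_kernel t x) has_real_derivative
    (\<Sum>i\<in>UNIV. (line_kernel t (x $ i + 1) + line_kernel t (x $ i - 1) - 2 * line_kernel t (x $ i)) * ?r i)) (at t)"
    unfolding lattice_kernel_def by (intro DERIV_prod DERIV_line_kernel) auto
  moreover have "(\<Sum>i\<in>UNIV. (line_kernel t (x $ i + 1) + line_kernel t (x $ i - 1) - 2 * line_kernel t (x $ i)) * ?r i)
    = - lap (lattice_kernel t) x"
    unfolding lap_eq sum_negf[symmetric]
  proof (intro sum.cong refl)
    fix i
    have "lattice_kernel t (x + axis i 1) = line_kernel t (x $ i + 1) * ?r i"
      unfolding lattice_kernel_remove[of t "x + axis i 1" i] by (auto simp: axis_def intro!: prod.cong)
    moreover have "lattice_kernel t (x - axis i 1) = line_kernel t (x $ i - 1) * ?r i"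
      unfolding lattice_kernel_remove[of t "x - axis i 1" i] by (auto simp: axis_def intro!: prod.cong)
    ultimately show "(line_kernel t (x $ i + 1) + line_kernel t (x $ i - 1) - 2 * line_kernel t (x $ i)) * ?r i =
      - (2 * lattice_kernel t x - lattice_kernel t (x + axis i 1) - lattice_kernel t (x - axis i 1))"
      using lattice_kernel_remove[of t x i] by (simp add: algebra_simps)
  qed
  ultimately show ?thesis by simp
qed

lemma lattice_kernel_nonneg: "0 \<le> t \<Longrightarrow> 0 \<le> lattice_kernel t x"
  by (simp add: lattice_kernel_def prod_nonneg line_kernel_nonneg)

lemma lattice_kernel_pos: "0 < t \<Longrightarrow> 0 < lattice_kernel t x"
  by (simp add: lattice_kernel_def prod_pos line_kernel_pos)

lemma lattice_kernel_le_1: "0 \<le> t \<Longrightarrow> lattice_kernel t x \<le> 1"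
  by (simp add: lattice_kernel_def prod_le_1 line_kernel_nonneg line_kernel_le_1)

lemma lattice_kernel_minus [simp]: "lattice_kernel t (- x) = lattice_kernel t x"
  by (simp add: lattice_kernel_def)

lemma lattice_kernel_0: "lattice_kernel 0 = delta0"
proof (rule ext)
  fix x :: "int^'n"
  show "lattice_kernel 0 x = delta0 x"
  proof (cases "x = 0")
    case False
    then obtain i where "x $ i \<noteq> 0" by (auto simp: vec_eq_iff)
    then have "\<exists>i\<in>UNIV. line_kernel 0 (x $ i) = 0" by (auto simp: line_kernel_0)
    then show ?thesis using False by (simp add: lattice_kernel_def delta0_def)
  qed (simp add: lattice_kernel_def delta0_def line_kernel_0)
qed

text \<open>The term of order 0 of the Bessel series is the probability exp (-2dt) of not having
  jumped. The resulting linear bound on 1 - p_t(0) makes the integrals against t^(-1-\<sigma>)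
  converge at t = 0.\<close>

lemma lattice_kernel_0_ge:
  fixes t :: real
  shows "0 \<le> t \<Longrightarrow> 1 - 2 * real CARD('n) * t \<le> lattice_kernel t (0 :: int^'n)"
proof -
  assume t: "0 \<le> t"
  have "1 - 2 * real CARD('n) * t \<le> exp (- (2 * real CARD('n) * t))"
    using exp_ge_add_one_self[of "- (2 * real CARD('n) * t)"] by simp
  also have "\<dots> = exp (-2 * t) ^ CARD('n)" by (simp flip: exp_of_nat_mult add: mult_ac)
  also have "\<dots> \<le> line_kernel t 0 ^ CARD('n)"
    by (intro power_mono line_kernel_0_ge) auto
  finally show ?thesis by (simp add: lattice_kernel_def)
qed

lemma continuous_on_lattice_kernel [continuous_intros]: "continuous_on A (\<lambda>t. lattice_kernel t x)"
  unfolding lattice_kernel_def by (intro continuous_intros)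

lemma borel_measurable_lattice_kernel [measurable]: "(\<lambda>t. lattice_kernel t x) \<in> borel_measurable borel"
  by (intro borel_measurable_continuous_onI continuous_intros)

lemma lap_shift: "lap (\<lambda>z. f (z - y)) (x :: int^'n) = lap f (x - y)"
  by (simp add: lap_eq algebra_simps)

text \<open>The convolution with the product kernel is a bounded solution of the heat equation with
  initial value \<phi>, so \<open>heat_series_sums\<close> identifies it with the exponential series
  that defines \<open>heat\<close>.\<close>

lemma heat_fin_supp:
  fixes \<phi> :: "int^'n \<Rightarrow> real"
  assumes "fin_supp \<phi>" "0 \<le> t"
  shows "heat t \<phi> x = (\<Sum>y | \<phi> y \<noteq> 0. lattice_kernel t (x - y) * \<phi> y)"
proof -
  define S where "S = {y. \<phi> y \<noteq> 0}"
  have S: "finite S" using assms by (simp add: S_def fin_supp_def)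
  define F where "F = (\<lambda>t x. \<Sum>y\<in>S. lattice_kernel t (x - y) * \<phi> y)"
  have lin: "lap (F t) x = (\<Sum>y\<in>S. lap (lattice_kernel t) (x - y) * \<phi> y)" for t x
    unfolding F_def lap_def[of "\<lambda>x. \<Sum>y\<in>S. _ x y"] lap_shift[symmetric]
    unfolding lap_def sum_distrib_right sum_subtractf[symmetric]
    by (subst sum.swap) (simp add: algebra_simps)
  have "(\<lambda>k. (- t) ^ k / fact k * (lap ^^ k) (F 0) x) sums F t x"
  proof (rule heat_series_sums)
    show "((\<lambda>t. F t x) has_real_derivative - lap (F t) x) (at t)" for t x
    proof -
      have "((\<lambda>t. F t x) has_real_derivative (\<Sum>y\<in>S. - lap (lattice_kernel t) (x - y) * \<phi> y)) (at t)"
        unfolding F_def by (intro DERIV_sum DERIV_cmult_right DERIV_lattice_kernel)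
      then show ?thesis unfolding lin by (simp add: sum_negf)
    qed
    show "\<bar>F t x\<bar> \<le> (\<Sum>y\<in>S. \<bar>\<phi> y\<bar>)" if "0 \<le> t" for t x
    proof -
      have "\<bar>F t x\<bar> \<le> (\<Sum>y\<in>S. \<bar>lattice_kernel t (x - y) * \<phi> y\<bar>)" unfolding F_def by (rule sum_abs)
      also have "\<dots> \<le> (\<Sum>y\<in>S. \<bar>\<phi> y\<bar>)"
      proof (rule sum_mono)
        fix y
        have "\<bar>lattice_kernel t (x - y)\<bar> \<le> 1"
          using lattice_kernel_nonneg[OF that, of "x - y"] lattice_kernel_le_1[OF that, of "x - y"] by simp
        then show "\<bar>lattice_kernel t (x - y) * \<phi> y\<bar> \<le> \<bar>\<phi> y\<bar>"
          by (simp add: abs_mult mult_left_le_one_le)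
      qed
      finally show ?thesis .
    qed
  qed fact
  moreover have "F 0 = \<phi>"
  proof (rule ext)
    fix x
    have "F 0 x = (\<Sum>y\<in>S. if y = x then \<phi> y else 0)"
      unfolding F_def lattice_kernel_0 delta0_def by (intro sum.cong) auto
    then show "F 0 x = \<phi> x" using S by (simp add: S_def)
  qed
  ultimately show ?thesis unfolding heat_def by (simp add: sums_iff F_def S_def)
qed

lemma heat_kernel_eq: "0 \<le> t \<Longrightarrow> heat_kernel t (x :: int^'n) = lattice_kernel t x"
proof -
  assume t: "0 \<le> t"
  have "{y :: int^'n. delta0 y \<noteq> 0} = {0}" by (auto simp: delta0_def)
  then show ?thesis
    using heat_fin_supp[of delta0 t x] t by (simp add: heat_kernel_def fin_supp_def delta0_def)
qed

lemma infsetsum_prod_vec: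
  fixes f :: "'n::finite \<Rightarrow> int \<Rightarrow> real"
  assumes "\<And>i. f i abs_summable_on UNIV"
  shows "(\<lambda>x::int^'n. \<Prod>i\<in>UNIV. f i (x $ i)) abs_summable_on UNIV"
    and "(\<Sum>\<^sub>ax::int^'n. \<Prod>i\<in>UNIV. f i (x $ i)) = (\<Prod>i\<in>UNIV. infsetsum (f i) UNIV)"
proof -
  let ?g = "\<lambda>h. \<Prod>i\<in>UNIV. f i (h i)"
  have bij: "bij_betw vec_nth (UNIV :: (int^'n) set) UNIV"
    by (rule bij_betwI[of _ _ _ vec_lambda]) auto
  have P: "PiE (UNIV :: 'n set) (\<lambda>_. UNIV :: int set) = UNIV" by auto
  have "?g abs_summable_on PiE UNIV (\<lambda>_. UNIV)"
    by (rule abs_summable_on_prod_PiE) (use assms in auto)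
  then show "(\<lambda>x::int^'n. \<Prod>i\<in>UNIV. f i (x $ i)) abs_summable_on UNIV"
    using abs_summable_on_reindex_bij_betw[OF bij, of ?g] unfolding P by simp
  have "infsetsum ?g (PiE UNIV (\<lambda>_. UNIV)) = (\<Prod>i\<in>UNIV. infsetsum (f i) UNIV)"
    by (rule infsetsum_prod_PiE) (use assms in auto)
  then show "(\<Sum>\<^sub>ax::int^'n. \<Prod>i\<in>UNIV. f i (x $ i)) = (\<Prod>i\<in>UNIV. infsetsum (f i) UNIV)"
    using infsetsum_reindex_bij_betw[OF bij, of ?g] unfolding P by simp
qed

lemma abs_summable_lattice_kernel:
  "0 \<le> t \<Longrightarrow> (lattice_kernel t :: int^'n \<Rightarrow> real) abs_summable_on UNIV"
  unfolding lattice_kernel_def[abs_def]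
  by (rule infsetsum_prod_vec) (rule abs_summable_line_kernel)

lemma infsetsum_lattice_kernel:
  "0 \<le> t \<Longrightarrow> infsetsum (lattice_kernel t :: int^'n \<Rightarrow> real) UNIV = 1"
  unfolding lattice_kernel_def[abs_def]
  by (subst infsetsum_prod_vec(2)) (simp_all add: abs_summable_line_kernel infsetsum_line_kernel)

lemma abs_summable_kernel_shift:
  fixes k :: "int^'n \<Rightarrow> real"
  assumes "k abs_summable_on UNIV"
  shows "(\<lambda>y. k (x - y)) abs_summable_on UNIV" "(\<Sum>\<^sub>ay. k (x - y)) = infsetsum k UNIV"
proof -
  have bij: "bij_betw (\<lambda>y. x - y) UNIV (UNIV :: (int^'n) set)"
    by (rule bij_betwI[of _ _ _ "\<lambda>y. x - y"]) auto
  show "(\<lambda>y. k (x - y)) abs_summable_on UNIV"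
    using abs_summable_on_reindex_bij_betw[OF bij, of k] assms by simp
  show "(\<Sum>\<^sub>ay. k (x - y)) = infsetsum k UNIV"
    by (rule infsetsum_reindex_bij_betw[OF bij])
qed

lemma lattice_kernel_semigroup:
  fixes x :: "int^'n"
  assumes "0 \<le> t" "0 \<le> s"
  shows "(\<Sum>\<^sub>ay. lattice_kernel t (x - y) * lattice_kernel s y) = lattice_kernel (t + s) x"
proof -
  let ?f = "\<lambda>i m. line_kernel t (x $ i - m) * line_kernel s m"
  have f: "?f i abs_summable_on UNIV" for i
  proof (rule abs_summable_on_comparison_test[OF abs_summable_line_kernel[OF assms(2)]])
    show "norm (?f i m) \<le> norm (line_kernel s m)" for m
      using line_kernel_nonneg[OF assms(1), of "x $ i - m"] line_kernel_le_1[OF assms(1), of "x $ i - m"]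
      by (simp add: abs_mult mult_left_le_one_le)
  qed
  have eq: "(\<lambda>y. lattice_kernel t (x - y) * lattice_kernel s y) = (\<lambda>y. \<Prod>i\<in>UNIV. ?f i (y $ i))"
    by (simp add: lattice_kernel_def prod.distrib)
  show ?thesis
    unfolding eq infsetsum_prod_vec(2)[of ?f, OF f] line_kernel_semigroup[OF assms]
    by (simp add: lattice_kernel_def)
qed

section \<open>Gamma and power integrals over the half-line\<close>

lemma set_integral_lborel_nonneg:
  fixes f :: "real \<Rightarrow> real"
  assumes I: "(f has_integral I) S" and nn: "\<And>x. x \<in> S \<Longrightarrow> 0 \<le> f x"
    and m: "f \<in> borel_measurable borel" "S \<in> sets borel"
  shows "set_integrable lborel S f" "(LINT x:S|lborel. f x) = I"
proof -
  have "has_bochner_integral lborel (\<lambda>x. indicator S x *\<^sub>R f x) I"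
  proof (rule has_bochner_integral_nn_integral)
    show "(\<integral>\<^sup>+x. ennreal (indicator S x *\<^sub>R f x) \<partial>lborel) = ennreal I"
      using nn_integral_has_integral_lebesgue[OF nn I] by simp
    show "0 \<le> I" using has_integral_nonneg[OF I nn] .
    show "AE x in lborel. 0 \<le> indicator S x *\<^sub>R f x"
      using nn by (auto simp: indicator_def)
  qed (use m in measurable)
  then show "set_integrable lborel S f" "(LINT x:S|lborel. f x) = I"
    unfolding set_integrable_def set_lebesgue_integral_def
    by (auto simp: has_bochner_integral_iff)
qed

text \<open>Substituting $y = c t^p$ in the Gamma integral.\<close>

lemma Gamma_integral_powr:
  fixes p c x :: real
  assumes c: "0 < c" and p: "p \<noteq> 0" and x: "0 < x"
  shows "set_integrable lborel {0<..} (\<lambda>t. t powr (p * x - 1) * exp (- (c * t powr p)))"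
    and "(LINT t:{0<..}|lborel. t powr (p * x - 1) * exp (- (c * t powr p))) = Gamma x / (\<bar>p\<bar> * c powr x)"
proof -
  let ?f = "\<lambda>y::real. y powr (x - 1) / exp y"
  let ?g = "\<lambda>t. c * t powr p"
  let ?g' = "\<lambda>t. c * (p * t powr (p - 1))"
  let ?h = "\<lambda>t. t powr (p * x - 1) * exp (- (c * t powr p))"
  have f0: "(?f has_integral Gamma x) {0<..}"
  proof -
    \<comment> \<open>The two domains differ only at 0, where the integrand vanishes by the
      convention \<open>0 powr a = 0\<close>.\<close>
    have e: "{y \<in> {0..} - {0<..}. ?f y \<noteq> 0} = {}" "{y \<in> {0<..} - {0..}. ?f y \<noteq> 0} = {}" by auto
    have "(?f has_integral Gamma x) {0..} \<longleftrightarrow> (?f has_integral Gamma x) {0<..}"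
      by (rule has_integral_spike_set_eq) (simp_all only: e negligible_empty)
    then show ?thesis using Gamma_integral_real[OF x] by simp
  qed
  then have fa: "?f absolutely_integrable_on {0<..}"
    by (intro nonnegative_absolutely_integrable_1) (auto intro: has_integral_integrable)
  have img: "?g ` {0<..} = {0<..}"
  proof (intro equalityI subsetI)
    fix y :: real assume y: "y \<in> {0<..}"
    then have "y = ?g ((y / c) powr (1 / p))" using c p by (simp add: powr_powr)
    then show "y \<in> ?g ` {0<..}" using y c by (intro image_eqI[of _ _ "(y / c) powr (1 / p)"]) auto
  qed (use c in auto)
  have inj: "inj_on ?g {0<..}"
  proof (rule inj_onI)
    fix a b :: real assume ab: "a \<in> {0<..}" "b \<in> {0<..}" "?g a = ?g b"
    then have "(a powr p) powr (1 / p) = (b powr p) powr (1 / p)" using c by simp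
    then show "a = b" using ab p by (simp add: powr_powr)
  qed
  have der: "(?g has_field_derivative ?g' t) (at t within {0<..})" if "t \<in> {0<..}" for t
    using that by (auto intro!: derivative_eq_intros)
  have A: "(\<lambda>t. \<bar>?g' t\<bar> * ?f (?g t)) absolutely_integrable_on {0<..} \<and>
      integral {0<..} (\<lambda>t. \<bar>?g' t\<bar> * ?f (?g t)) = Gamma x"
    using has_absolute_integral_change_of_variables_1'[OF _ der inj, of ?f "Gamma x"] fa f0
    unfolding img by (auto simp: integral_unique)
  have eq: "\<bar>?g' t\<bar> * ?f (?g t) = (\<bar>p\<bar> * c powr x) * ?h t" if "t \<in> {0<..}" for t
  proof -
    have "t powr (p * x - 1) = t powr ((p - 1) + p * (x - 1))" by (simp add: algebra_simps)
    then have "t powr (p * x - 1) = t powr (p - 1) * t powr (p * (x - 1))" by (simp only: powr_add)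
    moreover have "c powr x = c * c powr (x - 1)" using c powr_add[of c 1 "x - 1"] by simp
    ultimately show ?thesis
      using that c by (simp add: abs_mult powr_mult powr_powr exp_minus divide_inverse)
  qed
  have "((\<lambda>t. \<bar>?g' t\<bar> * ?f (?g t)) has_integral Gamma x) {0<..}"
    using integrable_integral[OF conjunct1[OF absolutely_integrable_on_def[THEN iffD1, OF conjunct1[OF A]]]]
    unfolding conjunct2[OF A] .
  then have "((\<lambda>t. (\<bar>p\<bar> * c powr x) * ?h t) has_integral Gamma x) {0<..}"
    by (rule has_integral_eq[rotated]) (use eq in auto)
  from has_integral_mult_right[OF this, of "1 / (\<bar>p\<bar> * c powr x)"]
  have "(?h has_integral Gamma x / (\<bar>p\<bar> * c powr x)) {0<..}"
    using p c by simp
  from set_integral_lborel_nonneg[OF this]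
  show "set_integrable lborel {0<..} ?h" "(LINT t:{0<..}|lborel. ?h t) = Gamma x / (\<bar>p\<bar> * c powr x)"
    by auto
qed

lemma set_integrable_powr_0_1:
  assumes "0 < a"
  shows "set_integrable lborel {0<..1} (\<lambda>t::real. t powr (a - 1))"
proof -
  have "set_integrable lborel {0..1} (\<lambda>t::real. t powr (a - 1))"
    by (rule set_integral_lborel_nonneg[OF has_integral_powr_from_0]) (use assms in auto)
  then show ?thesis by (rule set_integrable_subset) auto
qed

lemma set_integrable_powr_1_inf:
  assumes "0 < b"
  shows "set_integrable lborel {1<..} (\<lambda>t::real. t powr (- b - 1))"
proof -
  have "set_integrable lborel {1..} (\<lambda>t::real. t powr (- b - 1))"
    by (rule set_integral_lborel_nonneg[OF has_integral_powr_to_inf]) (use assms in auto)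
  then show ?thesis by (rule set_integrable_subset) auto
qed

text \<open>The standard majorant of the time integrals below: one power controls short times,
  another controls long times.\<close>

lemma set_integrable_two_powers:
  assumes "0 < a" "0 < b"
  shows "set_integrable lborel {0<..} (\<lambda>t::real. if t \<le> 1 then t powr (a - 1) else t powr (- b - 1))"
proof -
  let ?f = "\<lambda>t::real. if t \<le> 1 then t powr (a - 1) else t powr (- b - 1)"
  have "set_integrable lborel {0<..1} ?f"
    using set_integrable_powr_0_1[OF assms(1)] by (subst set_integrable_cong) auto
  moreover have "set_integrable lborel {1<..} ?f"
    using set_integrable_powr_1_inf[OF assms(2)] by (subst set_integrable_cong) auto
  ultimately have "set_integrable lborel ({0<..1} \<union> {1<..}) ?f"
    by (rule set_integrable_Un) auto
  moreover have "{0<..1} \<union> {1<..} = ({0<..} :: real set)" by auto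
  ultimately show ?thesis by simp
qed

section \<open>The lattice kernel against the product Gaussian\<close>

text \<open>Replacing one factor at a time: each replacement costs a relative error \<epsilon>
  measured against the common majorant M.\<close>

lemma abs_prod_diff_le:
  fixes a b M :: "'i \<Rightarrow> real" and \<epsilon> :: real
  assumes "finite I" "\<And>i. i \<in> I \<Longrightarrow> \<bar>a i\<bar> \<le> M i" "\<And>i. i \<in> I \<Longrightarrow> \<bar>b i\<bar> \<le> M i"
    and "\<And>i. i \<in> I \<Longrightarrow> \<bar>a i - b i\<bar> \<le> \<epsilon> * M i"
  shows "\<bar>prod a I - prod b I\<bar> \<le> real (card I) * \<epsilon> * prod M I"
  using assms
proof (induction I)
  case (insert i I)
  have M0: "0 \<le> M j" if "j \<in> insert i I" for j
    using insert.prems(1)[OF that] by linarith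
  have \<epsilon>M: "0 \<le> \<epsilon> * M i" using insert.prems(3)[of i] by auto
  have PM: "0 \<le> prod M I" using M0 by (intro prod_nonneg) auto
  have pa: "\<bar>prod a I\<bar> \<le> prod M I" unfolding abs_prod using insert.prems by (intro prod_mono) auto
  have IH: "\<bar>prod a I - prod b I\<bar> \<le> real (card I) * \<epsilon> * prod M I" using insert by auto
  have "a i * prod a I - b i * prod b I = (a i - b i) * prod a I + b i * (prod a I - prod b I)"
    by (simp add: algebra_simps)
  then have "\<bar>a i * prod a I - b i * prod b I\<bar> \<le> \<bar>a i - b i\<bar> * \<bar>prod a I\<bar> + \<bar>b i\<bar> * \<bar>prod a I - prod b I\<bar>"
    by (metis abs_mult abs_triangle_ineq)
  also have "\<dots> \<le> (\<epsilon> * M i) * prod M I + M i * (real (card I) * \<epsilon> * prod M I)"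
    using insert.prems pa IH M0[of i] \<epsilon>M by (intro add_mono mult_mono) auto
  finally show ?case using insert.hyps by (simp add: algebra_simps)
qed simp

definition lattice_gauss :: "real \<Rightarrow> int^'n \<Rightarrow> real" where
  "lattice_gauss t x = (\<Prod>i\<in>UNIV. gauss t (of_int (x $ i)))"

lemma znorm_square: "(znorm x)\<^sup>2 = (\<Sum>i\<in>UNIV. (of_int (x $ i))\<^sup>2)"
  by (simp add: znorm_def zsqnorm_def sum_nonneg)

lemma znorm_nonneg [simp]: "0 \<le> znorm x"
  by (simp add: znorm_def zsqnorm_def sum_nonneg)

lemma znorm_le_sum_abs: "znorm x \<le> (\<Sum>i\<in>UNIV. \<bar>of_int (x $ i)\<bar>)"
  using L2_set_le_sum_abs[of "\<lambda>i. real_of_int (x $ i)" UNIV]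
  by (simp add: znorm_def zsqnorm_def L2_set_def)

lemma abs_nth_le_znorm: "\<bar>of_int (x $ i)\<bar> \<le> znorm x"
proof -
  have "\<bar>of_int (x $ i)\<bar>\<^sup>2 \<le> (znorm x)\<^sup>2"
    unfolding znorm_square using member_le_sum[of i UNIV "\<lambda>i. (real_of_int (x $ i))\<^sup>2"] by simp
  then show ?thesis by (rule power2_le_imp_le) simp
qed

lemma znorm_ge_1: "x \<noteq> 0 \<Longrightarrow> 1 \<le> znorm x"
proof -
  assume "x \<noteq> 0"
  then obtain i where "x $ i \<noteq> 0" by (auto simp: vec_eq_iff)
  then have "1 \<le> \<bar>x $ i\<bar>" by simp
  then have "1 \<le> \<bar>real_of_int (x $ i)\<bar>" by linarith
  then show ?thesis using abs_nth_le_znorm[of x i] by linarith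
qed

lemma sqrt_power_powr:
  assumes "0 < t"
  shows "sqrt t ^ n = t powr (real n / 2)"
proof -
  have "sqrt t ^ n = (t powr (1 / 2)) powr real n"
    using assms by (simp add: powr_realpow powr_half_sqrt)
  also have "\<dots> = t powr (real n / 2)" by (simp only: powr_powr) simp
  finally show ?thesis .
qed

lemma powr_minus_half: "t powr (- real n / 2) = 1 / t powr (real n / 2)"
  by (simp only: minus_divide_left[symmetric] powr_minus_divide)

lemma lattice_gauss_eq:
  assumes "0 < t"
  shows "lattice_gauss t (x :: int^'n) =
    (4 * pi) powr (- real CARD('n) / 2) * (t powr (- real CARD('n) / 2) * exp (- ((znorm x)\<^sup>2 / 4 * t powr (-1))))"
proof -
  have "lattice_gauss t x = (\<Prod>i\<in>(UNIV::'n set). exp (- ((of_int (x $ i))\<^sup>2 / (4 * t)))) / sqrt (4 * pi * t) ^ CARD('n)"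
    by (simp add: lattice_gauss_def gauss_def prod_dividef)
  also have "(\<Prod>i\<in>(UNIV::'n set). exp (- ((of_int (x $ i))\<^sup>2 / (4 * t)))) = exp (- ((znorm x)\<^sup>2 / (4 * t)))"
    by (simp add: exp_sum[symmetric] znorm_square sum_negf sum_divide_distrib)
  also have "sqrt (4 * pi * t) ^ CARD('n) = (4 * pi * t) powr (real CARD('n) / 2)"
    using assms by (intro sqrt_power_powr) auto
  also have "\<dots> = (4 * pi) powr (real CARD('n) / 2) * t powr (real CARD('n) / 2)"
    using assms by (simp add: powr_mult)
  finally show ?thesis
    using assms by (simp add: powr_minus_half powr_minus_divide)
qed

lemma prod_exp_decay_le:
  assumes "0 < t"
  shows "(\<Prod>i\<in>UNIV. K / sqrt t * exp (- (\<bar>of_int ((x :: int^'n) $ i)\<bar> / sqrt t)))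
    = K ^ CARD('n) * t powr (- real CARD('n) / 2) * exp (- ((\<Sum>i\<in>UNIV. \<bar>of_int (x $ i)\<bar>) / sqrt t))"
proof -
  have "(\<Prod>i\<in>(UNIV::'n set). exp (- (\<bar>of_int (x $ i)\<bar> / sqrt t))) = exp (- ((\<Sum>i\<in>UNIV. \<bar>of_int (x $ i)\<bar>) / sqrt t))"
    by (simp add: exp_sum[symmetric] sum_negf sum_divide_distrib)
  moreover have "(K / sqrt t) ^ CARD('n) = K ^ CARD('n) * t powr (- real CARD('n) / 2)"
    by (simp add: power_divide powr_minus_divide sqrt_power_powr[OF assms])
  ultimately show ?thesis unfolding prod.distrib prod_constant by (simp only:)
qed

lemma exp_sum_abs_le_znorm:
  "0 < s \<Longrightarrow> exp (- ((\<Sum>i\<in>UNIV. \<bar>of_int (x $ i)\<bar>) / s)) \<le> exp (- (znorm x / s))"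
  using znorm_le_sum_abs[of x] by (simp add: divide_right_mono)

text \<open>For t \<ge> 1 every coordinate has relative error 1/t against the majorant K / sqrt t *
  exp (- \<bar>n\<bar> / sqrt t), which gives the extra power of t. The last summand covers short
  times, where the kernel is exponentially small in |x|.\<close>

lemma lattice_kernel_estimates:
  obtains K where "0 < K"
    "\<And>t x. 1 \<le> t \<Longrightarrow> lattice_kernel t (x :: int^'n) \<le> K * t powr (- real CARD('n) / 2)"
    "\<And>t x. 0 < t \<Longrightarrow> \<bar>lattice_kernel t (x :: int^'n) - lattice_gauss t x\<bar> \<le>
       K * (t powr (- real CARD('n) / 2 - 1) * exp (- (znorm x / sqrt t)) + (if t \<le> 1 then exp (- znorm x) else 0))"
proof -
  let ?d = "real CARD('n)"
  obtain K1 where K1: "0 < K1" "\<And>t n. 1 \<le> t \<Longrightarrow>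
    \<bar>line_kernel t n - gauss t (of_int n)\<bar> \<le> K1 / (t * sqrt t) * exp (- (\<bar>of_int n\<bar> / sqrt t))"
    using line_kernel_minus_gauss by blast
  obtain K2 where K2: "0 < K2" "\<And>t n. 1 \<le> t \<Longrightarrow> line_kernel t n \<le> K2 / sqrt t * exp (- (\<bar>of_int n\<bar> / sqrt t))"
    using line_kernel_le by blast
  define K where "K = K1 + K2 + 3"
  have K: "0 < K" "K1 \<le> K" "K2 \<le> K" "3 \<le> K" using K1 K2 by (auto simp: K_def)
  define L where "L = max (?d * K ^ CARD('n)) (max (K ^ CARD('n)) (exp 2 ^ CARD('n) + 3 ^ CARD('n)))"
  have L: "?d * K ^ CARD('n) \<le> L" "K ^ CARD('n) \<le> L" "exp 2 ^ CARD('n) \<le> L" "3 ^ CARD('n) \<le> L"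
  proof -
    have "exp 2 ^ CARD('n) + 3 ^ CARD('n) \<le> L" "0 < exp (2::real) ^ CARD('n)" "0 < (3::real) ^ CARD('n)"
      by (auto simp: L_def)
    then show "exp 2 ^ CARD('n) \<le> L" "3 ^ CARD('n) \<le> L" by linarith+
  qed (auto simp: L_def)
  have "0 < exp (2::real) ^ CARD('n)" by simp
  then have L0: "0 < L" using L(3) by linarith
  let ?M = "\<lambda>t n. K / sqrt t * exp (- (\<bar>of_int n\<bar> / sqrt t))"
  have q: "\<bar>line_kernel t n\<bar> \<le> ?M t n" if "1 \<le> t" for t n
  proof -
    have "line_kernel t n \<le> K2 / sqrt t * exp (- (\<bar>of_int n\<bar> / sqrt t))" by (rule K2(2)[OF that])
    also have "\<dots> \<le> ?M t n" using K that by (intro mult_right_mono divide_right_mono) auto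
    finally show ?thesis using line_kernel_nonneg[of t n] that by simp
  qed
  have g: "\<bar>gauss t (of_int n)\<bar> \<le> ?M t n" if "0 < t" for t n
  proof -
    have "gauss t (of_int n) \<le> 3 / sqrt t * exp (- (\<bar>of_int n\<bar> / sqrt t))" by (rule gauss_le[OF that])
    also have "\<dots> \<le> ?M t n" using K that by (intro mult_right_mono divide_right_mono) auto
    finally show ?thesis using that by (simp add: gauss_def)
  qed
  have d: "\<bar>line_kernel t n - gauss t (of_int n)\<bar> \<le> (1 / t) * ?M t n" if "1 \<le> t" for t n
  proof -
    have "\<bar>line_kernel t n - gauss t (of_int n)\<bar> \<le> K1 / (t * sqrt t) * exp (- (\<bar>of_int n\<bar> / sqrt t))"
      by (rule K1(2)[OF that])
    also have "\<dots> \<le> K / (t * sqrt t) * exp (- (\<bar>of_int n\<bar> / sqrt t))"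
      using K that by (intro mult_right_mono divide_right_mono) auto
    finally show ?thesis by simp
  qed
  show ?thesis
  proof (rule that[of L])
    show "0 < L" by fact
  next
    fix t :: real and x :: "int^'n" assume t: "1 \<le> t"
    have "lattice_kernel t x \<le> (\<Prod>i\<in>UNIV. ?M t (x $ i))"
      unfolding lattice_kernel_def using q[OF t] t
      by (intro prod_mono) (auto simp: line_kernel_nonneg)
    also have "\<dots> = K ^ CARD('n) * t powr (- ?d / 2) * exp (- ((\<Sum>i\<in>UNIV. \<bar>of_int (x $ i)\<bar>) / sqrt t))"
      using t by (intro prod_exp_decay_le) auto
    also have "\<dots> \<le> L * t powr (- ?d / 2) * 1"
      using L L0 t K by (intro mult_mono) (auto intro!: divide_nonneg_nonneg sum_nonneg)
    finally show "lattice_kernel t x \<le> L * t powr (- ?d / 2)" by simp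
  next
    fix t :: real and x :: "int^'n" assume t: "0 < t"
    show "\<bar>lattice_kernel t x - lattice_gauss t x\<bar> \<le>
       L * (t powr (- ?d / 2 - 1) * exp (- (znorm x / sqrt t)) + (if t \<le> 1 then exp (- znorm x) else 0))"
    proof (cases "1 \<le> t")
      case True
      have "\<bar>lattice_kernel t x - lattice_gauss t x\<bar> \<le> CARD('n) * (1 / t) * (\<Prod>i\<in>UNIV. ?M t (x $ i))"
        unfolding lattice_kernel_def lattice_gauss_def
        by (rule abs_prod_diff_le[OF finite]) (use True q g d in auto)
      also have "(\<Prod>i\<in>UNIV. ?M t (x $ i)) = K ^ CARD('n) * t powr (- ?d / 2) * exp (- ((\<Sum>i\<in>UNIV. \<bar>of_int (x $ i)\<bar>) / sqrt t))"
        by (rule prod_exp_decay_le[OF t])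
      also have "CARD('n) * (1 / t) * (K ^ CARD('n) * t powr (- ?d / 2) * exp (- ((\<Sum>i\<in>UNIV. \<bar>of_int (x $ i)\<bar>) / sqrt t)))
         = (?d * K ^ CARD('n)) * (t powr (- ?d / 2 - 1) * exp (- ((\<Sum>i\<in>UNIV. \<bar>of_int (x $ i)\<bar>) / sqrt t)))"
        using t by (simp add: powr_diff)
      also have "\<dots> \<le> L * (t powr (- ?d / 2 - 1) * exp (- (znorm x / sqrt t)))"
        using L L0 K t exp_sum_abs_le_znorm[of "sqrt t" x]
        by (intro mult_mono) auto
      also have "\<dots> \<le> L * (t powr (- ?d / 2 - 1) * exp (- (znorm x / sqrt t)) + (if t \<le> 1 then exp (- znorm x) else 0))"
        using L0 by (intro mult_left_mono) auto
      finally show ?thesis .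
    next
      case False
      \<comment> \<open>For t < 1 no comparison is attempted: kernel and Gaussian are bounded
        separately, and lowering the exponent of t by 1 only enlarges the Gaussian bound.\<close>
      have "lattice_kernel t x \<le> (\<Prod>i\<in>(UNIV::'n set). exp 2 * exp (- \<bar>of_int (x $ i)\<bar>))"
        unfolding lattice_kernel_def using t False
        by (intro prod_mono) (auto simp: line_kernel_nonneg line_kernel_le_small)
      also have "\<dots> = exp 2 ^ CARD('n) * exp (- ((\<Sum>i\<in>UNIV. \<bar>of_int (x $ i)\<bar>) / 1))"
        by (simp add: prod.distrib prod_constant exp_sum[symmetric] sum_negf)
      also have "\<dots> \<le> L * exp (- (znorm x / 1))"
        using L L0 exp_sum_abs_le_znorm[of 1 x] by (intro mult_mono) auto
      finally have P: "lattice_kernel t x \<le> L * exp (- znorm x)" by simp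
      have "lattice_gauss t x \<le> (\<Prod>i\<in>UNIV. 3 / sqrt t * exp (- (\<bar>of_int (x $ i)\<bar> / sqrt t)))"
        unfolding lattice_gauss_def using t gauss_le[OF t]
        by (intro prod_mono) (auto simp: gauss_def)
      also have "\<dots> = 3 ^ CARD('n) * t powr (- ?d / 2) * exp (- ((\<Sum>i\<in>UNIV. \<bar>of_int (x $ i)\<bar>) / sqrt t))"
        by (rule prod_exp_decay_le[OF t])
      also have "\<dots> \<le> L * t powr (- ?d / 2 - 1) * exp (- (znorm x / sqrt t))"
        using L L0 K t False exp_sum_abs_le_znorm[of "sqrt t" x]
        by (intro mult_mono) (auto intro!: powr_mono')
      finally have G: "lattice_gauss t x \<le> L * t powr (- ?d / 2 - 1) * exp (- (znorm x / sqrt t))" .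
      have "\<bar>lattice_kernel t x - lattice_gauss t x\<bar> \<le> lattice_kernel t x + lattice_gauss t x"
        using t lattice_kernel_nonneg[of t x] by (simp add: abs_le_iff lattice_gauss_def gauss_def prod_nonneg)
      then show ?thesis using P G False by (simp add: algebra_simps)
    qed
  qed
qed

text \<open>The majorant depends on t alone. Uniformity in the shift s is needed for the integrals
  of p_(s+t) that arise when the semigroup acts on a Riesz kernel.\<close>

lemma lattice_kernel_le:
  obtains K where "1 \<le> K"
    "\<And>s t x. 0 \<le> s \<Longrightarrow> 0 < t \<Longrightarrow>
      lattice_kernel (s + t) (x :: int^'n) \<le> K * (if t \<le> 1 then 1 else t powr (- real CARD('n) / 2))"
proof -
  obtain K where K: "0 < K"
    "\<And>t x. 1 \<le> t \<Longrightarrow> lattice_kernel t (x :: int^'n) \<le> K * t powr (- real CARD('n) / 2)"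
    using lattice_kernel_estimates[where 'n='n] by metis
  show ?thesis
  proof (rule that[of "max 1 K"])
    fix s t :: real and x :: "int^'n" assume st: "0 \<le> s" "0 < t"
    show "lattice_kernel (s + t) x \<le> max 1 K * (if t \<le> 1 then 1 else t powr (- real CARD('n) / 2))"
    proof (cases "t \<le> 1")
      case True
      then show ?thesis using lattice_kernel_le_1[of "s + t" x] st by simp
    next
      case False
      then have "lattice_kernel (s + t) x \<le> K * (s + t) powr (- real CARD('n) / 2)"
        using st by (intro K) auto
      also have "\<dots> \<le> max 1 K * t powr (- real CARD('n) / 2)"
        using st by (intro mult_mono powr_mono2') auto
      finally show ?thesis using False by simp
    qed
  qed simp
qed

section \<open>Asymptotics of the Riesz kernels\<close>

lemma kappa_uminus:
  fixes x :: "int^'n"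
  assumes "0 < \<beta>"
  shows "kappa (- \<beta>) x = (LINT t:{0<..}|lborel. lattice_kernel t x * t powr (\<beta> - 1)) / Gamma \<beta>"
proof -
  have "(LINT t:{0<..}|lborel. heat_kernel t x / t powr (1 + - \<beta>)) =
      (LINT t:{0<..}|lborel. lattice_kernel t x * t powr (\<beta> - 1))"
  proof (rule set_lebesgue_integral_cong)
    have "y / t powr (1 + - \<beta>) = y * t powr (\<beta> - 1)" for y t
      using powr_minus_divide[of t "1 - \<beta>"] by simp
    then show "\<forall>t. t \<in> {0<..} \<longrightarrow> heat_kernel t x / t powr (1 + - \<beta>) = lattice_kernel t x * t powr (\<beta> - 1)"
      by (auto simp: heat_kernel_eq)
  qed simp
  then show ?thesis
    using assms Gamma_real_pos[OF assms] by (simp add: kappa_def)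
qed

text \<open>Convergence at 0 comes from \<beta> > 0 and the bound by a constant, convergence at
  infinity from \<beta> < d/2 and the decay t^(-d/2).\<close>

lemma set_integrable_lattice_kernel:
  fixes x :: "int^'n"
  assumes "0 < \<beta>" "\<beta> < real CARD('n) / 2" "0 \<le> s"
  shows "set_integrable lborel {0<..} (\<lambda>t. lattice_kernel (s + t) x * t powr (\<beta> - 1))"
proof -
  obtain K where K: "1 \<le> K"
    "\<And>s t x. 0 \<le> s \<Longrightarrow> 0 < t \<Longrightarrow>
      lattice_kernel (s + t) (x :: int^'n) \<le> K * (if t \<le> 1 then 1 else t powr (- real CARD('n) / 2))"
    using lattice_kernel_le[where 'n='n] by metis
  define b where "b = real CARD('n) / 2 - \<beta>"
  have b: "0 < b" using assms by (simp add: b_def)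
  show ?thesis
  proof (rule set_integrable_bound)
    show "set_integrable lborel {0<..} (\<lambda>t. K * (if t \<le> 1 then t powr (\<beta> - 1) else t powr (- b - 1)))"
      by (intro set_integrable_mult_right set_integrable_two_powers assms b)
    show "set_borel_measurable lborel {0<..} (\<lambda>t. lattice_kernel (s + t) x * t powr (\<beta> - 1))"
      unfolding set_borel_measurable_def by measurable
    show "AE t in lborel. t \<in> {0<..} \<longrightarrow> norm (lattice_kernel (s + t) x * t powr (\<beta> - 1))
        \<le> norm (K * (if t \<le> 1 then t powr (\<beta> - 1) else t powr (- b - 1)))"
    proof (intro AE_I2 impI)
      fix t :: real assume "t \<in> {0<..}"
      then have t: "0 < t" by simp
      have e: "t powr (- real CARD('n) / 2) * t powr (\<beta> - 1) = t powr (- b - 1)"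
        by (simp add: powr_add[symmetric] b_def algebra_simps)
      have "lattice_kernel (s + t) x * t powr (\<beta> - 1)
          \<le> K * (if t \<le> 1 then 1 else t powr (- real CARD('n) / 2)) * t powr (\<beta> - 1)"
        by (intro mult_right_mono K(2) assms t) auto
      also have "\<dots> = K * (if t \<le> 1 then t powr (\<beta> - 1) else t powr (- b - 1))"
        unfolding e[symmetric] by simp
      finally show "norm (lattice_kernel (s + t) x * t powr (\<beta> - 1))
          \<le> norm (K * (if t \<le> 1 then t powr (\<beta> - 1) else t powr (- b - 1)))"
        using lattice_kernel_nonneg[of "s + t" x] t assms by simp
    qed
  qed
qed

lemma set_integral_pos:
  fixes f :: "real \<Rightarrow> real"
  assumes i: "set_integrable lborel {0<..} f" and pos: "\<And>t. 0 < t \<Longrightarrow> 0 < f t"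
  shows "0 < (LINT t:{0<..}|lborel. f t)"
proof -
  have nn: "0 \<le> indicator {0<..} t *\<^sub>R f t" for t
    by (auto simp: indicator_def intro: less_imp_le pos)
  have "(LINT t:{0<..}|lborel. f t) \<noteq> 0"
  proof
    assume "(LINT t:{0<..}|lborel. f t) = 0"
    then have "AE t in lborel. indicator {0<..} t *\<^sub>R f t = 0"
      using integral_nonneg_eq_0_iff_AE[OF i[unfolded set_integrable_def]] nn
      unfolding set_lebesgue_integral_def by auto
    then have "AE t in lborel. t \<notin> {0<..1::real}"
      by eventually_elim (use pos in \<open>force simp: indicator_def\<close>)
    then have "{0<..1::real} \<in> null_sets lborel"
      by (subst AE_iff_null_sets) auto
    then show False by (simp add: null_sets_def)
  qed
  moreover have "0 \<le> (LINT t:{0<..}|lborel. f t)"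
    unfolding set_lebesgue_integral_def using nn by simp
  ultimately show ?thesis by simp
qed

lemma kappa_uminus_pos:
  fixes x :: "int^'n"
  assumes "0 < \<beta>" "\<beta> < real CARD('n) / 2"
  shows "0 < kappa (- \<beta>) x"
  unfolding kappa_uminus[OF assms(1)]
  using set_integrable_lattice_kernel[OF assms order_refl, of x]
  by (intro divide_pos_pos set_integral_pos Gamma_real_pos assms mult_pos_pos lattice_kernel_pos) auto

text \<open>The inequality r/a \<le> exp (r/a) raised to the power a. It downgrades exponentially
  small errors to powers.\<close>

lemma powr_le_exp:
  fixes a r :: real
  assumes "0 < a" "0 < r"
  shows "exp (- r) \<le> a powr a * r powr (- a)"
proof -
  have "r / a \<le> exp (r / a)" using exp_ge_add_one_self[of "r / a"] by linarith
  then have "(r / a) powr a \<le> exp (r / a) powr a" using assms by (intro powr_mono2) auto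
  also have "\<dots> = exp r" using assms by (simp add: powr_def)
  finally show ?thesis using assms by (simp add: powr_divide powr_minus exp_minus field_simps)
qed

text \<open>The constant of the Riesz potential of order 2\<beta> on R^d, the continuum kernel of
  the power -\<beta> of the Laplacian.\<close>

definition riesz_const :: "real \<Rightarrow> real \<Rightarrow> real" where
  "riesz_const d \<beta> = Gamma (d / 2 - \<beta>) / (Gamma \<beta> * pi powr (d / 2) * 4 powr \<beta>)"

lemma riesz_const_pos: "0 < \<beta> \<Longrightarrow> \<beta> < d / 2 \<Longrightarrow> 0 < riesz_const d \<beta>"
  by (simp add: riesz_const_def Gamma_real_pos)

text \<open>Up to a constant the integrand is t^(-b-1) exp (-c/t) with b = d/2 - \<beta> and c =
  |x|^2 / 4: the Gamma integral under the substitution with exponent p = -1.\<close>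

lemma set_integral_lattice_gauss:
  fixes x :: "int^'n"
  assumes \<beta>: "0 < \<beta>" "\<beta> < real CARD('n) / 2" and x: "x \<noteq> 0"
  shows "set_integrable lborel {0<..} (\<lambda>t. lattice_gauss t x * t powr (\<beta> - 1))"
    and "(LINT t:{0<..}|lborel. lattice_gauss t x * t powr (\<beta> - 1)) =
      Gamma \<beta> * (riesz_const CARD('n) \<beta> * znorm x powr (2 * \<beta> - CARD('n)))"
proof -
  let ?d = "real CARD('n)"
  define r where "r = znorm x"
  have r: "1 \<le> r" "0 < r" using znorm_ge_1[OF x] by (auto simp: r_def)
  define b where "b = ?d / 2 - \<beta>"
  have b: "0 < b" using \<beta> by (simp add: b_def)
  define c where "c = r\<^sup>2 / 4"
  have c: "0 < c" using r by (simp add: c_def)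
  let ?G = "\<lambda>t. (4 * pi) powr (- ?d / 2) * (t powr ((-1) * b - 1) * exp (- (c * t powr (-1))))"
  have eq: "lattice_gauss t x * t powr (\<beta> - 1) = ?G t" if "t \<in> {0<..}" for t
  proof -
    have "t powr (- ?d / 2) * t powr (\<beta> - 1) = t powr ((-1) * b - 1)"
      by (simp add: powr_add[symmetric] b_def algebra_simps)
    then show ?thesis using that lattice_gauss_eq[of t x] by (simp add: c_def r_def)
  qed
  note GI = Gamma_integral_powr[OF c, of "-1" b]
  show "set_integrable lborel {0<..} (\<lambda>t. lattice_gauss t x * t powr (\<beta> - 1))"
  proof (subst set_integrable_cong[OF refl refl eq])
    show "set_integrable lborel {0<..} ?G" using GI(1) b by (intro set_integrable_mult_right) auto
  qed
  have "(LINT t:{0<..}|lborel. lattice_gauss t x * t powr (\<beta> - 1)) = (LINT t:{0<..}|lborel. ?G t)"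
    by (rule set_lebesgue_integral_cong) (use eq in auto)
  also have "\<dots> = (4 * pi) powr (- ?d / 2) * (Gamma b / c powr b)"
    using GI(2) b by simp
  also have "c powr b = (r powr (?d - 2 * \<beta>)) / 4 powr b"
  proof -
    have "(r\<^sup>2) powr b = r powr (2 * b)" using powr_powr[of r 2 b] r by simp
    then show ?thesis by (simp add: c_def powr_divide b_def right_diff_distrib)
  qed
  also have "(4 * pi) powr (- ?d / 2) = 1 / (4 powr (?d / 2) * pi powr (?d / 2))"
    unfolding powr_minus_half by (simp add: powr_mult)
  also have "4 powr (?d / 2) = 4 powr b * 4 powr \<beta>"
    by (simp add: powr_add[symmetric] b_def)
  also have "r powr (?d - 2 * \<beta>) = 1 / r powr (2 * \<beta> - ?d)"
    using powr_minus_divide[of r "2 * \<beta> - ?d"] by simp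
  finally show "(LINT t:{0<..}|lborel. lattice_gauss t x * t powr (\<beta> - 1)) =
      Gamma \<beta> * (riesz_const CARD('n) \<beta> * znorm x powr (2 * \<beta> - CARD('n)))"
    using Gamma_real_pos[OF \<beta>(1)] by (simp add: riesz_const_def r_def b_def)
qed

text \<open>The Gaussian part integrates exactly to the main term. The long-time error t^(-y/2-1)
  exp (-r / sqrt t), with y = d - 2\<beta> + 2, is a Gamma integral with p = -1/2 and equals 2 Gamma
  y r^(-y); the short-time error carries exp (-r), which is smaller than any power.\<close>

lemma kappa_asymptotics:
  assumes \<beta>: "0 < \<beta>" "\<beta> < real CARD('n::finite) / 2"
  obtains C where "0 < C" "\<And>x::int^'n. x \<noteq> 0 \<Longrightarrow>
    \<bar>kappa (- \<beta>) x - riesz_const CARD('n) \<beta> * znorm x powr (2 * \<beta> - CARD('n))\<bar>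
      \<le> C * znorm x powr (2 * \<beta> - CARD('n) - 2)"
proof -
  let ?d = "real CARD('n)"
  obtain K where K: "0 < K"
    "\<And>t x. 0 < t \<Longrightarrow> \<bar>lattice_kernel t (x :: int^'n) - lattice_gauss t x\<bar> \<le>
       K * (t powr (- ?d / 2 - 1) * exp (- (znorm x / sqrt t)) + (if t \<le> 1 then exp (- znorm x) else 0))"
    using lattice_kernel_estimates[where 'n='n] by metis
  define b where "b = ?d / 2 - \<beta>"
  have b: "0 < b" using \<beta> by (simp add: b_def)
  define y where "y = 2 * b + 2"
  have y: "0 < y" using b by (simp add: y_def)
  have G: "0 < Gamma \<beta>" using \<beta> by (simp add: Gamma_real_pos)
  let ?one = "\<lambda>t::real. (if t \<le> 1 then t powr (\<beta> - 1) else 0)"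
  have one: "set_integrable lborel {0<..} ?one"
    by (rule set_integrable_bound[OF set_integrable_two_powers[OF \<beta>(1) b]])
      (auto simp: set_borel_measurable_def)
  define I where "I = (LINT t:{0<..}|lborel. ?one t)"
  have I: "0 \<le> I" unfolding I_def set_lebesgue_integral_def
    by (rule Bochner_Integration.integral_nonneg) (auto simp: indicator_def)
  define C where "C = K * (2 * Gamma y + y powr y * I) / Gamma \<beta> + 1"
  show ?thesis
  proof (rule that[of C])
    show "0 < C" using K G I Gamma_real_pos[OF y]
      by (auto simp: C_def intro!: add_nonneg_pos divide_nonneg_pos mult_nonneg_nonneg add_nonneg_nonneg)
  next
    fix x :: "int^'n" assume x: "x \<noteq> 0"
    define r where "r = znorm x"
    have r: "1 \<le> r" "0 < r" using znorm_ge_1[OF x] by (auto simp: r_def)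
    let ?e = "\<lambda>t. t powr ((-1/2) * y - 1) * exp (- (r * t powr (-1/2)))"
    let ?E = "\<lambda>t. K * ?e t + K * exp (- r) * ?one t"
    let ?D = "\<lambda>t. lattice_kernel t x * t powr (\<beta> - 1) - lattice_gauss t x * t powr (\<beta> - 1)"
    note GI = Gamma_integral_powr[OF r(2), of "-1/2" y]
    have e: "set_integrable lborel {0<..} ?e" using GI(1) y by simp
    have bd: "\<bar>?D t\<bar> \<le> ?E t" if "0 < t" for t
    proof -
      let ?A = "t powr (- ?d / 2 - 1)" and ?T = "t powr (\<beta> - 1)"
      have "r / sqrt t = r * t powr (-1/2)"
        using that by (simp add: powr_minus_divide powr_half_sqrt)
      moreover have "?A * ?T = t powr ((-1/2) * y - 1)"
        by (simp add: powr_add[symmetric] y_def b_def algebra_simps)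
      ultimately have e: "?e t = ?A * ?T * exp (- (r / sqrt t))" by (simp only:)
      have "\<bar>?D t\<bar> = \<bar>lattice_kernel t x - lattice_gauss t x\<bar> * ?T"
        by (simp add: left_diff_distrib[symmetric] abs_mult)
      also have "\<dots> \<le> K * (?A * exp (- (r / sqrt t)) + (if t \<le> 1 then exp (- r) else 0)) * ?T"
        unfolding r_def by (intro mult_right_mono K that) auto
      also have "\<dots> = ?E t"
        unfolding e by (cases "t \<le> 1") (simp_all add: ring_distribs mult_ac)
      finally show ?thesis .
    qed
    have P: "set_integrable lborel {0<..} (\<lambda>t. lattice_kernel t x * t powr (\<beta> - 1))"
      using set_integrable_lattice_kernel[OF \<beta> order_refl, of x] by simp
    have E: "set_integrable lborel {0<..} ?E"
      using e one by (intro set_integral_add set_integrable_mult_right) auto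
    have "\<bar>LINT t:{0<..}|lborel. ?D t\<bar> \<le> (LINT t:{0<..}|lborel. \<bar>?D t\<bar>)"
      using set_integral_norm_bound[OF set_integral_diff(1)[OF P set_integral_lattice_gauss(1)[OF \<beta> x]]] by simp
    also have "\<dots> \<le> (LINT t:{0<..}|lborel. ?E t)"
    proof (rule set_integral_mono[OF _ E])
      show "set_integrable lborel {0<..} (\<lambda>t. \<bar>?D t\<bar>)"
        using set_integrable_abs[OF set_integral_diff(1)[OF P set_integral_lattice_gauss(1)[OF \<beta> x]]] by simp
    qed (use bd in auto)
    also have "\<dots> = K * (2 * Gamma y / r powr y) + K * exp (- r) * I"
      using e one GI(2) y unfolding I_def
      by (subst set_integral_add(2)) (auto intro!: set_integrable_mult_right)
    also have "\<dots> \<le> K * (2 * Gamma y / r powr y) + K * (y powr y * r powr (- y)) * I"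
      using K I powr_le_exp[OF y r(2)] by (intro add_left_mono mult_right_mono mult_left_mono) auto
    also have "\<dots> = K * (2 * Gamma y + y powr y * I) * r powr (- y)"
      by (simp add: powr_minus divide_inverse algebra_simps)
    finally have D: "\<bar>LINT t:{0<..}|lborel. ?D t\<bar> \<le> K * (2 * Gamma y + y powr y * I) * r powr (- y)" .
    have "kappa (- \<beta>) x - riesz_const CARD('n) \<beta> * r powr (2 * \<beta> - CARD('n)) = (LINT t:{0<..}|lborel. ?D t) / Gamma \<beta>"
      unfolding kappa_uminus[OF \<beta>(1)] set_integral_diff(2)[OF P set_integral_lattice_gauss(1)[OF \<beta> x]]
        set_integral_lattice_gauss(2)[OF \<beta> x]
      using G by (simp add: r_def field_simps)
    then have "\<bar>kappa (- \<beta>) x - riesz_const CARD('n) \<beta> * r powr (2 * \<beta> - CARD('n))\<bar> =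
        \<bar>LINT t:{0<..}|lborel. ?D t\<bar> / Gamma \<beta>"
      using G by simp
    also have "\<dots> \<le> K * (2 * Gamma y + y powr y * I) * r powr (- y) / Gamma \<beta>"
      using D G by (intro divide_right_mono) auto
    also have "\<dots> \<le> C * r powr (- y)"
      by (simp add: C_def algebra_simps)
    also have "- y = 2 * \<beta> - CARD('n) - 2" by (simp add: y_def b_def)
    finally show "\<bar>kappa (- \<beta>) x - riesz_const CARD('n) \<beta> * znorm x powr (2 * \<beta> - CARD('n))\<bar>
      \<le> C * znorm x powr (2 * \<beta> - CARD('n) - 2)"
      unfolding r_def .
  qed
qed

lemma kappa_upper:
  assumes \<beta>: "0 < \<beta>" "\<beta> < real CARD('n::finite) / 2"
  obtains C where "0 < C" "\<And>x::int^'n. x \<noteq> 0 \<Longrightarrow> kappa (- \<beta>) x \<le> C * znorm x powr (2 * \<beta> - CARD('n))"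
proof -
  obtain C where C: "0 < C" "\<And>x::int^'n. x \<noteq> 0 \<Longrightarrow>
    \<bar>kappa (- \<beta>) x - riesz_const CARD('n) \<beta> * znorm x powr (2 * \<beta> - CARD('n))\<bar>
      \<le> C * znorm x powr (2 * \<beta> - CARD('n) - 2)"
    using kappa_asymptotics[OF \<beta>] by blast
  show ?thesis
  proof (rule that[of "C + riesz_const CARD('n) \<beta>"])
    show "0 < C + riesz_const CARD('n) \<beta>" using C riesz_const_pos[OF \<beta>] by simp
    fix x :: "int^'n" assume x: "x \<noteq> 0"
    have "C * znorm x powr (2 * \<beta> - CARD('n) - 2) \<le> C * znorm x powr (2 * \<beta> - CARD('n))"
      using C znorm_ge_1[OF x] by (intro mult_left_mono powr_mono) auto
    then show "kappa (- \<beta>) x \<le> (C + riesz_const CARD('n) \<beta>) * znorm x powr (2 * \<beta> - CARD('n))"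
      using C(2)[OF x] by (simp add: algebra_simps)
  qed
qed

lemma kappa_lower:
  assumes \<beta>: "0 < \<beta>" "\<beta> < real CARD('n::finite) / 2"
  obtains c R where "0 < c" "1 \<le> R"
    "\<And>x::int^'n. R \<le> znorm x \<Longrightarrow> c * znorm x powr (2 * \<beta> - CARD('n)) \<le> kappa (- \<beta>) x"
proof -
  let ?A = "riesz_const CARD('n) \<beta>"
  obtain C where C: "0 < C" "\<And>x::int^'n. x \<noteq> 0 \<Longrightarrow>
    \<bar>kappa (- \<beta>) x - ?A * znorm x powr (2 * \<beta> - CARD('n))\<bar>
      \<le> C * znorm x powr (2 * \<beta> - CARD('n) - 2)"
    using kappa_asymptotics[OF \<beta>] by blast
  have A: "0 < ?A" by (rule riesz_const_pos[OF \<beta>])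
  \<comment> \<open>For r \<ge> 1 the bound r \<ge> 2C/A already gives r^2 \<ge> 2C/A, so the error
    is at most half of the main term.\<close>
  define R where "R = max 1 (2 * C / ?A)"
  show ?thesis
  proof (rule that[of "?A / 2" R])
    show "0 < ?A / 2" "1 \<le> R" using A by (auto simp: R_def)
    fix x :: "int^'n" assume x: "R \<le> znorm x"
    then have r: "1 \<le> znorm x" "2 * C / ?A \<le> znorm x" by (auto simp: R_def)
    then have x0: "x \<noteq> 0" by (auto simp: znorm_def zsqnorm_def)
    have "2 * C / ?A \<le> (znorm x)\<^sup>2" using r self_le_power[of "znorm x" 2] by simp
    then have "C \<le> ?A / 2 * (znorm x)\<^sup>2" using A by (simp add: field_simps)
    then have "C * znorm x powr (2 * \<beta> - CARD('n) - 2) \<le> ?A / 2 * (znorm x)\<^sup>2 * znorm x powr (2 * \<beta> - CARD('n) - 2)"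
      by (intro mult_right_mono) auto
    also have "\<dots> = ?A / 2 * znorm x powr (2 * \<beta> - CARD('n))"
    proof -
      have "(znorm x)\<^sup>2 * znorm x powr (2 * \<beta> - CARD('n) - 2) = znorm x powr 2 * znorm x powr (2 * \<beta> - CARD('n) - 2)"
        using r by simp
      also have "\<dots> = znorm x powr (2 + (2 * \<beta> - CARD('n) - 2))" by (simp only: powr_add)
      also have "\<dots> = znorm x powr (2 * \<beta> - CARD('n))" by simp
      finally show ?thesis by simp
    qed
    finally show "?A / 2 * znorm x powr (2 * \<beta> - CARD('n)) \<le> kappa (- \<beta>) x"
      using C(2)[OF x0] by (simp add: algebra_simps)
  qed
qed

section \<open>Ground states of symmetric kernels\<close>

text \<open>The geometric mean is at most the logarithmic mean. With s = sqrt (a/b) it reads 2 ln s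
  \<le> s - 1/s, and the derivative of the difference is the square (1 - 1/s)^2.\<close>

lemma ln_square_le:
  fixes a b :: real
  assumes "0 < b" "b \<le> a"
  shows "a * b * (ln (a / b))\<^sup>2 \<le> (a - b)\<^sup>2"
proof -
  define s where "s = sqrt (a / b)"
  have s: "1 \<le> s" "s\<^sup>2 = a / b" using assms by (auto simp: s_def)
  let ?h = "\<lambda>s::real. s - 1 / s - 2 * ln s"
  have "?h 1 \<le> ?h s"
  proof (rule DERIV_nonneg_imp_nondecreasing[OF s(1)])
    fix x :: real assume x: "1 \<le> x" "x \<le> s"
    have "(?h has_real_derivative (1 - 1 / x)\<^sup>2) (at x)"
      using x by (auto intro!: derivative_eq_intros simp: power2_eq_square field_simps)
    then show "\<exists>y. (?h has_real_derivative y) (at x) \<and> 0 \<le> y" by (intro exI[of _ "(1 - 1 / x)\<^sup>2"]) auto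
  qed
  then have "2 * ln s \<le> s - 1 / s" by simp
  moreover have "ln (a / b) = 2 * ln s" using s ln_realpow[of s 2] by simp
  moreover have "0 \<le> ln s" using s by simp
  ultimately have "(ln (a / b))\<^sup>2 \<le> (s - 1 / s)\<^sup>2" by (intro power_mono) auto
  then have "a * b * (ln (a / b))\<^sup>2 \<le> a * b * (s - 1 / s)\<^sup>2"
    using assms by (intro mult_left_mono) auto
  also have "(s - 1 / s)\<^sup>2 = s\<^sup>2 - 2 + 1 / s\<^sup>2" using s(1) by (simp add: power2_eq_square field_simps)
  also have "a * b * (s\<^sup>2 - 2 + 1 / s\<^sup>2) = (a - b)\<^sup>2"
    unfolding s(2) using assms by (simp add: power2_eq_square field_simps)
  finally show ?thesis .
qed

text \<open>The left side is the defect density of the logarithmic cutoff, the right side the Green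
  density of u and (u - l)_+. For a > l and b \<le> a, replacing b by m = max b l leaves the
  logarithms unchanged and enlarges the product; then (a - m)^2 \<le> (a - b)(a - m).\<close>

lemma ln_cutoff_le:
  fixes a b l :: real
  assumes "0 < a" "0 < b" "0 < l"
  shows "a * b * (ln (max a l / l) - ln (max b l / l))\<^sup>2 \<le> (a - b) * (max (a - l) 0 - max (b - l) 0)"
proof -
  have *: "a * b * (ln (max a l / l) - ln (max b l / l))\<^sup>2 \<le> (a - b) * (max (a - l) 0 - max (b - l) 0)"
    if "b \<le> a" "0 < b" for a b
  proof (cases "a \<le> l")
    case False
    define m where "m = max b l"
    have m: "0 < m" "b \<le> m" "m \<le> a" using that False assms by (auto simp: m_def)
    have "ln (max a l / l) - ln (max b l / l) = ln (a / m)"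
      using False m assms by (simp add: m_def[symmetric] max_absorb1 ln_div)
    then have "a * b * (ln (max a l / l) - ln (max b l / l))\<^sup>2 \<le> a * m * (ln (a / m))\<^sup>2"
      using m that by (auto intro!: mult_right_mono mult_left_mono)
    also have "\<dots> \<le> (a - m)\<^sup>2" by (rule ln_square_le) (use m in auto)
    also have "\<dots> \<le> (a - b) * (a - m)"
      unfolding power2_eq_square using m by (intro mult_right_mono) auto
    also have "a - m = max (a - l) 0 - max (b - l) 0" using False by (auto simp: m_def)
    finally show ?thesis .
  qed (use that in \<open>auto simp: max_absorb2\<close>)
  show ?thesis
  proof (cases "b \<le> a")
    case False
    then show ?thesis using *[of a b] assms by (simp add: power2_commute algebra_simps)
  qed (use * assms in auto)
qed

lemma infsetsum_finite_support:
  assumes "finite S" "\<And>x. x \<notin> S \<Longrightarrow> f x = 0"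
  shows "f abs_summable_on UNIV" "infsetsum f UNIV = sum f S"
proof -
  show "f abs_summable_on UNIV"
    using assms abs_summable_on_cong_neutral[of UNIV S f f] by auto
  have "infsetsum f UNIV = infsetsum f S"
    using assms by (intro infsetsum_cong_neutral) auto
  then show "infsetsum f UNIV = sum f S" using assms(1) by simp
qed

text \<open>Neither translation invariance nor finite range is assumed, so the nearest-neighbour
  case \<sigma> = 1 and the long-range case \<sigma> < 1 share one argument. Summable rows make the
  generator well defined on bounded functions.\<close>

locale symmetric_kernel =
  fixes k :: "'a::countable \<Rightarrow> 'a \<Rightarrow> real"
  assumes kernel_nonneg: "0 \<le> k x y"
    and kernel_commute: "k x y = k y x"
    and kernel_summable: "k x abs_summable_on UNIV"
begin

definition generator :: "('a \<Rightarrow> real) \<Rightarrow> 'a \<Rightarrow> real" where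
  "generator g x = (\<Sum>\<^sub>ay. k x y * (g x - g y))"

definition energy :: "('a \<Rightarrow> real) \<Rightarrow> ennreal" where
  "energy g = (\<integral>\<^sup>+ p. ennreal (k (fst p) (snd p) * (g (fst p) - g (snd p))\<^sup>2 / 2) \<partial>count_space UNIV)"

text \<open>The form after the ground state transform. Like \<open>energy\<close> it takes values in
  \<open>ennreal\<close>, so that it makes sense for limits of finitely supported functions, where
  finiteness is not known beforehand.\<close>

definition defect :: "('a \<Rightarrow> real) \<Rightarrow> ('a \<Rightarrow> real) \<Rightarrow> ennreal" where
  "defect u g = (\<integral>\<^sup>+ p. ennreal (k (fst p) (snd p) * (u (fst p) * u (snd p)) *
     (g (fst p) / u (fst p) - g (snd p) / u (snd p))\<^sup>2 / 2) \<partial>count_space UNIV)"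

lemma abs_summable_generator:
  assumes "\<And>x. \<bar>g x\<bar> \<le> B"
  shows "(\<lambda>y. k x y * (g x - g y)) abs_summable_on UNIV"
proof (rule abs_summable_on_comparison_test[of "\<lambda>y. k x y * (2 * B)"])
  show "(\<lambda>y. k x y * (2 * B)) abs_summable_on UNIV"
    by (intro abs_summable_on_cmult_left kernel_summable)
  fix y
  have "\<bar>g x - g y\<bar> \<le> \<bar>2 * B\<bar>" using assms[of x] assms[of y] by linarith
  then show "norm (k x y * (g x - g y)) \<le> norm (k x y * (2 * B))"
    unfolding norm_mult by (intro mult_left_mono) auto
qed

text \<open>Boundedness of g makes each row summable, and the finite support of \<phi> leaves
  finitely many rows. This is why g may be the ground state itself, which need not be square
  summable.\<close>

lemma green:
  assumes g: "\<And>x. \<bar>g x\<bar> \<le> B" and S: "finite S" "\<And>x. x \<notin> S \<Longrightarrow> \<phi> x = 0"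
  shows "(\<lambda>p. k (fst p) (snd p) * (g (fst p) - g (snd p)) * (\<phi> (fst p) - \<phi> (snd p))) abs_summable_on UNIV"
    and "(\<Sum>\<^sub>ap. k (fst p) (snd p) * (g (fst p) - g (snd p)) * (\<phi> (fst p) - \<phi> (snd p))) =
      2 * (\<Sum>x\<in>S. \<phi> x * generator g x)"
proof -
  \<comment> \<open>Only the first endpoint of \<phi> is kept, so that the rows of h vanish off S.
    By symmetry of the kernel the full integrand is h plus its image under swapping the
    endpoints.\<close>
  define h where "h = (\<lambda>p. k (fst p) (snd p) * (g (fst p) - g (snd p)) * \<phi> (fst p))"
  have row: "(\<lambda>y. h (x, y)) abs_summable_on UNIV" for x
    unfolding h_def fst_conv snd_conv
    by (intro abs_summable_on_cmult_left abs_summable_generator[of g B] g)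
  have rows: "(\<Sum>\<^sub>ay. h (x, y)) = \<phi> x * generator g x" for x
    unfolding h_def fst_conv snd_conv generator_def
    using abs_summable_generator[of g B x, OF g] by (subst infsetsum_cmult_left) auto
  have "h abs_summable_on (UNIV \<times> UNIV)"
  proof (subst abs_summable_on_Sigma_iff, simp, simp, intro conjI ballI row)
    show "(\<lambda>x. \<Sum>\<^sub>ay. norm (h (x, y))) abs_summable_on UNIV"
      by (rule infsetsum_finite_support(1)[OF S(1)]) (simp add: h_def S(2))
  qed
  then have hs: "h abs_summable_on UNIV" by simp
  have "infsetsum h (UNIV \<times> UNIV) = (\<Sum>\<^sub>ax. \<phi> x * generator g x)"
    using hs by (subst infsetsum_Times) (simp_all add: rows)
  also have "\<dots> = (\<Sum>x\<in>S. \<phi> x * generator g x)"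
    by (rule infsetsum_finite_support(2)[OF S(1)]) (simp add: S(2))
  finally have he: "infsetsum h UNIV = (\<Sum>x\<in>S. \<phi> x * generator g x)" by simp
  have bij: "bij_betw prod.swap (UNIV :: ('a \<times> 'a) set) UNIV"
    by (rule bij_betwI[of _ _ _ prod.swap]) auto
  have hs': "(\<lambda>p. h (prod.swap p)) abs_summable_on UNIV"
    using abs_summable_on_reindex_bij_betw[OF bij, of h] hs by simp
  have he': "(\<Sum>\<^sub>ap. h (prod.swap p)) = infsetsum h UNIV"
    by (rule infsetsum_reindex_bij_betw[OF bij])
  have eq: "(\<lambda>p. k (fst p) (snd p) * (g (fst p) - g (snd p)) * (\<phi> (fst p) - \<phi> (snd p))) =
     (\<lambda>p. h p + h (prod.swap p))"
    by (rule ext) (simp add: h_def kernel_commute[of "snd _" "fst _"] algebra_simps)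
  show "(\<lambda>p. k (fst p) (snd p) * (g (fst p) - g (snd p)) * (\<phi> (fst p) - \<phi> (snd p))) abs_summable_on UNIV"
    unfolding eq by (intro abs_summable_on_add hs hs')
  show "(\<Sum>\<^sub>ap. k (fst p) (snd p) * (g (fst p) - g (snd p)) * (\<phi> (fst p) - \<phi> (snd p))) =
      2 * (\<Sum>x\<in>S. \<phi> x * generator g x)"
    unfolding eq infsetsum_add[OF hs hs'] he' he by simp
qed

lemma finite_support_bounded:
  fixes \<phi> :: "'a \<Rightarrow> real"
  assumes "finite S" "\<And>x. x \<notin> S \<Longrightarrow> \<phi> x = 0"
  shows "\<bar>\<phi> x\<bar> \<le> (\<Sum>y\<in>S. \<bar>\<phi> y\<bar>)"
proof (cases "x \<in> S")
  case True
  then show ?thesis using assms(1) by (intro member_le_sum) auto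
qed (simp add: assms sum_nonneg)

lemma energy_finite_support:
  assumes S: "finite S" "\<And>x. x \<notin> S \<Longrightarrow> \<phi> x = 0"
  shows "energy \<phi> = ennreal (\<Sum>x\<in>S. \<phi> x * generator \<phi> x)"
proof -
  note G = green[of \<phi> "\<Sum>y\<in>S. \<bar>\<phi> y\<bar>" S \<phi>, OF finite_support_bounded[OF S] S]
  have "energy \<phi> = (\<integral>\<^sup>+ p. ennreal (k (fst p) (snd p) * (\<phi> (fst p) - \<phi> (snd p)) * (\<phi> (fst p) - \<phi> (snd p)) / 2) \<partial>count_space UNIV)"
    unfolding energy_def by (simp add: power2_eq_square mult.assoc)
  also have "\<dots> = ennreal (\<Sum>\<^sub>ap. k (fst p) (snd p) * (\<phi> (fst p) - \<phi> (snd p)) * (\<phi> (fst p) - \<phi> (snd p)) / 2)"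
    by (rule nn_integral_conv_infsetsum)
      (use abs_summable_on_cmult_left[OF G(1), of "1/2"] kernel_nonneg in \<open>auto simp: mult.assoc\<close>)
  also have "(\<Sum>\<^sub>ap. k (fst p) (snd p) * (\<phi> (fst p) - \<phi> (snd p)) * (\<phi> (fst p) - \<phi> (snd p)) / 2) =
      (\<Sum>x\<in>S. \<phi> x * generator \<phi> x)"
    using G(2) infsetsum_cmult_left[of "1/2" "\<lambda>p. k (fst p) (snd p) * (\<phi> (fst p) - \<phi> (snd p)) * (\<phi> (fst p) - \<phi> (snd p))" UNIV] G(1)
    by simp
  finally show ?thesis .
qed

text \<open>Ground state transform: Green's formula for the pair $u$, $\varphi^2/u$.\<close>

lemma ground_state_transform:
  assumes u: "\<And>x. 0 < u x" "\<And>x. u x \<le> B" and S: "finite S" "\<And>x. x \<notin> S \<Longrightarrow> \<phi> x = 0"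
  obtains E where "0 \<le> E" "defect u \<phi> = ennreal E"
    "(\<lambda>p. k (fst p) (snd p) * (u (fst p) * u (snd p)) * (\<phi> (fst p) / u (fst p) - \<phi> (snd p) / u (snd p))\<^sup>2) abs_summable_on UNIV"
    "2 * E = (\<Sum>\<^sub>ap. k (fst p) (snd p) * (u (fst p) * u (snd p)) * (\<phi> (fst p) / u (fst p) - \<phi> (snd p) / u (snd p))\<^sup>2)"
    "(\<Sum>x\<in>S. \<phi> x * generator \<phi> x) = E + (\<Sum>x\<in>S. generator u x / u x * (\<phi> x)\<^sup>2)"
proof -
  define \<psi> where "\<psi> = (\<lambda>x. (\<phi> x)\<^sup>2 / u x)"
  have \<psi>: "x \<notin> S \<Longrightarrow> \<psi> x = 0" for x by (simp add: \<psi>_def S(2))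
  have ub: "\<bar>u x\<bar> \<le> B" for x using u[of x] by simp
  note G1 = green[of \<phi> "\<Sum>y\<in>S. \<bar>\<phi> y\<bar>" S \<phi>, OF finite_support_bounded[OF S] S]
  note G2 = green[of u B S \<psi>, OF ub S(1) \<psi>]
  let ?d = "\<lambda>p. k (fst p) (snd p) * (u (fst p) * u (snd p)) * (\<phi> (fst p) / u (fst p) - \<phi> (snd p) / u (snd p))\<^sup>2"
  have id: "?d = (\<lambda>p. k (fst p) (snd p) * (\<phi> (fst p) - \<phi> (snd p)) * (\<phi> (fst p) - \<phi> (snd p)) -
      k (fst p) (snd p) * (u (fst p) - u (snd p)) * (\<psi> (fst p) - \<psi> (snd p)))"
  proof (rule ext)
    fix p
    \<comment> \<open>Both sides equal (b/a) f^2 - 2 f g + (a/b) g^2; this is the whole algebraic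
      content of the transform.\<close>
    have *: "a * b * (f / a - g / b)\<^sup>2 = (f - g) * (f - g) - (a - b) * (f\<^sup>2 / a - g\<^sup>2 / b)"
      if "a \<noteq> 0" "b \<noteq> 0" for a b f g :: real
      using that by (simp add: power2_eq_square field_simps)
    have "u (fst p) \<noteq> 0" "u (snd p) \<noteq> 0" using u(1)[of "fst p"] u(1)[of "snd p"] by auto
    from *[OF this, of "\<phi> (fst p)" "\<phi> (snd p)"]
    show "?d p = k (fst p) (snd p) * (\<phi> (fst p) - \<phi> (snd p)) * (\<phi> (fst p) - \<phi> (snd p)) -
      k (fst p) (snd p) * (u (fst p) - u (snd p)) * (\<psi> (fst p) - \<psi> (snd p))"
      unfolding \<psi>_def mult.assoc[of "k (fst p) (snd p)"]
      by (simp only: right_diff_distrib[of "k (fst p) (snd p)", symmetric])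
  qed
  have ds: "?d abs_summable_on UNIV" unfolding id by (intro abs_summable_on_diff G1 G2)
  have de: "infsetsum ?d UNIV = 2 * (\<Sum>x\<in>S. \<phi> x * generator \<phi> x) - 2 * (\<Sum>x\<in>S. \<psi> x * generator u x)"
    unfolding id by (rule trans[OF infsetsum_diff[OF G1(1) G2(1)] arg_cong2[OF G1(2) G2(2), of "(-)"]])
  have nn: "0 \<le> ?d p" for p using kernel_nonneg u less_imp_le[OF u(1)] by (intro mult_nonneg_nonneg) auto
  show ?thesis
  proof (rule that[of "infsetsum ?d UNIV / 2"])
    show "0 \<le> infsetsum ?d UNIV / 2" using nn by (simp add: infsetsum_nonneg)
    have "defect u \<phi> = ennreal (\<Sum>\<^sub>ap. ?d p / 2)"
      unfolding defect_def
      by (rule nn_integral_conv_infsetsum) (use abs_summable_on_cmult_left[OF ds, of "1/2"] nn in auto)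
    also have "(\<Sum>\<^sub>ap. ?d p / 2) = infsetsum ?d UNIV / 2"
      using infsetsum_cmult_left[of "1/2" ?d UNIV] ds by simp
    finally show "defect u \<phi> = ennreal (infsetsum ?d UNIV / 2)" .
    show "?d abs_summable_on UNIV" by (rule ds)
    have w: "(\<Sum>x\<in>S. \<psi> x * generator u x) = (\<Sum>x\<in>S. generator u x / u x * (\<phi> x)\<^sup>2)"
      by (simp add: \<psi>_def mult_ac)
    have "infsetsum ?d UNIV / 2 = (\<Sum>x\<in>S. \<phi> x * generator \<phi> x) - (\<Sum>x\<in>S. \<psi> x * generator u x)"
      unfolding de right_diff_distrib[symmetric] by simp
    then show "(\<Sum>x\<in>S. \<phi> x * generator \<phi> x) = infsetsum ?d UNIV / 2 + (\<Sum>x\<in>S. generator u x / u x * (\<phi> x)\<^sup>2)"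
      unfolding w by (simp only: diff_add_cancel)
  qed simp
qed

text \<open>The bound on the defect is again an instance of Green's formula, now for the pair
  $u$, $(u - l)_+$.\<close>

lemma log_cutoff:
  assumes u: "\<And>x. 0 < u x" "\<And>x. u x \<le> B" and sup: "\<And>x. 0 \<le> generator u x"
    and l: "0 < l" "l < B" and fin: "finite {x. l < u x}"
  defines "\<phi> \<equiv> \<lambda>x. u x * (ln (max (u x) l / l) / ln (B / l))"
  shows "(\<Sum>x | l < u x. \<phi> x * generator \<phi> x) - (\<Sum>x | l < u x. generator u x / u x * (\<phi> x)\<^sup>2)
    \<le> (\<Sum>x | l < u x. generator u x * u x) / (ln (B / l))\<^sup>2"
proof -
  let ?S = "{x. l < u x}"
  let ?\<Lambda> = "ln (B / l)"
  have \<Lambda>: "0 < ?\<Lambda>" using l by simp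
  have \<phi>0: "\<phi> x = 0" if "x \<notin> ?S" for x using that l by (simp add: \<phi>_def max_absorb2)
  obtain E where E0: "0 \<le> E" "defect u \<phi> = ennreal E" and E:
    "(\<lambda>p. k (fst p) (snd p) * (u (fst p) * u (snd p)) * (\<phi> (fst p) / u (fst p) - \<phi> (snd p) / u (snd p))\<^sup>2) abs_summable_on UNIV"
    "2 * E = (\<Sum>\<^sub>ap. k (fst p) (snd p) * (u (fst p) * u (snd p)) * (\<phi> (fst p) / u (fst p) - \<phi> (snd p) / u (snd p))\<^sup>2)"
    "(\<Sum>x\<in>?S. \<phi> x * generator \<phi> x) = E + (\<Sum>x\<in>?S. generator u x / u x * (\<phi> x)\<^sup>2)"
    by (rule ground_state_transform[of u B ?S \<phi>, OF u fin \<phi>0]) (assumption, rule that)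
  define \<psi> where "\<psi> = (\<lambda>x. max (u x - l) 0)"
  have \<psi>0: "\<psi> x = 0" if "x \<notin> ?S" for x using that by (simp add: \<psi>_def)
  have ub: "\<bar>u x\<bar> \<le> B" for x using u[of x] by simp
  note G = green[of u B ?S \<psi>, OF ub fin \<psi>0]
  have "2 * E \<le> (\<Sum>\<^sub>ap. k (fst p) (snd p) * (u (fst p) - u (snd p)) * (\<psi> (fst p) - \<psi> (snd p)) * (1 / ?\<Lambda>\<^sup>2))"
    unfolding E(2)
  proof (rule infsetsum_mono[OF E(1)])
    show "(\<lambda>p. k (fst p) (snd p) * (u (fst p) - u (snd p)) * (\<psi> (fst p) - \<psi> (snd p)) * (1 / ?\<Lambda>\<^sup>2)) abs_summable_on UNIV"
      by (intro abs_summable_on_cmult_left G)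
    fix p :: "'a \<times> 'a"
    let ?a = "u (fst p)" and ?b = "u (snd p)"
    have a: "0 < ?a" "0 < ?b" using u by auto
    have "\<phi> (fst p) / ?a - \<phi> (snd p) / ?b = (ln (max ?a l / l) - ln (max ?b l / l)) / ?\<Lambda>"
      using a unfolding \<phi>_def by (simp add: diff_divide_distrib)
    then have "?a * ?b * (\<phi> (fst p) / ?a - \<phi> (snd p) / ?b)\<^sup>2 = ?a * ?b * (ln (max ?a l / l) - ln (max ?b l / l))\<^sup>2 * (1 / ?\<Lambda>\<^sup>2)"
      by (simp add: power_divide)
    also have "\<dots> \<le> (?a - ?b) * (\<psi> (fst p) - \<psi> (snd p)) * (1 / ?\<Lambda>\<^sup>2)"
      unfolding \<psi>_def using a l by (intro mult_right_mono ln_cutoff_le) auto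
    finally show "k (fst p) (snd p) * (?a * ?b) * (\<phi> (fst p) / ?a - \<phi> (snd p) / ?b)\<^sup>2
        \<le> k (fst p) (snd p) * (?a - ?b) * (\<psi> (fst p) - \<psi> (snd p)) * (1 / ?\<Lambda>\<^sup>2)"
      unfolding mult.assoc[of "k _ _"] by (intro mult_left_mono kernel_nonneg) (simp add: mult.assoc)
  qed
  also have "\<dots> = 2 * (\<Sum>x\<in>?S. \<psi> x * generator u x) / ?\<Lambda>\<^sup>2"
    using G by (subst infsetsum_cmult_left) auto
  finally have "E \<le> (\<Sum>x\<in>?S. \<psi> x * generator u x) / ?\<Lambda>\<^sup>2" by simp
  also have "\<dots> \<le> (\<Sum>x\<in>?S. generator u x * u x) / ?\<Lambda>\<^sup>2"
  proof (intro divide_right_mono sum_mono)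
    fix x assume "x \<in> ?S"
    then have "\<psi> x \<le> u x" using l by (simp add: \<psi>_def)
    then show "\<psi> x * generator u x \<le> generator u x * u x"
      using mult_right_mono[OF _ sup[of x], of "\<psi> x" "u x"] by (simp add: mult.commute)
  qed simp
  finally show ?thesis using E(3) by simp
qed

text \<open>Young's inequality, from (\<epsilon> b + c)^2 / \<epsilon> \<ge> 0 with c = b - a. It
  replaces the triangle inequality for the square root of the energy and shows that approximants
  cost at most slightly more energy than their limit.\<close>

lemma energy_add_le:
  assumes "0 < \<epsilon>"
  shows "energy \<phi> \<le> ennreal (1 + \<epsilon>) * energy v + ennreal (1 + 1 / \<epsilon>) * energy (\<lambda>x. v x - \<phi> x)"
proof -
  have *: "a\<^sup>2 \<le> (1 + \<epsilon>) * b\<^sup>2 + (1 + 1 / \<epsilon>) * (b - a)\<^sup>2" for a b :: real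
  proof -
    define c where "c = b - a"
    have "0 \<le> (\<epsilon> * b + c)\<^sup>2" by simp
    then have "0 \<le> (\<epsilon> * b + c)\<^sup>2 / \<epsilon>" using assms by simp
    also have "\<dots> = \<epsilon> * b\<^sup>2 + 2 * b * c + c\<^sup>2 / \<epsilon>" using assms by (simp add: power2_eq_square field_simps)
    finally have "0 \<le> \<epsilon> * b\<^sup>2 + 2 * b * c + c\<^sup>2 / \<epsilon>" .
    moreover have "a\<^sup>2 = b\<^sup>2 - 2 * b * c + c\<^sup>2" by (simp add: c_def power2_eq_square algebra_simps)
    moreover have "(1 + \<epsilon>) * b\<^sup>2 + (1 + 1 / \<epsilon>) * c\<^sup>2 = b\<^sup>2 + \<epsilon> * b\<^sup>2 + c\<^sup>2 + c\<^sup>2 / \<epsilon>"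
      by (simp add: algebra_simps)
    ultimately show ?thesis unfolding c_def[symmetric] by linarith
  qed
  have "energy \<phi> \<le> (\<integral>\<^sup>+ p. ennreal (1 + \<epsilon>) * ennreal (k (fst p) (snd p) * (v (fst p) - v (snd p))\<^sup>2 / 2) +
      ennreal (1 + 1 / \<epsilon>) * ennreal (k (fst p) (snd p) * ((v (fst p) - \<phi> (fst p)) - (v (snd p) - \<phi> (snd p)))\<^sup>2 / 2)
      \<partial>count_space UNIV)"
    unfolding energy_def
  proof (rule nn_integral_mono)
    fix p :: "'a \<times> 'a"
    let ?k = "k (fst p) (snd p)" and ?a = "\<phi> (fst p) - \<phi> (snd p)" and ?b = "v (fst p) - v (snd p)"
    have c: "(v (fst p) - \<phi> (fst p)) - (v (snd p) - \<phi> (snd p)) = ?b - ?a" by simp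
    have "?k * ?a\<^sup>2 / 2 \<le> ?k * ((1 + \<epsilon>) * ?b\<^sup>2 + (1 + 1 / \<epsilon>) * (?b - ?a)\<^sup>2) / 2"
      by (intro divide_right_mono mult_left_mono * kernel_nonneg) auto
    also have "\<dots> = (1 + \<epsilon>) * (?k * ?b\<^sup>2 / 2) + (1 + 1 / \<epsilon>) * (?k * (?b - ?a)\<^sup>2 / 2)"
      by (simp add: distrib_left add_divide_distrib mult_ac)
    finally have "?k * ?a\<^sup>2 / 2 \<le> (1 + \<epsilon>) * (?k * ?b\<^sup>2 / 2) + (1 + 1 / \<epsilon>) * (?k * (?b - ?a)\<^sup>2 / 2)" .
    then have "ennreal (?k * ?a\<^sup>2 / 2) \<le> ennreal ((1 + \<epsilon>) * (?k * ?b\<^sup>2 / 2) + (1 + 1 / \<epsilon>) * (?k * (?b - ?a)\<^sup>2 / 2))"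
      by (rule ennreal_leI)
    also have "\<dots> = ennreal ((1 + \<epsilon>) * (?k * ?b\<^sup>2 / 2)) + ennreal ((1 + 1 / \<epsilon>) * (?k * (?b - ?a)\<^sup>2 / 2))"
      using assms kernel_nonneg by (intro ennreal_plus mult_nonneg_nonneg divide_nonneg_nonneg) auto
    also have "ennreal ((1 + \<epsilon>) * (?k * ?b\<^sup>2 / 2)) = ennreal (1 + \<epsilon>) * ennreal (?k * ?b\<^sup>2 / 2)"
      using assms kernel_nonneg by (intro ennreal_mult mult_nonneg_nonneg divide_nonneg_nonneg) auto
    also have "ennreal ((1 + 1 / \<epsilon>) * (?k * (?b - ?a)\<^sup>2 / 2)) = ennreal (1 + 1 / \<epsilon>) * ennreal (?k * (?b - ?a)\<^sup>2 / 2)"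
      using assms kernel_nonneg by (intro ennreal_mult mult_nonneg_nonneg divide_nonneg_nonneg) auto
    finally show "ennreal (?k * ?a\<^sup>2 / 2) \<le> ennreal (1 + \<epsilon>) * ennreal (?k * ?b\<^sup>2 / 2) +
      ennreal (1 + 1 / \<epsilon>) * ennreal (?k * ((v (fst p) - \<phi> (fst p)) - (v (snd p) - \<phi> (snd p)))\<^sup>2 / 2)"
      unfolding c .
  qed
  also have "\<dots> = ennreal (1 + \<epsilon>) * energy v + ennreal (1 + 1 / \<epsilon>) * energy (\<lambda>x. v x - \<phi> x)"
    unfolding energy_def by (subst nn_integral_add) (auto simp: nn_integral_cmult)
  finally show ?thesis .
qed

lemma energy_pair_le: "ennreal (k x y * (g x - g y)\<^sup>2 / 2) \<le> energy g"
  unfolding energy_def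
  using nn_integral_ge_point[of "(x, y)" UNIV "\<lambda>p. ennreal (k (fst p) (snd p) * (g (fst p) - g (snd p))\<^sup>2 / 2)"] by simp

text \<open>The energy dominates the squared difference over any single pair of positive weight.
  Convergence at one site therefore spreads along such pairs, starting from the origin, which the
  form norm controls directly.\<close>

lemma pointwise_limit_step:
  assumes k: "0 < k x y" and E: "(\<lambda>n. energy (g n)) \<longlonglongrightarrow> 0" and y: "(\<lambda>n. g n y) \<longlonglongrightarrow> 0"
  shows "(\<lambda>n. g n x) \<longlonglongrightarrow> 0"
proof -
  have "(\<lambda>n. ennreal (k x y * (g n x - g n y)\<^sup>2 / 2)) \<longlonglongrightarrow> 0"
    by (rule tendsto_sandwich[OF _ _ tendsto_const E]) (auto intro!: always_eventually energy_pair_le)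
  then have "(\<lambda>n. k x y * (g n x - g n y)\<^sup>2 / 2) \<longlonglongrightarrow> 0"
    using k by (subst (asm) ennreal_0[symmetric], subst (asm) tendsto_ennreal_iff) auto
  from tendsto_mult_left[OF this, of "2 / k x y"] have "(\<lambda>n. (g n x - g n y)\<^sup>2) \<longlonglongrightarrow> 0"
    using k by simp
  then have "(\<lambda>n. sqrt ((g n x - g n y)\<^sup>2)) \<longlonglongrightarrow> sqrt 0" by (rule tendsto_real_sqrt)
  then have "(\<lambda>n. g n x - g n y) \<longlonglongrightarrow> 0" by (simp add: tendsto_rabs_zero_iff)
  from tendsto_add[OF this y] show ?thesis by simp
qed

text \<open>Superadditivity of the lower limit; the tail infima increase, so their suprema may be
  added.\<close>

lemma SUP_INF_add_le:
  fixes a b :: "nat \<Rightarrow> ennreal"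
  assumes "\<And>n. N \<le> n \<Longrightarrow> a n + b n \<le> c"
  shows "liminf a + liminf b \<le> c"
proof -
  let ?a = "\<lambda>m. INF n\<in>{m..}. a n" and ?b = "\<lambda>m. INF n\<in>{m..}. b n"
  have "incseq ?a" "incseq ?b" by (auto intro!: incseq_SucI INF_superset_mono)
  then have "liminf a + liminf b = (SUP m. ?a m + ?b m)"
    unfolding liminf_SUP_INF by (rule ennreal_SUP_add[symmetric])
  also have "\<dots> \<le> c"
  proof (rule SUP_least)
    fix m
    have "?a m + ?b m \<le> a (max m N) + b (max m N)" by (intro add_mono INF_lower) auto
    also have "\<dots> \<le> c" by (rule assms) simp
    finally show "?a m + ?b m \<le> c" .
  qed
  finally show ?thesis .
qed

lemma liminf_ennreal_eq:
  assumes "f \<longlonglongrightarrow> (l::real)"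
  shows "liminf (\<lambda>n. ennreal (f n)) = ennreal l"
  using lim_imp_Liminf[OF _ tendsto_ennrealI[OF assms]] by simp

text \<open>The ground state transform extends to limits in the form norm as an inequality, by Fatou.\<close>

lemma defect_le_energy:
  assumes u: "\<And>x. 0 < u x" "\<And>x. u x \<le> B" and sup: "\<And>x. 0 \<le> generator u x"
    and fs: "\<And>n. finite {x. \<phi> n x \<noteq> 0}"
    and E: "(\<lambda>n. energy (\<lambda>x. v x - \<phi> n x)) \<longlonglongrightarrow> 0"
    and lim: "\<And>x. (\<lambda>n. \<phi> n x) \<longlonglongrightarrow> v x"
  shows "energy v < \<infinity>"
    and "defect u v + (\<integral>\<^sup>+ x. ennreal (generator u x / u x * (v x)\<^sup>2) \<partial>count_space UNIV) \<le> energy v"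
proof -
  let ?w = "\<lambda>x. generator u x / u x"
  let ?W = "\<lambda>g. \<integral>\<^sup>+ x. ennreal (?w x * (g x)\<^sup>2) \<partial>count_space UNIV"
  have w: "0 \<le> ?w x" for x using u(1)[of x] sup[of x] by simp
  have split: "defect u (\<phi> n) + ?W (\<phi> n) = energy (\<phi> n)" for n
  proof -
    let ?S = "{x. \<phi> n x \<noteq> 0}"
    have 0: "x \<notin> ?S \<Longrightarrow> \<phi> n x = 0" for x by simp
    obtain D where D: "0 \<le> D" "defect u (\<phi> n) = ennreal D"
      "(\<lambda>p. k (fst p) (snd p) * (u (fst p) * u (snd p)) * (\<phi> n (fst p) / u (fst p) - \<phi> n (snd p) / u (snd p))\<^sup>2) abs_summable_on UNIV"
      "2 * D = (\<Sum>\<^sub>ap. k (fst p) (snd p) * (u (fst p) * u (snd p)) * (\<phi> n (fst p) / u (fst p) - \<phi> n (snd p) / u (snd p))\<^sup>2)"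
      "(\<Sum>x\<in>?S. \<phi> n x * generator (\<phi> n) x) = D + (\<Sum>x\<in>?S. ?w x * (\<phi> n x)\<^sup>2)"
      by (rule ground_state_transform[of u B ?S "\<phi> n", OF u fs 0]) (assumption, rule that)
    have wn: "0 \<le> ?w x * (\<phi> n x)\<^sup>2" for x using w[of x] by (rule mult_nonneg_nonneg) simp
    have w0: "x \<notin> ?S \<Longrightarrow> ?w x * (\<phi> n x)\<^sup>2 = 0" for x by simp
    note F = infsetsum_finite_support[of ?S "\<lambda>x. ?w x * (\<phi> n x)\<^sup>2", OF fs w0]
    have "?W (\<phi> n) = ennreal (\<Sum>\<^sub>ax. ?w x * (\<phi> n x)\<^sup>2)"
      by (rule nn_integral_conv_infsetsum[OF F(1) wn])
    also have "(\<Sum>\<^sub>ax. ?w x * (\<phi> n x)\<^sup>2) = (\<Sum>x\<in>?S. ?w x * (\<phi> n x)\<^sup>2)"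
      by (rule F(2))
    finally have "?W (\<phi> n) = ennreal (\<Sum>x\<in>?S. ?w x * (\<phi> n x)\<^sup>2)" .
    moreover have "0 \<le> (\<Sum>x\<in>?S. ?w x * (\<phi> n x)\<^sup>2)" by (intro sum_nonneg wn)
    ultimately show ?thesis
      using D(1,2,5) energy_finite_support[of ?S "\<phi> n", OF fs 0] by (simp add: ennreal_plus)
  qed
  obtain N where N: "energy (\<lambda>x. v x - \<phi> N x) < 1"
    using order_tendstoD(2)[OF E, of 1] unfolding eventually_sequentially by auto
  \<comment> \<open>\<open>energy_add_le\<close> with \<epsilon> = 1 and the roles of v and the
    approximant exchanged; the approximant has finite energy by its finite support.\<close>
  have "energy v \<le> ennreal 2 * energy (\<phi> N) + ennreal 2 * energy (\<lambda>x. v x - \<phi> N x)"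
  proof -
    have "energy (\<lambda>x. \<phi> N x - v x) = energy (\<lambda>x. v x - \<phi> N x)"
      unfolding energy_def by (intro nn_integral_cong arg_cong[of _ _ ennreal]) (simp add: power2_eq_square algebra_simps)
    then show ?thesis using energy_add_le[of 1 v "\<phi> N"] by simp
  qed
  also have "\<dots> < \<infinity>"
  proof -
    obtain a where a: "energy (\<phi> N) = ennreal a" using energy_finite_support[OF fs[of N], of "\<phi> N"] by auto
    obtain b where b: "energy (\<lambda>x. v x - \<phi> N x) = ennreal b"
      using N by (cases "energy (\<lambda>x. v x - \<phi> N x)") auto
    have "ennreal 2 * ennreal a < \<infinity>" "ennreal 2 * ennreal b < \<infinity>"
      unfolding infinity_ennreal_def by (intro ennreal_mult_less_top[THEN iffD2] disjI2; simp)+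
    then show ?thesis unfolding a b infinity_ennreal_def by (simp only: ennreal_add_less_top)
  qed
  finally show fin: "energy v < \<infinity>" .
  then obtain q where q: "0 \<le> q" "energy v = ennreal q" by (cases "energy v") auto
  have liminf: "defect u v + ?W v \<le> liminf (\<lambda>n. defect u (\<phi> n)) + liminf (\<lambda>n. ?W (\<phi> n))"
  proof (rule add_mono)
    have "defect u v = (\<integral>\<^sup>+ p. liminf (\<lambda>n. ennreal (k (fst p) (snd p) * (u (fst p) * u (snd p)) *
       (\<phi> n (fst p) / u (fst p) - \<phi> n (snd p) / u (snd p))\<^sup>2 / 2)) \<partial>count_space UNIV)"
      unfolding defect_def
      by (intro nn_integral_cong liminf_ennreal_eq[symmetric] tendsto_intros lim) (use u(1) in \<open>auto simp: less_imp_neq[symmetric]\<close>)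
    also have "\<dots> \<le> liminf (\<lambda>n. defect u (\<phi> n))"
      unfolding defect_def by (rule nn_integral_liminf) simp
    finally show "defect u v \<le> liminf (\<lambda>n. defect u (\<phi> n))" .
    have "?W v = (\<integral>\<^sup>+ x. liminf (\<lambda>n. ennreal (?w x * (\<phi> n x)\<^sup>2)) \<partial>count_space UNIV)"
      by (intro nn_integral_cong liminf_ennreal_eq[symmetric] tendsto_intros lim)
    also have "\<dots> \<le> liminf (\<lambda>n. ?W (\<phi> n))" by (rule nn_integral_liminf) simp
    finally show "?W v \<le> liminf (\<lambda>n. ?W (\<phi> n))" .
  qed
  have "defect u v + ?W v \<le> energy v + ennreal e" if e: "0 < e" for e
  proof -
    \<comment> \<open>The error e is shared equally: \<epsilon> pays for the factor 1 + \<epsilon>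
      on the energy q, and \<delta> then pays for the factor 1 + 1/\<epsilon> on the remainder. The
      summand 1 in q + 1 covers q = 0.\<close>
    define \<epsilon> where "\<epsilon> = e / (2 * (q + 1))"
    have \<epsilon>: "0 < \<epsilon>" "\<epsilon> * q \<le> e / 2"
      using e q by (auto simp: \<epsilon>_def field_simps)
    define \<delta> where "\<delta> = e / (2 * (1 + 1 / \<epsilon>))"
    have \<delta>: "0 < \<delta>" "(1 + 1 / \<epsilon>) * \<delta> = e / 2"
    proof -
      have *: "0 < 1 + 1 / \<epsilon>" using \<epsilon> by (simp add: add_pos_pos)
      then show "0 < \<delta>" unfolding \<delta>_def using e by (intro divide_pos_pos mult_pos_pos) auto
      have "c * (e / (2 * c)) = e / 2" if "0 < c" for c :: real using that by simp
      from this[OF *] show "(1 + 1 / \<epsilon>) * \<delta> = e / 2" unfolding \<delta>_def .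
    qed
    obtain N where N: "\<And>n. N \<le> n \<Longrightarrow> energy (\<lambda>x. v x - \<phi> n x) < ennreal \<delta>"
      using order_tendstoD(2)[OF E, of "ennreal \<delta>"] \<delta> unfolding eventually_sequentially by auto
    have "defect u (\<phi> n) + ?W (\<phi> n) \<le> energy v + ennreal e" if "N \<le> n" for n
    proof -
      have "defect u (\<phi> n) + ?W (\<phi> n) \<le> ennreal (1 + \<epsilon>) * energy v + ennreal (1 + 1 / \<epsilon>) * energy (\<lambda>x. v x - \<phi> n x)"
        unfolding split by (rule energy_add_le[OF \<epsilon>(1)])
      also have "\<dots> \<le> ennreal (1 + \<epsilon>) * ennreal q + ennreal (1 + 1 / \<epsilon>) * ennreal \<delta>"
        unfolding q(2) by (intro add_left_mono mult_left_mono[OF less_imp_le[OF N[OF that]]]) simp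
      also have "\<dots> = ennreal ((1 + \<epsilon>) * q + (1 + 1 / \<epsilon>) * \<delta>)"
        using \<epsilon> \<delta> q by (simp add: ennreal_mult[symmetric] ennreal_plus[symmetric] del: ennreal_plus)
      also have "\<dots> \<le> ennreal (q + e)"
        using \<epsilon> \<delta> by (intro ennreal_leI) (simp add: algebra_simps)
      also have "\<dots> = energy v + ennreal e" using q e by simp
      finally show ?thesis .
    qed
    from order_trans[OF liminf SUP_INF_add_le[OF this]] show ?thesis by simp
  qed
  then show "defect u v + ?W v \<le> energy v" by (rule ennreal_le_epsilon)
qed

lemma defect_eq_0D:
  assumes "defect u v = 0" "\<And>x. 0 < u x" "0 < k x y"
  shows "v x / u x = v y / u y"
proof -
  have "ennreal (k x y * (u x * u y) * (v x / u x - v y / u y)\<^sup>2 / 2) \<le> defect u v"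
    unfolding defect_def
    using nn_integral_ge_point[of "(x, y)" UNIV "\<lambda>p. ennreal (k (fst p) (snd p) * (u (fst p) * u (snd p)) *
     (v (fst p) / u (fst p) - v (snd p) / u (snd p))\<^sup>2 / 2)"] by simp
  then have "k x y * (u x * u y) * (v x / u x - v y / u y)\<^sup>2 \<le> 0"
    unfolding assms(1) by (simp add: ennreal_eq_0_iff)
  moreover have "0 < k x y * (u x * u y)" using assms by simp
  ultimately have "\<not> 0 < (v x / u x - v y / u y)\<^sup>2" using mult_pos_pos by (meson not_le)
  then show ?thesis by simp
qed

end

section \<open>Fractional powers of the generator\<close>

lemma infsetsum_lborel_swap:
  fixes F :: "real \<Rightarrow> 'b::countable \<Rightarrow> real"
  assumes m: "\<And>y. (\<lambda>t. F t y) \<in> borel_measurable borel"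
    and s: "\<And>t. F t abs_summable_on UNIV"
    and D: "integrable lborel D" and b: "\<And>t. (\<Sum>\<^sub>ay. \<bar>F t y\<bar>) \<le> D t"
  shows "(\<lambda>y. LINT t|lborel. F t y) abs_summable_on UNIV"
    and "(\<Sum>\<^sub>ay. LINT t|lborel. F t y) = (LINT t|lborel. (\<Sum>\<^sub>ay. F t y))"
proof -
  interpret pair_sigma_finite "count_space (UNIV :: 'b set)" "lborel :: real measure"
    by (intro pair_sigma_finite.intro sigma_finite_measure_count_space_countable sigma_finite_lborel) auto
  have meas: "(\<lambda>(y, t). F t y) \<in> borel_measurable (count_space (UNIV :: 'b set) \<Otimes>\<^sub>M (lborel :: real measure))"
    by (rule measurable_pair_measure_countable1) (use m in auto)
  have "(\<integral>\<^sup>+ p. ennreal (norm (case p of (y, t) \<Rightarrow> F t y)) \<partial>(count_space UNIV \<Otimes>\<^sub>M lborel)) =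
      (\<integral>\<^sup>+ t. (\<integral>\<^sup>+ y. ennreal (norm (F t y)) \<partial>count_space UNIV) \<partial>lborel)"
    using nn_integral_snd[of "\<lambda>p. ennreal (norm (case p of (y, t) \<Rightarrow> F t y))"] meas by simp
  also have "\<dots> = (\<integral>\<^sup>+ t. ennreal (\<Sum>\<^sub>ay. \<bar>F t y\<bar>) \<partial>lborel)"
    using abs_summable_on_normI[OF s] by (intro nn_integral_cong) (subst nn_integral_conv_infsetsum, auto)
  also have "\<dots> \<le> (\<integral>\<^sup>+ t. ennreal (norm (D t)) \<partial>lborel)"
  proof (intro nn_integral_mono ennreal_leI)
    show "(\<Sum>\<^sub>ay. \<bar>F t y\<bar>) \<le> norm (D t)" for t using b[of t] by simp
  qed
  also have "\<dots> < \<infinity>" using D unfolding integrable_iff_bounded by simp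
  finally have I: "integrable (count_space UNIV \<Otimes>\<^sub>M lborel) (\<lambda>(y, t). F t y)"
    by (intro integrableI_bounded meas)
  show "(\<lambda>y. LINT t|lborel. F t y) abs_summable_on UNIV"
    unfolding abs_summable_on_def using integrable_fst[OF I] by simp
  show "(\<Sum>\<^sub>ay. LINT t|lborel. F t y) = (LINT t|lborel. (\<Sum>\<^sub>ay. F t y))"
    unfolding infsetsum_def using Fubini_integral[OF I] by simp
qed

lemma set_integral_FTC_0_inf:
  fixes f F :: "real \<Rightarrow> real"
  assumes F: "\<And>t. 0 < t \<Longrightarrow> (F has_real_derivative f t) (at t)"
    and c: "continuous_on {0<..} f" and i: "set_integrable lborel {0<..} f"
    and lim: "(F \<longlongrightarrow> A) (at_right 0)" "(F \<longlongrightarrow> B) at_top"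
  shows "(LINT t:{0<..}|lborel. f t) = B - A"
proof -
  have e: "einterval 0 \<infinity> = {0<..}" by (auto simp: einterval_def zero_ereal_def)
  have "(LBINT x=0..\<infinity>. f x) = B - A"
  proof (rule interval_integral_FTC_integrable)
    show "isCont f x" if "0 < ereal x" for x
      using c that by (simp add: continuous_on_eq_continuous_at zero_ereal_def)
    show "(F has_vector_derivative f x) (at x)" if "0 < ereal x" for x
      using F[of x] that by (simp add: has_real_derivative_iff_has_vector_derivative zero_ereal_def)
    show "((F \<circ> real_of_ereal) \<longlongrightarrow> A) (at_right 0)" "((F \<circ> real_of_ereal) \<longlongrightarrow> B) (at_left \<infinity>)"
      using lim by (simp_all add: ereal_tendsto_simps1 zero_ereal_def)
    show "set_integrable lborel (einterval 0 \<infinity>) f" unfolding e by (rule i)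
  qed simp
  then show ?thesis by (simp add: interval_lebesgue_integral_def e)
qed

text \<open>The mean value theorem; on [0, 1/2] the base 1 - z stays above 1/2 and the exponent e -
  1 above -(\<bar>e\<bar> + 1), whence the power of 2.\<close>

lemma abs_one_minus_powr_le:
  fixes e \<tau> :: real
  assumes "0 \<le> \<tau>" "\<tau> \<le> 1 / 2"
  shows "\<bar>1 - (1 - \<tau>) powr e\<bar> \<le> \<bar>e\<bar> * 2 powr (\<bar>e\<bar> + 1) * \<tau>"
proof (cases "\<tau> = 0")
  case False
  then have \<tau>: "0 < \<tau>" using assms by simp
  have "\<exists>z. 0 < z \<and> z < \<tau> \<and> (1 - \<tau>) powr e - (1 - 0) powr e = (\<tau> - 0) * (- e * (1 - z) powr (e - 1))"
  proof (rule MVT2[OF \<tau>])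
    fix x assume "0 \<le> x" "x \<le> \<tau>"
    then have "0 < 1 - x" using assms by simp
    then show "((\<lambda>x. (1 - x) powr e) has_real_derivative - e * (1 - x) powr (e - 1)) (at x)"
      by (auto intro!: derivative_eq_intros)
  qed
  then obtain z where z: "0 < z" "z < \<tau>" "(1 - \<tau>) powr e - 1 = \<tau> * (- e * (1 - z) powr (e - 1))" by auto
  have "(1 - z) powr (e - 1) \<le> (1 - z) powr (- (\<bar>e\<bar> + 1))"
    using z assms by (intro powr_mono') auto
  also have "\<dots> \<le> (1 / 2) powr (- (\<bar>e\<bar> + 1))"
    using z assms by (intro powr_mono2') auto
  also have "\<dots> = 2 powr (\<bar>e\<bar> + 1)" by (simp only: powr_minus powr_divide) simp
  finally have "\<bar>e\<bar> * (1 - z) powr (e - 1) \<le> \<bar>e\<bar> * 2 powr (\<bar>e\<bar> + 1)" by (intro mult_left_mono) auto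
  then have "\<bar>e\<bar> * (1 - z) powr (e - 1) * \<tau> \<le> \<bar>e\<bar> * 2 powr (\<bar>e\<bar> + 1) * \<tau>"
    using \<tau> by (intro mult_right_mono) auto
  moreover have "\<bar>1 - (1 - \<tau>) powr e\<bar> = \<bar>e\<bar> * (1 - z) powr (e - 1) * \<tau>"
    using \<tau> unfolding abs_minus_commute[of 1] z(3) by (simp add: abs_mult)
  ultimately show ?thesis by simp
qed simp

text \<open>The kernel of the map $s^{\alpha - 1} \mapsto s^{\alpha - 1 - \sigma}$; it is homogeneous, so
  its action on powers is determined up to the constant $\int_0^\infty$ of the profile at $s = 1$.\<close>

definition marchaud_kernel :: "real \<Rightarrow> real \<Rightarrow> real \<Rightarrow> real \<Rightarrow> real" where
  "marchaud_kernel \<sigma> \<alpha> s t = (s powr (\<alpha> - 1) - (if t < s then (s - t) powr (\<alpha> - 1) else 0)) * t powr (-1 - \<sigma>)"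

lemma marchaud_kernel_scale:
  assumes "0 < s" "0 < \<tau>"
  shows "s * marchaud_kernel \<sigma> \<alpha> s (s * \<tau>) = s powr (\<alpha> - 1 - \<sigma>) * marchaud_kernel \<sigma> \<alpha> 1 \<tau>"
proof -
  have l: "s * \<tau> < s \<longleftrightarrow> \<tau> < 1" using assms by (simp add: mult_less_cancel_left2)
  have "s - s * \<tau> = s * (1 - \<tau>)" by (simp add: algebra_simps)
  then have 1: "(if s * \<tau> < s then (s - s * \<tau>) powr (\<alpha> - 1) else 0) =
      s powr (\<alpha> - 1) * (if \<tau> < 1 then (1 - \<tau>) powr (\<alpha> - 1) else 0)"
    using assms l by (simp add: powr_mult)
  have 2: "(s * \<tau>) powr (-1 - \<sigma>) = s powr (-1 - \<sigma>) * \<tau> powr (-1 - \<sigma>)" using assms by (simp add: powr_mult)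
  have "s powr (\<alpha> - 1 - \<sigma>) = s powr (1 + ((\<alpha> - 1) + (-1 - \<sigma>)))"
    by (rule arg_cong[of _ _ "\<lambda>e. s powr e"]) simp
  then have 3: "s powr (\<alpha> - 1 - \<sigma>) = s * (s powr (\<alpha> - 1) * s powr (-1 - \<sigma>))"
    using assms by (simp only: powr_add) simp
  show ?thesis
    unfolding marchaud_kernel_def 1 2 3 by (simp add: left_diff_distrib right_diff_distrib mult_ac)
qed

text \<open>Near 0 the difference of powers is O(t) and leaves t^(-\<sigma>), near 1 the singularity
  (1 - t)^(\<alpha>-1) is integrable by \<alpha> > 0, and from 1 on only t^(-1-\<sigma>)
  remains.\<close>

lemma set_integrable_marchaud_profile:
  assumes \<sigma>: "0 < \<sigma>" "\<sigma> < 1" and \<alpha>: "0 < \<alpha>"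
  shows "set_integrable lborel {0<..} (marchaud_kernel \<sigma> \<alpha> 1)"
proof -
  define C where "C = max (\<bar>\<alpha> - 1\<bar> * 2 powr (\<bar>\<alpha> - 1\<bar> + 1)) (2 powr (1 + \<sigma>))"
  have C: "\<bar>\<alpha> - 1\<bar> * 2 powr (\<bar>\<alpha> - 1\<bar> + 1) \<le> C" "2 powr (1 + \<sigma>) \<le> C" "0 \<le> C"
    by (auto simp: C_def le_max_iff_disj)
  have C1: "1 \<le> C" using C(2) \<sigma> by (intro order_trans[OF _ C(2)]) (simp add: ge_one_powr_ge_zero)
  let ?p = "\<lambda>t::real. if t \<le> 1 then t powr ((1 - \<sigma>) - 1) else t powr (- \<sigma> - 1)"
  \<comment> \<open>The singular part is the integrable power on (0, 1] reflected by t -> 1 - t,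
    written in the form of the affine substitution.\<close>
  let ?q = "\<lambda>t::real. indicator {0<..1} (1 + (-1) * t) *\<^sub>R (1 + (-1) * t) powr (\<alpha> - 1)"
  have p: "integrable lborel (\<lambda>t. indicator {0<..} t *\<^sub>R ?p t)"
    using set_integrable_two_powers[of "1 - \<sigma>" \<sigma>] \<sigma> by (simp add: set_integrable_def)
  have q: "integrable lborel ?q"
    using lborel_integrable_real_affine[OF set_integrable_powr_0_1[OF \<alpha>, unfolded set_integrable_def], of "-1" 1] by simp
  have "integrable lborel (\<lambda>t. C * (indicator {0<..} t *\<^sub>R ?p t) + C * ?q t)"
    using p q by (intro Bochner_Integration.integrable_add integrable_mult_right)
  then show ?thesis
    unfolding set_integrable_def
  proof (rule Bochner_Integration.integrable_bound)
    show "(\<lambda>t. indicator {0<..} t *\<^sub>R marchaud_kernel \<sigma> \<alpha> 1 t) \<in> borel_measurable lborel"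
      unfolding marchaud_kernel_def by measurable
    show "AE t in lborel. norm (indicator {0<..} t *\<^sub>R marchaud_kernel \<sigma> \<alpha> 1 t)
       \<le> norm (C * (indicator {0<..} t *\<^sub>R ?p t) + C * ?q t)"
    proof (rule AE_I2)
      fix t :: real
      have q0: "0 \<le> C * ?q t" using C by (simp add: indicator_def)
      have p0: "0 \<le> C * ?p t" using C by simp
      have "\<bar>marchaud_kernel \<sigma> \<alpha> 1 t\<bar> \<le> C * ?p t + C * ?q t" if t: "0 < t"
      proof -
        consider "t \<le> 1/2" | "1/2 < t" "t < 1" | "1 \<le> t" by linarith
        then show ?thesis
        proof cases
          case 1
          have "\<bar>marchaud_kernel \<sigma> \<alpha> 1 t\<bar> = \<bar>1 - (1 - t) powr (\<alpha> - 1)\<bar> * t powr (-1 - \<sigma>)"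
            using 1 by (simp add: marchaud_kernel_def abs_mult)
          also have "\<dots> \<le> (\<bar>\<alpha> - 1\<bar> * 2 powr (\<bar>\<alpha> - 1\<bar> + 1) * t) * t powr (-1 - \<sigma>)"
            using 1 t by (intro mult_right_mono abs_one_minus_powr_le) auto
          also have "\<dots> \<le> (C * t) * t powr (-1 - \<sigma>)"
            using C t by (intro mult_right_mono) auto
          also have "\<dots> = C * t powr (1 + (-1 - \<sigma>))" using t by (simp only: powr_add) simp
          also have "\<dots> = C * ?p t" using 1 by simp
          finally show ?thesis using q0 by linarith
        next
          case 2
          have "t powr (-1 - \<sigma>) \<le> (1 / 2) powr (- (1 + \<sigma>))"
            using 2 \<sigma> by (intro order_trans[OF powr_mono2'[of "-1 - \<sigma>" "1/2" t]]) auto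
          also have "\<dots> = 2 powr (1 + \<sigma>)" by (simp only: powr_minus powr_divide) simp
          finally have tp: "t powr (-1 - \<sigma>) \<le> C" using C by linarith
          have one: "1 \<le> t powr (- \<sigma>)" using 2 t \<sigma> by (simp add: powr_minus_divide powr_le1)
          have "\<bar>marchaud_kernel \<sigma> \<alpha> 1 t\<bar> = \<bar>1 - (1 - t) powr (\<alpha> - 1)\<bar> * t powr (-1 - \<sigma>)"
            using 2 by (simp add: marchaud_kernel_def abs_mult)
          also have "\<dots> \<le> (1 + (1 - t) powr (\<alpha> - 1)) * C"
            using tp by (intro mult_mono) (auto simp: abs_le_iff)
          also have "\<dots> \<le> (t powr (- \<sigma>) + (1 - t) powr (\<alpha> - 1)) * C"
            using one C by (intro mult_right_mono) auto
          also have "\<dots> = C * ?p t + C * ?q t"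
            using 2 by (simp add: algebra_simps)
          finally show ?thesis .
        next
          case 3
          have "\<bar>marchaud_kernel \<sigma> \<alpha> 1 t\<bar> = t powr (- \<sigma> - 1)"
            using 3 unfolding minus_diff_commute[of \<sigma> 1] by (simp add: marchaud_kernel_def)
          also have "\<dots> = ?p t" using 3 by (cases "t = 1") auto
          also have "\<dots> \<le> C * ?p t" using mult_right_mono[OF C1, of "?p t"] by simp
          finally show ?thesis using q0 by linarith
        qed
      qed
      then show "norm (indicator {0<..} t *\<^sub>R marchaud_kernel \<sigma> \<alpha> 1 t)
       \<le> norm (C * (indicator {0<..} t *\<^sub>R ?p t) + C * ?q t)"
        using q0 p0 by (cases "0 < t") auto
    qed
  qed
qed

text \<open>Writing the difference of the two time integrals as a single integral of m against
  \<open>marchaud_kernel\<close> and exchanging the order leaves an inner integral in t that depends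
  on s only through s^(\<alpha>-1-\<sigma>). The sign of m serves to compute the absolute integrals
  that justify the exchange.\<close>

lemma marchaud_fubini:
  fixes m :: "real \<Rightarrow> real"
  assumes \<sigma>: "0 < \<sigma>" "\<sigma> < 1" and \<alpha>: "0 < \<alpha>"
    and meas[measurable]: "m \<in> borel_measurable borel" and nn: "\<And>s. 0 < s \<Longrightarrow> 0 \<le> m s"
    and i1: "\<And>t. 0 \<le> t \<Longrightarrow> set_integrable lborel {0<..} (\<lambda>s. m (t + s) * s powr (\<alpha> - 1))"
    and i2: "set_integrable lborel {0<..} (\<lambda>s. m s * s powr (\<alpha> - 1 - \<sigma>))"
  shows "(LINT t:{0<..}|lborel. t powr (-1 - \<sigma>) *
      ((LINT s:{0<..}|lborel. m s * s powr (\<alpha> - 1)) - (LINT s:{0<..}|lborel. m (t + s) * s powr (\<alpha> - 1)))) =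
    (LINT s:{0<..}|lborel. m s * s powr (\<alpha> - 1 - \<sigma>)) * (LINT \<tau>:{0<..}|lborel. marchaud_kernel \<sigma> \<alpha> 1 \<tau>)"
proof -
  let ?k = "marchaud_kernel \<sigma> \<alpha>"
  let ?i = "\<lambda>t::real. indicat_real {0<..} t"
  define G where "G = (\<lambda>s t. ?i s * ?i t * (m s * ?k s t))"
  have B: "integrable lborel (\<lambda>\<tau>. ?i \<tau> * ?k 1 \<tau>)"
    using set_integrable_marchaud_profile[OF \<sigma> \<alpha>] by (simp add: set_integrable_def)
  have Gmeas: "case_prod G \<in> borel_measurable (lborel \<Otimes>\<^sub>M lborel)"
    unfolding G_def marchaud_kernel_def by measurable
  \<comment> \<open>The substitution t = s \<tau> separates the variables; the factor 1/s cancels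
    against the Jacobian s.\<close>
  have Gs: "G s (0 + s * \<tau>) = (1 / s) * (?i s * (m s * s powr (\<alpha> - 1 - \<sigma>)) * (?i \<tau> * ?k 1 \<tau>))" if "0 < s" for s \<tau>
  proof -
    have "?i (0 + s * \<tau>) = ?i \<tau>" using that by (auto simp: indicator_def zero_less_mult_iff)
    moreover have "?i \<tau> * ?k s (0 + s * \<tau>) = ?i \<tau> * ((1 / s) * (s powr (\<alpha> - 1 - \<sigma>) * ?k 1 \<tau>))"
      using marchaud_kernel_scale[OF that, of \<tau> \<sigma> \<alpha>] that by (cases "0 < \<tau>") (auto simp: field_simps)
    moreover have "G s (0 + s * \<tau>) = ?i s * m s * (?i (0 + s * \<tau>) * ?k s (0 + s * \<tau>))"
      by (simp add: G_def mult_ac)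
    ultimately have "G s (0 + s * \<tau>) = ?i s * m s * (?i \<tau> * ((1 / s) * (s powr (\<alpha> - 1 - \<sigma>) * ?k 1 \<tau>)))"
      by (simp only:)
    then show ?thesis by (simp add: mult_ac)
  qed
  have Gint: "integrable lborel (G s)" for s
  proof (cases "0 < s")
    case True
    have "integrable lborel (\<lambda>\<tau>. G s (0 + s * \<tau>))"
      unfolding Gs[OF True] using B by (intro integrable_mult_right)
    then show ?thesis using lborel_integrable_real_affine_iff[of s "G s" 0] True by simp
  qed (simp add: G_def)
  have Gval: "(LINT t|lborel. G s t) = ?i s * (m s * s powr (\<alpha> - 1 - \<sigma>)) * (LINT \<tau>|lborel. ?i \<tau> * ?k 1 \<tau>)"
    and Gabs: "(LINT t|lborel. norm (G s t)) = ?i s * (m s * s powr (\<alpha> - 1 - \<sigma>)) * (LINT \<tau>|lborel. \<bar>?i \<tau> * ?k 1 \<tau>\<bar>)" for s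
  proof -
    let ?a = "?i s * (m s * s powr (\<alpha> - 1 - \<sigma>))"
    show "(LINT t|lborel. G s t) = ?a * (LINT \<tau>|lborel. ?i \<tau> * ?k 1 \<tau>)"
    proof (cases "0 < s")
      case True
      have "(LINT t|lborel. G s t) = s * (LINT \<tau>|lborel. G s (0 + s * \<tau>))"
        using lborel_integral_real_affine[of s "G s" 0] True by simp
      then show ?thesis unfolding Gs[OF True] using True by simp
    qed (simp add: G_def)
    show "(LINT t|lborel. norm (G s t)) = ?a * (LINT \<tau>|lborel. \<bar>?i \<tau> * ?k 1 \<tau>\<bar>)"
    proof (cases "0 < s")
      case True
      have "(LINT t|lborel. norm (G s t)) = s * (LINT \<tau>|lborel. norm (G s (0 + s * \<tau>)))"
        using lborel_integral_real_affine[of s "\<lambda>t. norm (G s t)" 0] True by simp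
      moreover have "norm (G s (0 + s * \<tau>)) = (1 / s) * (?a * \<bar>?i \<tau> * ?k 1 \<tau>\<bar>)" for \<tau>
      proof -
        have "0 \<le> (1 / s) * ?a" using True nn[OF True] by simp
        moreover have "G s (0 + s * \<tau>) = (1 / s) * ?a * (?i \<tau> * ?k 1 \<tau>)"
          using Gs[OF True, of \<tau>] by (simp only: mult.assoc)
        moreover have "\<bar>c * y\<bar> = c * \<bar>y\<bar>" if "0 \<le> c" for c y :: real using that by (simp add: abs_mult)
        ultimately have "norm (G s (0 + s * \<tau>)) = (1 / s) * ?a * \<bar>?i \<tau> * ?k 1 \<tau>\<bar>" by (simp only: real_norm_def)
        then show ?thesis by (simp only: mult.assoc)
      qed
      ultimately show ?thesis using True by simp
    qed (simp add: G_def)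
  qed
  have I: "integrable (lborel \<Otimes>\<^sub>M lborel) (case_prod G)"
  proof (rule lborel_pair.Fubini_integrable[OF Gmeas])
    show "integrable lborel (\<lambda>s. LINT t|lborel. norm (case (s, t) of (s, t) \<Rightarrow> G s t))"
      using i2 unfolding prod.case Gabs set_integrable_def by simp
    show "AE s in lborel. integrable lborel (\<lambda>t. case (s, t) of (s, t) \<Rightarrow> G s t)"
      using Gint by simp
  qed
  have Gt: "(LINT s|lborel. G s t) = ?i t * (t powr (-1 - \<sigma>) *
      ((LINT s:{0<..}|lborel. m s * s powr (\<alpha> - 1)) - (LINT s:{0<..}|lborel. m (t + s) * s powr (\<alpha> - 1))))" for t
  proof (cases "0 < t")
    case True
    let ?f = "\<lambda>s. ?i s * (m s * s powr (\<alpha> - 1))"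
    \<comment> \<open>Translating s by t brings both integrals to the same value m s; the positivity
      of s - t becomes the condition t < s in the kernel.\<close>
    let ?g = "\<lambda>s. ?i (s - t) * (m s * (s - t) powr (\<alpha> - 1))"
    have f: "integrable lborel ?f" using i1[of 0] by (simp add: set_integrable_def)
    have gt: "?g (t + 1 * s) = ?i s * (m (t + s) * s powr (\<alpha> - 1))" for s by simp
    have g': "integrable lborel (\<lambda>s. ?g (t + 1 * s))"
      unfolding gt using i1[of t] True by (simp add: set_integrable_def)
    then have g: "integrable lborel ?g"
      using lborel_integrable_real_affine_iff[of 1 ?g t] by simp
    have gI: "(LINT s|lborel. ?g s) = (LINT s:{0<..}|lborel. m (t + s) * s powr (\<alpha> - 1))"
      using lborel_integral_real_affine[of 1 ?g t] unfolding gt by (simp add: set_lebesgue_integral_def)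
    have "G s t = t powr (-1 - \<sigma>) * (?f s - ?g s)" for s
      using True by (auto simp: G_def marchaud_kernel_def indicator_def algebra_simps)
    then have "(LINT s|lborel. G s t) = t powr (-1 - \<sigma>) * ((LINT s|lborel. ?f s) - (LINT s|lborel. ?g s))"
      using f g by (simp add: Bochner_Integration.integral_diff)
    then show ?thesis using True unfolding gI by (simp add: set_lebesgue_integral_def)
  qed (simp add: G_def)
  have "(LINT t|lborel. LINT s|lborel. G s t) = (LINT s|lborel. LINT t|lborel. G s t)"
    by (rule lborel_pair.Fubini_integral[OF I])
  then show ?thesis
    unfolding Gt Gval by (simp add: set_lebesgue_integral_def)
qed

lemma abs_Gamma_minus:
  fixes \<sigma> :: real
  assumes "0 < \<sigma>" "\<sigma> < 1"
  shows "\<bar>Gamma (- \<sigma>)\<bar> = Gamma (1 - \<sigma>) / \<sigma>" "0 < \<bar>Gamma (- \<sigma>)\<bar>"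
proof -
  have "- \<sigma> \<notin> \<int>\<^sub>\<le>\<^sub>0"
  proof
    assume "- \<sigma> \<in> \<int>\<^sub>\<le>\<^sub>0"
    then obtain n where "- \<sigma> = of_int n" by (auto elim!: nonpos_Ints_cases)
    then have "0 < - n" "- n < 1" using assms by linarith+
    then show False by simp
  qed
  then have "Gamma (- \<sigma> + 1) = - \<sigma> * Gamma (- \<sigma>)" by (rule Gamma_plus1)
  then have "Gamma (1 - \<sigma>) = - \<sigma> * Gamma (- \<sigma>)" by (simp add: add.commute)
  moreover have "0 < Gamma (1 - \<sigma>)" using assms by (simp add: Gamma_real_pos)
  ultimately have "\<bar>- \<sigma> * Gamma (- \<sigma>)\<bar> = Gamma (1 - \<sigma>)" by simp
  then show "\<bar>Gamma (- \<sigma>)\<bar> = Gamma (1 - \<sigma>) / \<sigma>" using assms by (simp add: abs_mult field_simps)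
  then show "0 < \<bar>Gamma (- \<sigma>)\<bar>" using \<open>0 < Gamma (1 - \<sigma>)\<close> assms by simp
qed

text \<open>Integration by parts: the primitive - t^(-\<sigma>) (1 - exp (-t)) / \<sigma> vanishes
  at both ends because 0 < \<sigma> < 1, and what remains is Gamma (1 - \<sigma>) / \<sigma>. It is
  the subordination formula for a power, evaluated at spectral value 1.\<close>

lemma one_minus_exp_integral:
  fixes \<sigma> :: real
  assumes \<sigma>: "0 < \<sigma>" "\<sigma> < 1"
  shows "(LINT t:{0<..}|lborel. t powr (-1 - \<sigma>) * (1 - exp (- t))) = \<bar>Gamma (- \<sigma>)\<bar>"
proof -
  let ?J = "\<lambda>t::real. t powr (-1 - \<sigma>) * (1 - exp (- t))"
  let ?g = "\<lambda>t::real. t powr (1 * (1 - \<sigma>) - 1) * exp (- (1 * t powr 1))"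
  let ?F = "\<lambda>t::real. - (t powr (- \<sigma>) * (1 - exp (- t)) / \<sigma>)"
  note G = Gamma_integral_powr[of 1 1 "1 - \<sigma>"]
  have e: "0 \<le> 1 - exp (- t)" "1 - exp (- t) \<le> t" "1 - exp (- t) \<le> 1" if "0 \<le> t" for t :: real
    using that exp_ge_add_one_self[of "-t"] by auto
  have J: "set_integrable lborel {0<..} ?J"
  proof (rule set_integrable_bound)
    show "set_integrable lborel {0<..} (\<lambda>t. if t \<le> 1 then t powr ((1 - \<sigma>) - 1) else t powr (- \<sigma> - 1))"
      using \<sigma> by (intro set_integrable_two_powers) auto
    show "AE t in lborel. t \<in> {0<..} \<longrightarrow> norm (?J t) \<le> norm (if t \<le> 1 then t powr ((1 - \<sigma>) - 1) else t powr (- \<sigma> - 1))"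
    proof (intro AE_I2 impI)
      fix t :: real assume "t \<in> {0<..}"
      then have t: "0 < t" by simp
      show "norm (?J t) \<le> norm (if t \<le> 1 then t powr ((1 - \<sigma>) - 1) else t powr (- \<sigma> - 1))"
      proof (cases "t \<le> 1")
        case True
        have "?J t \<le> t powr (-1 - \<sigma>) * t" using e[of t] t by (intro mult_left_mono) auto
        also have "\<dots> = t powr ((-1 - \<sigma>) + 1)" using t by (simp only: powr_add) simp
        finally show ?thesis using True e[of t] t by (simp add: abs_mult)
      next
        case False
        have "?J t \<le> t powr (-1 - \<sigma>) * 1" using e[of t] t by (intro mult_left_mono) auto
        then show ?thesis using False e[of t] t by (simp add: abs_mult diff_minus_eq_add minus_diff_commute)
      qed
    qed
  qed (simp add: set_borel_measurable_def)
  have g: "set_integrable lborel {0<..} ?g" using G \<sigma> by simp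
  have "(LINT t:{0<..}|lborel. ?J t - ?g t / \<sigma>) = 0 - 0"
  proof (rule set_integral_FTC_0_inf)
    fix t :: real assume t: "0 < t"
    have "t powr (- \<sigma> - 1) = t powr (-1 - \<sigma>)" by (rule arg_cong[of _ _ "\<lambda>e. t powr e"]) simp
    then show "(?F has_real_derivative ?J t - ?g t / \<sigma>) (at t)"
      using t \<sigma> by (auto intro!: derivative_eq_intros simp: divide_simps algebra_simps)
  next
    show "continuous_on {0<..} (\<lambda>t. ?J t - ?g t / \<sigma>)" using \<sigma> by (intro continuous_intros) auto
    show "set_integrable lborel {0<..} (\<lambda>t. ?J t - ?g t / \<sigma>)"
      using J g \<sigma> by (intro set_integral_diff(1)) auto
    show "(?F \<longlongrightarrow> 0) (at_right 0)"
    proof (rule Lim_null_comparison)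
      show "\<forall>\<^sub>F t in at_right 0. norm (?F t) \<le> t powr (1 - \<sigma>) / \<sigma>"
        using eventually_at_right_less[of "0::real"]
      proof eventually_elim
        case (elim t)
        have "t powr (- \<sigma>) * (1 - exp (- t)) \<le> t powr (- \<sigma>) * t"
          using e[of t] elim by (intro mult_left_mono) auto
        also have "\<dots> = t powr (- \<sigma> + 1)" using elim by (simp only: powr_add) simp
        finally show ?case using e[of t] elim \<sigma> by (simp add: abs_mult divide_right_mono)
      qed
      have "((\<lambda>t. t powr (1 - \<sigma>) / \<sigma>) \<longlongrightarrow> 0 powr (1 - \<sigma>) / \<sigma>) (at_right 0)"
        using \<sigma> by (intro tendsto_intros tendsto_powr2) (auto intro!: eventually_at_rightI[of 0 1])
      then show "((\<lambda>t. t powr (1 - \<sigma>) / \<sigma>) \<longlongrightarrow> 0) (at_right 0)" by simp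
    qed
    show "(?F \<longlongrightarrow> 0) at_top"
    proof (rule Lim_null_comparison)
      show "\<forall>\<^sub>F t in at_top. norm (?F t) \<le> t powr (- \<sigma>) / \<sigma>"
        using eventually_gt_at_top[of "0::real"]
      proof eventually_elim
        case (elim t)
        have "t powr (- \<sigma>) * (1 - exp (- t)) \<le> t powr (- \<sigma>) * 1"
          using e[of t] elim by (intro mult_left_mono) auto
        then show ?case using e[of t] elim \<sigma> by (simp add: abs_mult divide_right_mono)
      qed
      have "((\<lambda>t. t powr (- \<sigma>)) \<longlongrightarrow> 0) at_top"
        using \<sigma> by (intro tendsto_neg_powr filterlim_ident) auto
      from tendsto_divide[OF this tendsto_const[of \<sigma>]] show "((\<lambda>t. t powr (- \<sigma>) / \<sigma>) \<longlongrightarrow> 0) at_top"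
        using \<sigma> by simp
    qed
  qed
  then have "(LINT t:{0<..}|lborel. ?J t) = (LINT t:{0<..}|lborel. ?g t / \<sigma>)"
    using set_integral_diff(2)[OF J, of "\<lambda>t. ?g t / \<sigma>"] g \<sigma> by simp
  also have "\<dots> = Gamma (1 - \<sigma>) / \<sigma>"
    using G(2) \<sigma> set_integral_mult_left[of lborel "{0<..}" ?g "1 / \<sigma>"] by simp
  finally show ?thesis using abs_Gamma_minus[OF \<sigma>] by simp
qed

text \<open>The constant is found by testing on $m(s) = e^{-s}$.\<close>

lemma marchaud_constant:
  assumes \<sigma>: "0 < \<sigma>" "\<sigma> < 1" and \<alpha>: "\<sigma> < \<alpha>"
  shows "(LINT \<tau>:{0<..}|lborel. marchaud_kernel \<sigma> \<alpha> 1 \<tau>) = \<bar>Gamma (- \<sigma>)\<bar> * Gamma \<alpha> / Gamma (\<alpha> - \<sigma>)"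
proof -
  let ?m = "\<lambda>s::real. exp (- s)"
  have \<alpha>0: "0 < \<alpha>" using assms by simp
  have Gi: "set_integrable lborel {0<..} (\<lambda>s. ?m s * s powr (\<beta> - 1))"
    and GI: "(LINT s:{0<..}|lborel. ?m s * s powr (\<beta> - 1)) = Gamma \<beta>" if "0 < \<beta>" for \<beta> :: real
  proof -
    have *: "s powr (1 * \<beta> - 1) * exp (- (1 * s powr 1)) = ?m s * s powr (\<beta> - 1)" if "s \<in> {0<..}" for s
      using that by simp
    show "set_integrable lborel {0<..} (\<lambda>s. ?m s * s powr (\<beta> - 1))"
    proof -
      have "set_integrable lborel {0<..} (\<lambda>s. s powr (1 * \<beta> - 1) * exp (- (1 * s powr 1))) =
          set_integrable lborel {0<..} (\<lambda>s. ?m s * s powr (\<beta> - 1))"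
        by (rule set_integrable_cong[OF refl refl *])
      then show ?thesis using Gamma_integral_powr(1)[of 1 1 \<beta>] that by (simp only:)
    qed
    have "(LINT s:{0<..}|lborel. ?m s * s powr (\<beta> - 1)) = (LINT s:{0<..}|lborel. s powr (1 * \<beta> - 1) * exp (- (1 * s powr 1)))"
      by (rule set_lebesgue_integral_cong) (use * in auto)
    then show "(LINT s:{0<..}|lborel. ?m s * s powr (\<beta> - 1)) = Gamma \<beta>"
      using Gamma_integral_powr(2)[of 1 1 \<beta>] that by simp
  qed
  \<comment> \<open>For the exponential a time shift is multiplication by exp (-t), so the
    difference of time integrals collapses to Gamma \<alpha> times 1 - exp (-t).\<close>
  have shift: "(\<lambda>s. ?m (t + s) * s powr (\<alpha> - 1)) = (\<lambda>s. exp (- t) * (?m s * s powr (\<alpha> - 1)))" for t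
    by (rule ext) (simp add: exp_diff exp_minus field_simps)
  have "(LINT t:{0<..}|lborel. t powr (-1 - \<sigma>) * (Gamma \<alpha> - exp (- t) * Gamma \<alpha>)) =
      Gamma (\<alpha> - \<sigma>) * (LINT \<tau>:{0<..}|lborel. marchaud_kernel \<sigma> \<alpha> 1 \<tau>)"
  proof -
    have e: "\<alpha> - 1 - \<sigma> = (\<alpha> - \<sigma>) - 1" by simp
    have "(LINT t:{0<..}|lborel. t powr (-1 - \<sigma>) *
      ((LINT s:{0<..}|lborel. ?m s * s powr (\<alpha> - 1)) - (LINT s:{0<..}|lborel. ?m (t + s) * s powr (\<alpha> - 1)))) =
      (LINT s:{0<..}|lborel. ?m s * s powr (\<alpha> - 1 - \<sigma>)) * (LINT \<tau>:{0<..}|lborel. marchaud_kernel \<sigma> \<alpha> 1 \<tau>)"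
    proof (rule marchaud_fubini[OF \<sigma> \<alpha>0])
      show "set_integrable lborel {0<..} (\<lambda>s. ?m (t + s) * s powr (\<alpha> - 1))" for t
        unfolding shift by (intro set_integrable_mult_right Gi \<alpha>0)
      show "set_integrable lborel {0<..} (\<lambda>s. ?m s * s powr (\<alpha> - 1 - \<sigma>))"
        unfolding e by (rule Gi) (use \<alpha> in simp)
    qed simp_all
    then show ?thesis
      unfolding shift e set_integral_mult_right using GI[OF \<alpha>0] GI[of "\<alpha> - \<sigma>"] \<alpha> by simp
  qed
  moreover have "(\<lambda>t. t powr (-1 - \<sigma>) * (Gamma \<alpha> - exp (- t) * Gamma \<alpha>)) =
      (\<lambda>t. Gamma \<alpha> * (t powr (-1 - \<sigma>) * (1 - exp (- t))))"
    by (rule ext) (simp add: algebra_simps)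
  ultimately have "Gamma \<alpha> * \<bar>Gamma (- \<sigma>)\<bar> = Gamma (\<alpha> - \<sigma>) * (LINT \<tau>:{0<..}|lborel. marchaud_kernel \<sigma> \<alpha> 1 \<tau>)"
    using one_minus_exp_integral[OF \<sigma>] by simp
  moreover have "0 < Gamma (\<alpha> - \<sigma>)" using \<alpha> by (simp add: Gamma_real_pos)
  ultimately show ?thesis by (simp add: field_simps)
qed

section \<open>The fractional Laplacian as the generator of a summable kernel\<close>

lemma zsqnorm_minus [simp]: "zsqnorm (- x) = zsqnorm x"
  by (simp add: zsqnorm_def)

lemma kappa_minus: "kappa \<sigma> (- x) = kappa \<sigma> x"
proof -
  have "(LINT t:{0<..}|lborel. heat_kernel t (- x) / t powr (1 + \<sigma>)) =
      (LINT t:{0<..}|lborel. heat_kernel t x / t powr (1 + \<sigma>))"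
    by (rule set_lebesgue_integral_cong) (auto simp: heat_kernel_eq)
  then show ?thesis by (simp add: kappa_def delta0_def)
qed

lemma kappa_frac:
  assumes "0 < \<sigma>" "\<sigma> < 1"
  shows "kappa \<sigma> x = (if x = 0 then 0
    else (LINT t:{0<..}|lborel. t powr (-1 - \<sigma>) * lattice_kernel t x) / \<bar>Gamma (- \<sigma>)\<bar>)"
proof -
  have "(LINT t:{0<..}|lborel. heat_kernel t x / t powr (1 + \<sigma>)) =
      (LINT t:{0<..}|lborel. t powr (-1 - \<sigma>) * lattice_kernel t x)"
  proof (rule set_lebesgue_integral_cong)
    have "y / t powr (1 + \<sigma>) = t powr (-1 - \<sigma>) * y" for y t
      using powr_minus_divide[of t "1 + \<sigma>"] by simp
    then show "\<forall>t. t \<in> {0<..} \<longrightarrow> heat_kernel t x / t powr (1 + \<sigma>) = t powr (-1 - \<sigma>) * lattice_kernel t x"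
      by (auto simp: heat_kernel_eq)
  qed simp
  then show ?thesis using assms by (simp add: kappa_def)
qed

text \<open>A function vanishing at x sees only the mass that has left x by time t, which is 1 -
  p_t(0). This supplies the factor O(t) that compensates t^(-1-\<sigma>) near 0.\<close>

lemma infsetsum_lattice_kernel_off_diag:
  fixes h :: "int^'n \<Rightarrow> real"
  assumes t: "0 \<le> t" and h: "\<And>y. \<bar>h y\<bar> \<le> B" "h x = 0"
  shows "(\<lambda>y. lattice_kernel t (x - y) * h y) abs_summable_on UNIV"
    and "(\<Sum>\<^sub>ay. \<bar>lattice_kernel t (x - y) * h y\<bar>) \<le> B * (1 - lattice_kernel t (0 :: int^'n))"
proof -
  note P = abs_summable_kernel_shift[OF abs_summable_lattice_kernel[OF t], of x]
  have B: "0 \<le> B" using h(1)[of x] by linarith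
  show s: "(\<lambda>y. lattice_kernel t (x - y) * h y) abs_summable_on UNIV"
  proof (rule abs_summable_on_comparison_test)
    show "(\<lambda>y. lattice_kernel t (x - y) * B) abs_summable_on UNIV"
      by (intro abs_summable_on_cmult_left P)
    show "norm (lattice_kernel t (x - y) * h y) \<le> norm (lattice_kernel t (x - y) * B)" for y
      unfolding norm_mult using h(1)[of y] by (intro mult_left_mono) auto
  qed
  let ?D = "\<lambda>y. B * (lattice_kernel t (x - y) - (if y = x then lattice_kernel t (0 :: int^'n) else 0))"
  have d: "(\<lambda>y. if y = x then lattice_kernel t (0 :: int^'n) else 0) abs_summable_on UNIV"
    "(\<Sum>\<^sub>ay. if y = x then lattice_kernel t (0 :: int^'n) else 0) = lattice_kernel t (0 :: int^'n)"
    using infsetsum_finite_support[of "{x}" "\<lambda>y. if y = x then lattice_kernel t (0 :: int^'n) else 0"] by auto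
  have "(\<Sum>\<^sub>ay. \<bar>lattice_kernel t (x - y) * h y\<bar>) \<le> (\<Sum>\<^sub>ay. ?D y)"
  proof (rule infsetsum_mono)
    show "(\<lambda>y. \<bar>lattice_kernel t (x - y) * h y\<bar>) abs_summable_on UNIV"
      using abs_summable_on_normI[OF s] by simp
    show "?D abs_summable_on UNIV" by (intro abs_summable_on_cmult_right abs_summable_on_diff P d)
    show "\<bar>lattice_kernel t (x - y) * h y\<bar> \<le> ?D y" for y
      using h(1)[of y] h(2) lattice_kernel_nonneg[OF t, of "x - y"]
      by (auto simp: abs_mult mult.commute[of B] intro: mult_left_mono)
  qed
  also have "\<dots> = B * (1 - lattice_kernel t (0 :: int^'n))"
    using abs_summable_on_diff[OF P(1) d(1)]
    by (subst infsetsum_cmult_right) (auto simp: infsetsum_diff[OF P(1) d(1)] P(2) d(2) infsetsum_lattice_kernel[OF t])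
  finally show "(\<Sum>\<^sub>ay. \<bar>lattice_kernel t (x - y) * h y\<bar>) \<le> B * (1 - lattice_kernel t (0 :: int^'n))" .
qed

lemma powr_mult_min:
  fixes t :: real
  assumes "0 < t"
  shows "t powr (-1 - \<sigma>) * (if t \<le> 1 then t else 1) =
    (if t \<le> 1 then t powr ((1 - \<sigma>) - 1) else t powr (- \<sigma> - 1))"
proof -
  have "t powr ((1 - \<sigma>) - 1) = t powr ((-1 - \<sigma>) + 1)" by (rule arg_cong[of _ _ "\<lambda>e. t powr e"]) simp
  also have "\<dots> = t powr (-1 - \<sigma>) * t" using assms by (simp only: powr_add) simp
  finally have "t powr ((1 - \<sigma>) - 1) = t powr (-1 - \<sigma>) * t" .
  moreover have "t powr (- \<sigma> - 1) = t powr (-1 - \<sigma>)" by (rule arg_cong[of _ _ "\<lambda>e. t powr e"]) simp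
  ultimately show ?thesis by simp
qed

lemma one_minus_lattice_kernel_0_le:
  assumes "0 \<le> t"
  shows "1 - lattice_kernel t (0 :: int^'n) \<le> max 1 (2 * real CARD('n)) * (if t \<le> 1 then t else 1)"
proof (cases "t \<le> 1")
  case True
  have "2 * real CARD('n) * t \<le> max 1 (2 * real CARD('n)) * t" using assms by (intro mult_right_mono) auto
  then show ?thesis using lattice_kernel_0_ge[OF assms, where 'n='n] True by simp
next
  case False
  then show ?thesis using lattice_kernel_nonneg[OF assms, of "0 :: int^'n"] by simp
qed

text \<open>Summation over y and integration over t may be exchanged because the sum of absolute
  values is dominated by a multiple of t^(-1-\<sigma>) min(t, 1). In use h y is a difference g x - g
  y, which vanishes on the diagonal.\<close>

lemma kappa_frac_infsetsum:
  fixes h :: "int^'n \<Rightarrow> real"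
  assumes \<sigma>: "0 < \<sigma>" "\<sigma> < 1" and h: "\<And>y. \<bar>h y\<bar> \<le> B" "h x = 0"
  shows "(\<lambda>y. kappa \<sigma> (x - y) * h y) abs_summable_on UNIV"
    and "(\<Sum>\<^sub>ay. kappa \<sigma> (x - y) * h y) =
      (LINT t:{0<..}|lborel. t powr (-1 - \<sigma>) * (\<Sum>\<^sub>ay. lattice_kernel t (x - y) * h y)) / \<bar>Gamma (- \<sigma>)\<bar>"
proof -
  let ?i = "indicat_real {0<..}"
  let ?d = "real CARD('n)"
  define F where "F = (\<lambda>t y. ?i t * (t powr (-1 - \<sigma>) * (lattice_kernel t (x - y) * h y)))"
  define K where "K = B * max 1 (2 * ?d)"
  have B: "0 \<le> B" using h(1)[of x] by linarith
  define D where "D = (\<lambda>t. K * (?i t * (if t \<le> 1 then t powr ((1 - \<sigma>) - 1) else t powr (- \<sigma> - 1))))"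
  have meas: "(\<lambda>t. F t y) \<in> borel_measurable borel" for y
    unfolding F_def by measurable
  have s: "F t abs_summable_on UNIV" for t
  proof (cases "0 < t")
    case True
    then show ?thesis unfolding F_def
      by (intro abs_summable_on_cmult_right infsetsum_lattice_kernel_off_diag(1)[where B = B] h) auto
  qed (simp add: F_def)
  have DI: "integrable lborel D"
    unfolding D_def using set_integrable_two_powers[of "1 - \<sigma>" \<sigma>] \<sigma>
    by (intro integrable_mult_right) (simp add: set_integrable_def)
  have b: "(\<Sum>\<^sub>ay. \<bar>F t y\<bar>) \<le> D t" for t
  proof (cases "0 < t")
    case True
    let ?p = "t powr (-1 - \<sigma>)"
    have t0: "0 \<le> t" using True by simp
    note O = infsetsum_lattice_kernel_off_diag[where t = t and h = h and B = B and x = x, OF t0 h]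
    have "(\<Sum>\<^sub>ay. \<bar>F t y\<bar>) = (\<Sum>\<^sub>ay. ?p * \<bar>lattice_kernel t (x - y) * h y\<bar>)"
      using True by (simp add: F_def abs_mult)
    also have "\<dots> = ?p * (\<Sum>\<^sub>ay. \<bar>lattice_kernel t (x - y) * h y\<bar>)"
      using abs_summable_on_normI[OF O(1)] by (intro infsetsum_cmult_right) simp
    also have "\<dots> \<le> ?p * (B * (1 - lattice_kernel t (0 :: int^'n)))"
      by (intro mult_left_mono O) auto
    also have "\<dots> \<le> ?p * (B * (max 1 (2 * ?d) * (if t \<le> 1 then t else 1)))"
      by (intro mult_left_mono one_minus_lattice_kernel_0_le t0 B) auto
    also have "\<dots> = K * (?p * (if t \<le> 1 then t else 1))" by (simp add: K_def)
    also have "\<dots> = D t" unfolding powr_mult_min[OF True] using True by (simp add: D_def)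
    finally show ?thesis .
  qed (simp add: F_def D_def)
  note S = infsetsum_lborel_swap[of F D, OF meas s DI b]
  have Fy: "kappa \<sigma> (x - y) * h y = (1 / \<bar>Gamma (- \<sigma>)\<bar>) * (LINT t|lborel. F t y)" for y
  proof (cases "y = x")
    case True
    then show ?thesis using h(2) by (simp add: F_def)
  next
    case False
    have "(LINT t|lborel. F t y) = (LINT t|lborel. (?i t * (t powr (-1 - \<sigma>) * lattice_kernel t (x - y))) * h y)"
      by (simp add: F_def mult_ac)
    also have "\<dots> = (LINT t:{0<..}|lborel. t powr (-1 - \<sigma>) * lattice_kernel t (x - y)) * h y"
      by (simp add: set_lebesgue_integral_def)
    finally show ?thesis using False by (simp add: kappa_frac[OF \<sigma>])
  qed
  show "(\<lambda>y. kappa \<sigma> (x - y) * h y) abs_summable_on UNIV"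
    unfolding Fy by (intro abs_summable_on_cmult_right S)
  have "(\<Sum>\<^sub>ay. kappa \<sigma> (x - y) * h y) = (1 / \<bar>Gamma (- \<sigma>)\<bar>) * (LINT t|lborel. (\<Sum>\<^sub>ay. F t y))"
    unfolding Fy using S by (subst infsetsum_cmult_right) auto
  also have "(LINT t|lborel. (\<Sum>\<^sub>ay. F t y)) =
      (LINT t:{0<..}|lborel. t powr (-1 - \<sigma>) * (\<Sum>\<^sub>ay. lattice_kernel t (x - y) * h y))"
    unfolding set_lebesgue_integral_def
  proof (rule Bochner_Integration.integral_cong[OF refl])
    fix t :: real
    show "(\<Sum>\<^sub>ay. F t y) = ?i t *\<^sub>R (t powr (-1 - \<sigma>) * (\<Sum>\<^sub>ay. lattice_kernel t (x - y) * h y))"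
    proof (cases "0 < t")
      case True
      have "(\<Sum>\<^sub>ay. F t y) = (\<Sum>\<^sub>ay. t powr (-1 - \<sigma>) * (lattice_kernel t (x - y) * h y))"
        using True by (simp add: F_def)
      also have "\<dots> = t powr (-1 - \<sigma>) * (\<Sum>\<^sub>ay. lattice_kernel t (x - y) * h y)"
        by (intro infsetsum_cmult_right infsetsum_lattice_kernel_off_diag(1)[where B = B] h) (use True in auto)
      finally show ?thesis using True by simp
    qed (simp add: F_def)
  qed
  finally show "(\<Sum>\<^sub>ay. kappa \<sigma> (x - y) * h y) =
      (LINT t:{0<..}|lborel. t powr (-1 - \<sigma>) * (\<Sum>\<^sub>ay. lattice_kernel t (x - y) * h y)) / \<bar>Gamma (- \<sigma>)\<bar>"
    by simp
qed

lemma kappa_1: "kappa 1 x = (if zsqnorm x = 1 then 1 else 0)"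
  by (simp add: kappa_def)

lemma kappa_nonneg:
  assumes "0 < \<sigma>" "\<sigma> \<le> 1"
  shows "0 \<le> kappa \<sigma> x"
proof (cases "\<sigma> = 1")
  case False
  have "0 \<le> (LINT t:{0<..}|lborel. t powr (-1 - \<sigma>) * lattice_kernel t x)"
    unfolding set_lebesgue_integral_def
    by (rule Bochner_Integration.integral_nonneg) (auto simp: indicator_def lattice_kernel_nonneg)
  then show ?thesis using False assms by (simp add: kappa_frac)
qed (simp add: kappa_1)

lemma zsqnorm_diff_eq_1_iff: "zsqnorm (x - y) = 1 \<longleftrightarrow> y \<in> nbrs x"
  using zsqnorm_minus[of "x - y"] by (simp add: nbrs_def)

lemma abs_summable_kappa:
  fixes x :: "int^'n"
  assumes "0 < \<sigma>" "\<sigma> \<le> 1"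
  shows "(\<lambda>y. kappa \<sigma> (x - y)) abs_summable_on UNIV"
proof (cases "\<sigma> = 1")
  case True
  show ?thesis unfolding True
    by (rule infsetsum_finite_support(1)[OF finite_nbrs[of x]]) (simp add: kappa_1 zsqnorm_diff_eq_1_iff)
next
  case False
  then have \<sigma>: "0 < \<sigma>" "\<sigma> < 1" using assms by auto
  let ?h = "\<lambda>y. if y = x then 0 else 1 :: real"
  have "(\<lambda>y. kappa \<sigma> (x - y) * ?h y) abs_summable_on UNIV"
    by (rule kappa_frac_infsetsum(1)[OF \<sigma>, of _ 1]) auto
  moreover have "(\<lambda>y. kappa \<sigma> (x - y) * ?h y) = (\<lambda>y. kappa \<sigma> (x - y))"
    by (rule ext) (simp add: kappa_frac[OF \<sigma>])
  ultimately show ?thesis by (simp only:)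
qed

lemma symmetric_kernel_kappa:
  assumes "0 < \<sigma>" "\<sigma> \<le> 1"
  shows "symmetric_kernel (\<lambda>x y :: int^'n. kappa \<sigma> (x - y))"
proof
  show "kappa \<sigma> (x - y) = kappa \<sigma> (y - x)" for x y :: "int^'n"
    using kappa_minus[of \<sigma> "x - y"] by simp
qed (use kappa_nonneg[OF assms] abs_summable_kappa[OF assms] in auto)

lemma generator_kappa_1:
  "symmetric_kernel.generator (\<lambda>x y :: int^'n. kappa 1 (x - y)) g x = lap g x"
proof -
  interpret symmetric_kernel "\<lambda>x y :: int^'n. kappa 1 (x - y)"
    by (rule symmetric_kernel_kappa) auto
  have "generator g x = (\<Sum>y\<in>nbrs x. kappa 1 (x - y) * (g x - g y))"
    unfolding generator_def
    by (rule infsetsum_finite_support(2)) (auto simp: kappa_1 zsqnorm_diff_eq_1_iff)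
  then show ?thesis
    unfolding lap_def by (auto simp: kappa_1 zsqnorm_diff_eq_1_iff intro!: sum.cong)
qed

lemma abs_summable_kernel_mult:
  fixes g :: "int^'n \<Rightarrow> real"
  assumes "0 \<le> t" "\<And>y. \<bar>g y\<bar> \<le> B"
  shows "(\<lambda>y. lattice_kernel t (x - y) * g y) abs_summable_on UNIV"
proof (rule abs_summable_on_comparison_test)
  show "(\<lambda>y. lattice_kernel t (x - y) * B) abs_summable_on UNIV"
    by (intro abs_summable_on_cmult_left abs_summable_kernel_shift abs_summable_lattice_kernel assms)
  show "norm (lattice_kernel t (x - y) * g y) \<le> norm (lattice_kernel t (x - y) * B)" for y
    unfolding norm_mult using assms(2)[of y] by (intro mult_left_mono) auto
qed

text \<open>Total mass 1 of the heat kernel turns the summed differences into g minus its heat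
  evolution. Boundedness of g suffices, which is what the Riesz kernels require.\<close>

lemma generator_kappa_frac:
  fixes g :: "int^'n \<Rightarrow> real"
  assumes \<sigma>: "0 < \<sigma>" "\<sigma> < 1" and g: "\<And>y. \<bar>g y\<bar> \<le> B"
  shows "symmetric_kernel.generator (\<lambda>x y. kappa \<sigma> (x - y)) g x =
    (LINT t:{0<..}|lborel. t powr (-1 - \<sigma>) * (g x - (\<Sum>\<^sub>ay. lattice_kernel t (x - y) * g y))) / \<bar>Gamma (- \<sigma>)\<bar>"
proof -
  interpret symmetric_kernel "\<lambda>x y :: int^'n. kappa \<sigma> (x - y)"
    by (rule symmetric_kernel_kappa) (use \<sigma> in auto)
  have h: "\<bar>g x - g y\<bar> \<le> 2 * B" for y using g[of x] g[of y] by linarith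
  have eq: "(\<Sum>\<^sub>ay. lattice_kernel t (x - y) * (g x - g y)) = g x - (\<Sum>\<^sub>ay. lattice_kernel t (x - y) * g y)"
    if t: "0 < t" for t
  proof -
    have t0: "0 \<le> t" using t by simp
    note P = abs_summable_kernel_shift[OF abs_summable_lattice_kernel[OF t0], of x]
    have "(\<Sum>\<^sub>ay. lattice_kernel t (x - y) * (g x - g y)) =
        (\<Sum>\<^sub>ay. lattice_kernel t (x - y) * g x - lattice_kernel t (x - y) * g y)"
      by (simp add: right_diff_distrib)
    also have "\<dots> = (\<Sum>\<^sub>ay. lattice_kernel t (x - y) * g x) - (\<Sum>\<^sub>ay. lattice_kernel t (x - y) * g y)"
      by (intro infsetsum_diff abs_summable_on_cmult_left P abs_summable_kernel_mult[OF t0 g])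
    also have "(\<Sum>\<^sub>ay. lattice_kernel t (x - y) * g x) = g x"
      using P by (subst infsetsum_cmult_left) (auto simp: infsetsum_lattice_kernel[OF t0])
    finally show ?thesis .
  qed
  have "generator g x = (LINT t:{0<..}|lborel. t powr (-1 - \<sigma>) * (\<Sum>\<^sub>ay. lattice_kernel t (x - y) * (g x - g y))) / \<bar>Gamma (- \<sigma>)\<bar>"
    unfolding generator_def by (rule kappa_frac_infsetsum(2)[OF \<sigma> h]) simp
  also have "(LINT t:{0<..}|lborel. t powr (-1 - \<sigma>) * (\<Sum>\<^sub>ay. lattice_kernel t (x - y) * (g x - g y))) =
      (LINT t:{0<..}|lborel. t powr (-1 - \<sigma>) * (g x - (\<Sum>\<^sub>ay. lattice_kernel t (x - y) * g y)))"
    by (rule set_lebesgue_integral_cong) (auto simp: eq)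
  finally show ?thesis .
qed

lemma fraclap_eq_generator:
  fixes \<phi> :: "int^'n \<Rightarrow> real"
  assumes \<sigma>: "0 < \<sigma>" "\<sigma> \<le> 1" and \<phi>: "fin_supp \<phi>"
  shows "fraclap \<sigma> \<phi> x = symmetric_kernel.generator (\<lambda>x y. kappa \<sigma> (x - y)) \<phi> x"
proof (cases "\<sigma> = 1")
  case True
  then show ?thesis by (simp add: fraclap_def generator_kappa_1)
next
  case False
  then have \<sigma>': "0 < \<sigma>" "\<sigma> < 1" using \<sigma> by auto
  interpret symmetric_kernel "\<lambda>x y :: int^'n. kappa \<sigma> (x - y)"
    by (rule symmetric_kernel_kappa[OF \<sigma>])
  let ?S = "{y. \<phi> y \<noteq> 0}"
  have S: "finite ?S" using \<phi> by (simp add: fin_supp_def)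
  have bd: "\<bar>\<phi> y\<bar> \<le> (\<Sum>z\<in>?S. \<bar>\<phi> z\<bar>)" for y
    by (rule finite_support_bounded[OF S]) simp
  have "(LINT t:{0<..}|lborel. (\<phi> x - heat t \<phi> x) / t powr (1 + \<sigma>)) =
      (LINT t:{0<..}|lborel. t powr (-1 - \<sigma>) * (\<phi> x - (\<Sum>\<^sub>ay. lattice_kernel t (x - y) * \<phi> y)))"
  proof (rule set_lebesgue_integral_cong)
    have p: "y / t powr (1 + \<sigma>) = t powr (-1 - \<sigma>) * y" for y t
      using powr_minus_divide[of t "1 + \<sigma>"] by simp
    have "heat t \<phi> x = (\<Sum>\<^sub>ay. lattice_kernel t (x - y) * \<phi> y)" if "0 < t" for t
      using heat_fin_supp[OF \<phi>, of t x] infsetsum_finite_support(2)[OF S, of "\<lambda>y. lattice_kernel t (x - y) * \<phi> y"] that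
      by simp
    then show "\<forall>t. t \<in> {0<..} \<longrightarrow> (\<phi> x - heat t \<phi> x) / t powr (1 + \<sigma>) =
        t powr (-1 - \<sigma>) * (\<phi> x - (\<Sum>\<^sub>ay. lattice_kernel t (x - y) * \<phi> y))"
      by (auto simp: p)
  qed simp
  then show ?thesis
    using False by (simp add: fraclap_def generator_kappa_frac[OF \<sigma>' bd])
qed

section \<open>The equation satisfied by the Riesz kernels\<close>

lemma kappa_uminus_bounded:
  assumes \<alpha>: "0 < \<alpha>" "\<alpha> < real CARD('n::finite) / 2"
  obtains B where "0 < B" "\<And>x::int^'n. kappa (- \<alpha>) x \<le> B"
proof -
  obtain C where C: "0 < C" "\<And>x::int^'n. x \<noteq> 0 \<Longrightarrow> kappa (- \<alpha>) x \<le> C * znorm x powr (2 * \<alpha> - CARD('n))"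
    using kappa_upper[OF \<alpha>] by blast
  show ?thesis
  proof (rule that[of "max C (kappa (- \<alpha>) (0 :: int^'n))"])
    fix x :: "int^'n"
    show "kappa (- \<alpha>) x \<le> max C (kappa (- \<alpha>) (0 :: int^'n))"
    proof (cases "x = 0")
      case False
      have "kappa (- \<alpha>) x \<le> C * znorm x powr (2 * \<alpha> - CARD('n))" by (rule C(2)[OF False])
      also have "\<dots> \<le> C * znorm x powr 0"
        using C(1) \<alpha> znorm_ge_1[OF False] by (intro mult_left_mono powr_mono) auto
      finally show ?thesis using znorm_ge_1[OF False] by auto
    qed simp
  qed (use C in auto)
qed

text \<open>The semigroup law under the time integral. All terms are nonnegative, so the summed
  integrand is its own majorant.\<close>

lemma lattice_kernel_convolve_kappa:
  fixes x :: "int^'n"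
  assumes \<alpha>: "0 < \<alpha>" "\<alpha> < real CARD('n) / 2" and t: "0 \<le> t"
  shows "(\<Sum>\<^sub>ay. lattice_kernel t (x - y) * kappa (- \<alpha>) y) =
    (LINT s:{0<..}|lborel. lattice_kernel (t + s) x * s powr (\<alpha> - 1)) / Gamma \<alpha>"
proof -
  let ?i = "indicat_real {0<..}"
  define F where "F = (\<lambda>s y. ?i s * s powr (\<alpha> - 1) * (lattice_kernel t (x - y) * lattice_kernel s y))"
  define D where "D = (\<lambda>s. ?i s * (lattice_kernel (t + s) x * s powr (\<alpha> - 1)))"
  have meas: "(\<lambda>s. F s y) \<in> borel_measurable borel" for y
    unfolding F_def by measurable
  have ss: "(\<lambda>y. lattice_kernel t (x - y) * lattice_kernel s y) abs_summable_on UNIV" if "0 \<le> s" for s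
  proof (rule abs_summable_kernel_mult[OF t])
    show "\<bar>lattice_kernel s y\<bar> \<le> 1" for y :: "int^'n"
      using lattice_kernel_nonneg[OF that, of y] lattice_kernel_le_1[OF that, of y] by simp
  qed
  have s: "F s abs_summable_on UNIV" for s
  proof (cases "0 < s")
    case True
    then show ?thesis unfolding F_def by (intro abs_summable_on_cmult_right ss) auto
  qed (simp add: F_def)
  have DI: "integrable lborel D"
    using set_integrable_lattice_kernel[OF \<alpha> t, of x] by (simp add: D_def set_integrable_def)
  have FS: "(\<Sum>\<^sub>ay. F s y) = D s" for s
  proof (cases "0 < s")
    case True
    have "(\<Sum>\<^sub>ay. F s y) = ?i s * s powr (\<alpha> - 1) * (\<Sum>\<^sub>ay. lattice_kernel t (x - y) * lattice_kernel s y)"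
      unfolding F_def by (intro infsetsum_cmult_right ss) (use True in auto)
    then show ?thesis
      using True t lattice_kernel_semigroup[of t s x] by (simp add: D_def)
  qed (simp add: F_def D_def)
  have "\<bar>F s y\<bar> = F s y" for s y
    using lattice_kernel_nonneg[of t "x - y"] lattice_kernel_nonneg[of s y] t by (simp add: F_def indicator_def)
  then have b: "(\<Sum>\<^sub>ay. \<bar>F s y\<bar>) \<le> D s" for s using FS[of s] by simp
  note S = infsetsum_lborel_swap[of F D, OF meas s DI b]
  have Fy: "lattice_kernel t (x - y) * kappa (- \<alpha>) y = (1 / Gamma \<alpha>) * (LINT s|lborel. F s y)" for y
  proof -
    have "(LINT s|lborel. F s y) = (LINT s|lborel. lattice_kernel t (x - y) * (?i s * (lattice_kernel s y * s powr (\<alpha> - 1))))"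
      by (simp add: F_def mult_ac)
    also have "\<dots> = lattice_kernel t (x - y) * (LINT s:{0<..}|lborel. lattice_kernel s y * s powr (\<alpha> - 1))"
      by (simp add: set_lebesgue_integral_def)
    finally show ?thesis by (simp add: kappa_uminus[OF \<alpha>(1)])
  qed
  have "(\<Sum>\<^sub>ay. lattice_kernel t (x - y) * kappa (- \<alpha>) y) = (1 / Gamma \<alpha>) * (LINT s|lborel. (\<Sum>\<^sub>ay. F s y))"
    unfolding Fy using S by (subst infsetsum_cmult_right) auto
  then show ?thesis unfolding FS by (simp add: D_def set_lebesgue_integral_def)
qed

text \<open>\<open>marchaud_fubini\<close> with m the heat kernel at x, where the time shift is the
  semigroup. The constant \<bar>Gamma (-\<sigma>)\<bar> Gamma \<alpha> / Gamma (\<alpha> - \<sigma>)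
  exchanges one normalisation for the other exactly.\<close>

lemma generator_kappa_frac_uminus:
  fixes x :: "int^'n"
  assumes \<sigma>: "0 < \<sigma>" "\<sigma> < 1" and \<alpha>: "\<sigma> < \<alpha>" "\<alpha> < real CARD('n) / 2"
  shows "symmetric_kernel.generator (\<lambda>x y. kappa \<sigma> (x - y)) (kappa (- \<alpha>)) x = kappa (\<sigma> - \<alpha>) x"
proof -
  have \<alpha>0: "0 < \<alpha>" using \<sigma> \<alpha> by simp
  note G = Gamma_real_pos[OF \<alpha>0]
  obtain B where B: "0 < B" "\<And>x::int^'n. kappa (- \<alpha>) x \<le> B"
    using kappa_uminus_bounded[OF \<alpha>0 \<alpha>(2)] by blast
  have bd: "\<bar>kappa (- \<alpha>) y\<bar> \<le> B" for y :: "int^'n"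
    using B kappa_uminus_pos[OF \<alpha>0 \<alpha>(2), of y] by simp
  let ?I = "LINT s:{0<..}|lborel. lattice_kernel s x * s powr (\<alpha> - 1)"
  let ?T = "\<lambda>t. LINT s:{0<..}|lborel. lattice_kernel (t + s) x * s powr (\<alpha> - 1)"
  have e: "\<alpha> - 1 - \<sigma> = (\<alpha> - \<sigma>) - 1" by simp
  have "symmetric_kernel.generator (\<lambda>x y. kappa \<sigma> (x - y)) (kappa (- \<alpha>)) x =
    (LINT t:{0<..}|lborel. t powr (-1 - \<sigma>) * (kappa (- \<alpha>) x - (\<Sum>\<^sub>ay. lattice_kernel t (x - y) * kappa (- \<alpha>) y))) / \<bar>Gamma (- \<sigma>)\<bar>"
    by (rule generator_kappa_frac[OF \<sigma> bd])
  also have "(LINT t:{0<..}|lborel. t powr (-1 - \<sigma>) * (kappa (- \<alpha>) x - (\<Sum>\<^sub>ay. lattice_kernel t (x - y) * kappa (- \<alpha>) y))) =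
     (LINT t:{0<..}|lborel. (t powr (-1 - \<sigma>) * (?I - ?T t)) * (1 / Gamma \<alpha>))"
  proof (rule set_lebesgue_integral_cong)
    have "kappa (- \<alpha>) x - (\<Sum>\<^sub>ay. lattice_kernel t (x - y) * kappa (- \<alpha>) y) = (?I - ?T t) * (1 / Gamma \<alpha>)"
      if "0 < t" for t
      using that lattice_kernel_convolve_kappa[OF \<alpha>0 \<alpha>(2), of t x] kappa_uminus[OF \<alpha>0, of x]
      by (simp add: diff_divide_distrib)
    then show "\<forall>t. t \<in> {0<..} \<longrightarrow> t powr (-1 - \<sigma>) * (kappa (- \<alpha>) x - (\<Sum>\<^sub>ay. lattice_kernel t (x - y) * kappa (- \<alpha>) y)) =
        t powr (-1 - \<sigma>) * (?I - ?T t) * (1 / Gamma \<alpha>)"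
      by (simp add: mult.assoc)
  qed simp
  also have "\<dots> = (LINT t:{0<..}|lborel. t powr (-1 - \<sigma>) * (?I - ?T t)) * (1 / Gamma \<alpha>)"
    by (rule set_integral_mult_left)
  also have "(LINT t:{0<..}|lborel. t powr (-1 - \<sigma>) * (?I - ?T t)) =
     (LINT s:{0<..}|lborel. lattice_kernel s x * s powr (\<alpha> - 1 - \<sigma>)) * (LINT \<tau>:{0<..}|lborel. marchaud_kernel \<sigma> \<alpha> 1 \<tau>)"
  proof (rule marchaud_fubini[OF \<sigma> \<alpha>0])
    show "set_integrable lborel {0<..} (\<lambda>s. lattice_kernel (t + s) x * s powr (\<alpha> - 1))" if "0 \<le> t" for t
      by (rule set_integrable_lattice_kernel[OF \<alpha>0 \<alpha>(2) that])
    show "set_integrable lborel {0<..} (\<lambda>s. lattice_kernel s x * s powr (\<alpha> - 1 - \<sigma>))"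
      unfolding e using set_integrable_lattice_kernel[of "\<alpha> - \<sigma>" 0 x] \<sigma> \<alpha> by simp
  qed (auto simp: lattice_kernel_nonneg)
  finally show ?thesis
    using abs_Gamma_minus(2)[OF \<sigma>] G kappa_uminus[of "\<alpha> - \<sigma>" x] \<alpha>
    unfolding marchaud_constant[OF \<sigma> \<alpha>(1)] e by simp
qed

text \<open>The Laplacian acts on the heat kernel as minus the time derivative, so integration by
  parts trades t^(\<alpha>-1) for (\<alpha> - 1) t^(\<alpha>-2). The boundary terms vanish at 0 by
  \<alpha> > 1 and at infinity by the decay t^(-d/2); the factor is absorbed by Gamma \<alpha> =
  (\<alpha> - 1) Gamma (\<alpha> - 1).\<close>

lemma lap_kappa_uminus:
  fixes x :: "int^'n"
  assumes \<alpha>: "1 < \<alpha>" "\<alpha> < real CARD('n) / 2"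
  shows "lap (kappa (- \<alpha>)) x = kappa (1 - \<alpha>) x"
proof -
  have \<alpha>0: "0 < \<alpha>" "0 < \<alpha> - 1" "\<alpha> - 1 < real CARD('n) / 2" using \<alpha> by auto
  let ?I = "\<lambda>y :: int^'n. LINT t:{0<..}|lborel. lattice_kernel t y * t powr (\<alpha> - 1)"
  have i: "set_integrable lborel {0<..} (\<lambda>t. lattice_kernel t y * t powr (\<alpha> - 1))" for y :: "int^'n"
    using set_integrable_lattice_kernel[OF \<alpha>0(1) \<alpha>(2), of 0 y] by simp
  have j: "set_integrable lborel {0<..} (\<lambda>t. lattice_kernel t x * t powr (\<alpha> - 1 - 1))"
    using set_integrable_lattice_kernel[OF \<alpha>0(2,3), of 0 x] by simp
  let ?L = "\<lambda>t. \<Sum>y\<in>nbrs x. lattice_kernel t x * t powr (\<alpha> - 1) - lattice_kernel t y * t powr (\<alpha> - 1)"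
  have L: "?L t = lap (lattice_kernel t) x * t powr (\<alpha> - 1)" for t
    by (simp add: lap_def sum_distrib_right left_diff_distrib)
  have Li: "set_integrable lborel {0<..} ?L"
    unfolding set_integrable_def scaleR_sum_right
    by (intro Bochner_Integration.integrable_sum set_integral_diff(1)[OF i i, unfolded set_integrable_def])
  have LI: "(LINT t:{0<..}|lborel. ?L t) = (\<Sum>y\<in>nbrs x. ?I x - ?I y)"
  proof -
    have "(LINT t:{0<..}|lborel. ?L t) = (\<Sum>y\<in>nbrs x. LINT t:{0<..}|lborel. lattice_kernel t x * t powr (\<alpha> - 1) - lattice_kernel t y * t powr (\<alpha> - 1))"
      unfolding set_lebesgue_integral_def scaleR_sum_right
      by (intro Bochner_Integration.integral_sum set_integral_diff(1)[OF i i, unfolded set_integrable_def])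
    then show ?thesis by (simp add: set_integral_diff(2)[OF i i])
  qed
  obtain K where K: "1 \<le> K"
    "\<And>s t x. 0 \<le> s \<Longrightarrow> 0 < t \<Longrightarrow>
      lattice_kernel (s + t) (x :: int^'n) \<le> K * (if t \<le> 1 then 1 else t powr (- real CARD('n) / 2))"
    using lattice_kernel_le[where 'n='n] by metis
  let ?F = "\<lambda>t. t powr (\<alpha> - 1) * lattice_kernel t x"
  let ?f = "\<lambda>t. (\<alpha> - 1) * (lattice_kernel t x * t powr (\<alpha> - 1 - 1)) - ?L t"
  have fi: "set_integrable lborel {0<..} ?f"
    by (intro set_integral_diff(1) set_integrable_mult_right j Li)
  have "(LINT t:{0<..}|lborel. ?f t) = 0 - 0"
  proof (rule set_integral_FTC_0_inf[OF _ _ fi])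
    show "(?F has_real_derivative ?f t) (at t)" if "0 < t" for t
      unfolding L using that
      by (auto intro!: derivative_eq_intros DERIV_lattice_kernel simp: algebra_simps)
    show "continuous_on {0<..} ?f" by (intro continuous_intros) auto
    show "(?F \<longlongrightarrow> 0) (at_right 0)"
    proof (rule Lim_null_comparison)
      show "\<forall>\<^sub>F t in at_right 0. norm (?F t) \<le> t powr (\<alpha> - 1)"
        using eventually_at_right_less[of "0::real"]
      proof eventually_elim
        case (elim t)
        have "t powr (\<alpha> - 1) * lattice_kernel t x \<le> t powr (\<alpha> - 1) * 1"
          using elim by (intro mult_left_mono lattice_kernel_le_1) auto
        then show ?case using lattice_kernel_nonneg[of t x] elim by (simp add: abs_mult)
      qed
      have "((\<lambda>t. t powr (\<alpha> - 1)) \<longlongrightarrow> 0 powr (\<alpha> - 1)) (at_right 0)"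
        using \<alpha>0 by (intro tendsto_intros tendsto_powr2) (auto intro!: eventually_at_rightI[of 0 1])
      then show "((\<lambda>t. t powr (\<alpha> - 1)) \<longlongrightarrow> 0) (at_right 0)" by simp
    qed
    show "(?F \<longlongrightarrow> 0) at_top"
    proof (rule Lim_null_comparison)
      show "\<forall>\<^sub>F t in at_top. norm (?F t) \<le> K * t powr (\<alpha> - 1 - real CARD('n) / 2)"
        using eventually_gt_at_top[of "1::real"]
      proof eventually_elim
        case (elim t)
        have "t powr (\<alpha> - 1) * lattice_kernel t x \<le> t powr (\<alpha> - 1) * (K * t powr (- real CARD('n) / 2))"
          using elim K(2)[of 0 t x] by (intro mult_left_mono) auto
        also have "\<dots> = K * t powr (\<alpha> - 1 - real CARD('n) / 2)"
          by (simp add: powr_add[symmetric] mult.left_commute)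
        finally show ?case using lattice_kernel_nonneg[of t x] elim by (simp add: abs_mult)
      qed
      have "((\<lambda>t::real. t powr (\<alpha> - 1 - real CARD('n) / 2)) \<longlongrightarrow> 0) at_top"
        using \<alpha> by (intro tendsto_neg_powr filterlim_ident) auto
      from tendsto_mult[OF tendsto_const[of K] this]
      show "((\<lambda>t. K * t powr (\<alpha> - 1 - real CARD('n) / 2)) \<longlongrightarrow> 0) at_top" by simp
    qed
  qed
  then have "(LINT t:{0<..}|lborel. ?L t) = (\<alpha> - 1) * (LINT t:{0<..}|lborel. lattice_kernel t x * t powr (\<alpha> - 1 - 1))"
    using set_integral_diff(2)[OF set_integrable_mult_right[OF j] Li, of "\<alpha> - 1"] by simp
  moreover have "lap (kappa (- \<alpha>)) x = (\<Sum>y\<in>nbrs x. ?I x - ?I y) / Gamma \<alpha>"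
    unfolding lap_def kappa_uminus[OF \<alpha>0(1)] by (simp add: sum_divide_distrib diff_divide_distrib)
  moreover have "Gamma \<alpha> = (\<alpha> - 1) * Gamma (\<alpha> - 1)"
  proof -
    have "\<alpha> - 1 \<notin> \<int>\<^sub>\<le>\<^sub>0" using \<alpha>0(2) by (auto elim!: nonpos_Ints_cases)
    from Gamma_plus1[OF this] show ?thesis by simp
  qed
  moreover have "kappa (1 - \<alpha>) x = (LINT t:{0<..}|lborel. lattice_kernel t x * t powr (\<alpha> - 1 - 1)) / Gamma (\<alpha> - 1)"
    using kappa_uminus[OF \<alpha>0(2), of x] by simp
  ultimately show ?thesis unfolding LI using \<alpha>0(2) by simp
qed

lemma generator_kappa_uminus:
  fixes x :: "int^'n"
  assumes "0 < \<sigma>" "\<sigma> \<le> 1" "\<sigma> < \<alpha>" "\<alpha> < real CARD('n) / 2"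
  shows "symmetric_kernel.generator (\<lambda>x y. kappa \<sigma> (x - y)) (kappa (- \<alpha>)) x = kappa (\<sigma> - \<alpha>) x"
  using generator_kappa_frac_uminus[of \<sigma> \<alpha> x] lap_kappa_uminus[of \<alpha> x] generator_kappa_1[of "kappa (- \<alpha>)" x] assms
  by (cases "\<sigma> = 1") auto

text \<open>Nearest neighbours suffice, as they connect the lattice. For \<sigma> < 1 the
  integrability has to be established first, since an integral that does not exist has the value 0
  by convention.\<close>

lemma kappa_nbrs_pos:
  fixes x y :: "int^'n"
  assumes \<sigma>: "0 < \<sigma>" "\<sigma> \<le> 1" and y: "y \<in> nbrs x"
  shows "0 < kappa \<sigma> (x - y)"
proof (cases "\<sigma> = 1")
  case True
  then show ?thesis using y by (simp add: kappa_1 zsqnorm_diff_eq_1_iff)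
next
  case False
  then have \<sigma>': "0 < \<sigma>" "\<sigma> < 1" using \<sigma> by auto
  have "kappa \<sigma> (x - y) \<noteq> 0"
  proof
    let ?z = "x - y"
    have z: "?z \<noteq> 0" using y by (auto simp: nbrs_def zsqnorm_def)
    define F where "F = (\<lambda>t. t powr (-1 - \<sigma>) * lattice_kernel t ?z)"
    have "0 < (LINT t:{0<..}|lborel. F t)"
    proof (rule set_integral_pos)
      show "set_integrable lborel {0<..} F"
      proof (rule set_integrable_bound)
        show "set_integrable lborel {0<..}
            (\<lambda>t. max 1 (2 * real CARD('n)) * (if t \<le> 1 then t powr ((1 - \<sigma>) - 1) else t powr (- \<sigma> - 1)))"
          using \<sigma>' by (intro set_integrable_mult_right set_integrable_two_powers) auto
        show "set_borel_measurable lborel {0<..} F"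
          unfolding F_def set_borel_measurable_def by measurable
        show "AE t in lborel. t \<in> {0<..} \<longrightarrow> norm (F t) \<le>
            norm (max 1 (2 * real CARD('n)) * (if t \<le> 1 then t powr ((1 - \<sigma>) - 1) else t powr (- \<sigma> - 1)))"
        proof (intro AE_I2 impI)
          fix t :: real assume "t \<in> {0<..}"
          then have t: "0 < t" "0 \<le> t" by auto
          let ?p = "t powr (-1 - \<sigma>)"
          let ?K = "max 1 (2 * real CARD('n))"
          \<comment> \<open>Two distinct sites share the total mass 1, so the value at z is at most
            1 - p_t(0), which is O(t).\<close>
          have "lattice_kernel t ?z + lattice_kernel t (0 :: int^'n) \<le> 1"
          proof -
            have "(\<Sum>\<^sub>aw\<in>{?z, 0}. lattice_kernel t w) \<le> infsetsum (lattice_kernel t :: int^'n \<Rightarrow> real) UNIV"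
              by (rule infsetsum_mono_neutral_left)
                (use abs_summable_lattice_kernel[OF t(2)] lattice_kernel_nonneg[OF t(2)] in auto)
            then show ?thesis using z infsetsum_lattice_kernel[OF t(2), where 'n='n] by simp
          qed
          then have "lattice_kernel t ?z \<le> ?K * (if t \<le> 1 then t else 1)"
            using one_minus_lattice_kernel_0_le[OF t(2), where 'n='n] by linarith
          from mult_left_mono[OF this, of ?p]
          have "F t \<le> ?K * (?p * (if t \<le> 1 then t else 1))" by (simp add: F_def mult.left_commute)
          also have "\<dots> = ?K * (if t \<le> 1 then t powr ((1 - \<sigma>) - 1) else t powr (- \<sigma> - 1))"
            unfolding powr_mult_min[OF t(1)] ..
          finally show "norm (F t) \<le>
            norm (?K * (if t \<le> 1 then t powr ((1 - \<sigma>) - 1) else t powr (- \<sigma> - 1)))"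
            using lattice_kernel_nonneg[OF t(2), of ?z] by (simp add: F_def)
        qed
      qed
      show "0 < F t" if "0 < t" for t using that lattice_kernel_pos[of t ?z] by (simp add: F_def)
    qed
    moreover assume "kappa \<sigma> ?z = 0"
    ultimately show False
      using z abs_Gamma_minus(2)[OF \<sigma>'] by (simp add: kappa_frac[OF \<sigma>'] F_def)
  qed
  then show ?thesis using kappa_nonneg[OF \<sigma>, of "x - y"] by simp
qed

text \<open>Descent on the l^1 norm: one unit step towards 0 in a nonzero coordinate. It carries
  pointwise limits, and later the constancy of v/u, from the origin to every site.\<close>

lemma lattice_induct [case_names zero plus minus]:
  fixes x :: "int^'n"
  assumes "P 0" "\<And>x i. P x \<Longrightarrow> P (x + axis i 1)" "\<And>x i. P x \<Longrightarrow> P (x - axis i 1)"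
  shows "P x"
proof (induction "nat (\<Sum>i\<in>UNIV. \<bar>x $ i\<bar>)" arbitrary: x rule: less_induct)
  case less
  show ?case
  proof (cases "x = 0")
    case False
    then obtain i where i: "x $ i \<noteq> 0" by (auto simp: vec_eq_iff)
    have smaller: "nat (\<Sum>j\<in>UNIV. \<bar>y $ j\<bar>) < nat (\<Sum>j\<in>UNIV. \<bar>x $ j\<bar>)"
      if "\<bar>y $ i\<bar> < \<bar>x $ i\<bar>" "\<And>j. j \<noteq> i \<Longrightarrow> y $ j = x $ j" for y :: "int^'n"
    proof -
      have "(\<Sum>j\<in>UNIV. \<bar>y $ j\<bar>) < (\<Sum>j\<in>UNIV. \<bar>x $ j\<bar>)"
      proof (rule sum_strict_mono_ex1)
        show "\<forall>j\<in>UNIV. \<bar>y $ j\<bar> \<le> \<bar>x $ j\<bar>"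
        proof
          fix j show "\<bar>y $ j\<bar> \<le> \<bar>x $ j\<bar>" using that by (cases "j = i") auto
        qed
        show "\<exists>j\<in>UNIV. \<bar>y $ j\<bar> < \<bar>x $ j\<bar>" using that(1) by auto
      qed simp
      moreover have "0 \<le> (\<Sum>j\<in>UNIV. \<bar>y $ j\<bar>)" by (intro sum_nonneg) auto
      ultimately show ?thesis unfolding zless_nat_conj by linarith
    qed
    show ?thesis
    proof (cases "x $ i > 0")
      case True
      have "P (x - axis i 1)"
        by (rule less) (rule smaller, use True in \<open>auto simp: axis_def\<close>)
      from assms(2)[OF this, of i] show ?thesis by simp
    next
      case neg: False
      have "P (x + axis i 1)"
        by (rule less) (rule smaller, use neg i in \<open>auto simp: axis_def\<close>)
      from assms(3)[OF this, of i] show ?thesis by simp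
    qed
  qed (use assms in simp)
qed

section \<open>Optimality\<close>

lemma card_vec_box:
  fixes A :: "int set"
  assumes "finite A"
  shows "finite {x :: int^'n. \<forall>i. x $ i \<in> A}" "card {x :: int^'n. \<forall>i. x $ i \<in> A} = card A ^ CARD('n)"
proof -
  have bij: "bij_betw vec_lambda (PiE (UNIV :: 'n set) (\<lambda>_. A)) {x :: int^'n. \<forall>i. x $ i \<in> A}"
    by (rule bij_betwI[of _ _ _ vec_nth]) (auto simp: PiE_iff)
  have f: "finite (PiE (UNIV :: 'n set) (\<lambda>_. A))" using assms by (intro finite_PiE) auto
  show "finite {x :: int^'n. \<forall>i. x $ i \<in> A}" using bij_betw_finite[OF bij] f by simp
  show "card {x :: int^'n. \<forall>i. x $ i \<in> A} = card A ^ CARD('n)"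
    using bij_betw_same_card[OF bij] by (simp add: card_PiE)
qed

lemma znorm_ball_subset:
  "{x :: int^'n. znorm x < 2 ^ j} \<subseteq> {x. \<forall>i. x $ i \<in> {- (2 ^ j)..<2 ^ j}}"
proof
  fix x :: "int^'n" assume x: "x \<in> {x. znorm x < 2 ^ j}"
  have "x $ i \<in> {- (2 ^ j)..<2 ^ j}" for i
  proof -
    have "\<bar>real_of_int (x $ i)\<bar> < 2 ^ j" using abs_nth_le_znorm[of x i] x by simp
    then have "real_of_int \<bar>x $ i\<bar> < real_of_int (2 ^ j)" by simp
    then have "\<bar>x $ i\<bar> < 2 ^ j" by (simp only: of_int_less_iff)
    then show ?thesis by auto
  qed
  then show "x \<in> {x. \<forall>i. x $ i \<in> {- (2 ^ j)..<2 ^ j}}" by auto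
qed

lemma finite_znorm_ball: "finite {x :: int^'n. znorm x < 2 ^ j}"
  by (rule finite_subset[OF znorm_ball_subset card_vec_box(1)]) simp

lemma card_znorm_ball: "card {x :: int^'n. znorm x < 2 ^ j} \<le> (2 ^ (j + 1)) ^ CARD('n)"
proof -
  have "card {x :: int^'n. znorm x < 2 ^ j} \<le> card {x :: int^'n. \<forall>i. x $ i \<in> {- (2 ^ j)..<2 ^ j}}"
    by (rule card_mono[OF card_vec_box(1) znorm_ball_subset]) simp
  also have "\<dots> = card {- (2 ^ j)..<(2::int) ^ j} ^ CARD('n)" by (rule card_vec_box(2)) simp
  also have "card {- (2 ^ j)..<(2::int) ^ j} = 2 ^ (j + 1)" by (simp add: nat_mult_distrib nat_power_eq)
  finally show ?thesis .
qed

lemma powr_minus_pow: "((2::real) ^ j) powr (- real n) = 1 / (2 ^ j) ^ n"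
  by (simp add: powr_minus_divide powr_realpow)

text \<open>The shell between 2^j and 2^(j+1) has at most (2^(j+2))^d points, each contributing at
  most 2^(-jd), so every shell adds at most 4^d.\<close>

lemma dyadic_sum_upper:
  "(\<Sum>x | (x :: int^'n) \<noteq> 0 \<and> znorm x < 2 ^ j. znorm x powr (- real CARD('n))) \<le> 4 ^ CARD('n) * real j"
proof (induction j)
  case 0
  have e: "{x :: int^'n. x \<noteq> 0 \<and> znorm x < 2 ^ 0} = {}" using znorm_ge_1 by force
  show ?case unfolding e by simp
next
  case (Suc j)
  let ?A = "{x :: int^'n. x \<noteq> 0 \<and> znorm x < 2 ^ j}"
  let ?B = "{x :: int^'n. 2 ^ j \<le> znorm x \<and> znorm x < 2 ^ Suc j}"
  have pos: "0 < znorm x" if "2 ^ j \<le> znorm x" for x :: "int^'n"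
    using that zero_less_power[of "2::real" j] by linarith
  have split: "{x :: int^'n. x \<noteq> 0 \<and> znorm x < 2 ^ Suc j} = ?A \<union> ?B"
  proof -
    have "znorm x < 2 ^ Suc j" if "znorm x < 2 ^ j" for x :: "int^'n"
      using that zero_less_power[of "2::real" j] unfolding power_Suc by linarith
    moreover have "x \<noteq> 0" if "2 ^ j \<le> znorm x" for x :: "int^'n"
      using pos[OF that] by (auto simp: znorm_def zsqnorm_def)
    ultimately show ?thesis by auto
  qed
  have fA: "finite ?A" by (rule finite_subset[OF _ finite_znorm_ball[of j]]) blast
  have fB: "finite ?B" by (rule finite_subset[OF _ finite_znorm_ball[of "Suc j"]]) blast
  have "(\<Sum>x\<in>?B. znorm x powr (- real CARD('n))) \<le> (\<Sum>x\<in>?B. 1 / (2 ^ j) ^ CARD('n))"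
  proof (rule sum_mono)
    fix x assume "x \<in> ?B"
    then have "znorm x powr (- real CARD('n)) \<le> (2 ^ j) powr (- real CARD('n))"
      by (intro powr_mono2') auto
    then show "znorm x powr (- real CARD('n)) \<le> 1 / (2 ^ j) ^ CARD('n)" by (simp only: powr_minus_pow)
  qed
  also have "\<dots> = real (card ?B) * (1 / (2 ^ j) ^ CARD('n))" by simp
  also have "\<dots> \<le> real ((2 ^ (Suc j + 1)) ^ CARD('n)) * (1 / (2 ^ j) ^ CARD('n))"
  proof (rule mult_right_mono)
    have "card ?B \<le> card {x :: int^'n. znorm x < 2 ^ Suc j}"
      by (rule card_mono[OF finite_znorm_ball]) auto
    then show "real (card ?B) \<le> real ((2 ^ (Suc j + 1)) ^ CARD('n))"
      using card_znorm_ball[of "Suc j", where 'n='n] by linarith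
  qed simp
  also have "\<dots> = 4 ^ CARD('n)"
  proof -
    have "(2::real) ^ (Suc j + 1) = 4 * 2 ^ j" by simp
    then show ?thesis by (simp add: power_mult_distrib)
  qed
  finally have "(\<Sum>x\<in>?B. znorm x powr (- real CARD('n))) \<le> 4 ^ CARD('n)" .
  moreover have "(\<Sum>x\<in>?A \<union> ?B. znorm x powr (- real CARD('n))) =
      (\<Sum>x\<in>?A. znorm x powr (- real CARD('n))) + (\<Sum>x\<in>?B. znorm x powr (- real CARD('n)))"
    by (rule sum.union_disjoint[OF fA fB]) auto
  ultimately show ?case using Suc unfolding split by (simp add: algebra_simps)
qed

text \<open>A cube in the positive orthant instead of a whole shell: its cardinality is exactly
  2^(jd), and disjointness for different j is visible in any single coordinate.\<close>

definition dyadic_box :: "nat \<Rightarrow> (int^'n) set" where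
  "dyadic_box j = {x. \<forall>i. x $ i \<in> {2 ^ j..<2 ^ (j + 1)}}"

lemma dyadic_box_lower:
  shows "finite (dyadic_box j :: (int^'n) set)" "\<And>x :: int^'n. x \<in> dyadic_box j \<Longrightarrow> 2 ^ j \<le> znorm x"
    "i \<noteq> j \<Longrightarrow> dyadic_box i \<inter> (dyadic_box j :: (int^'n) set) = {}"
    "1 / (2 * real CARD('n)) ^ CARD('n) \<le> (\<Sum>x\<in>(dyadic_box j :: (int^'n) set). znorm x powr (- real CARD('n)))"
proof -
  let ?d = "real CARD('n)"
  show fin: "finite (dyadic_box j :: (int^'n) set)" unfolding dyadic_box_def by (rule card_vec_box(1)) simp
  have nth: "2 ^ j \<le> real_of_int (x $ i)" "real_of_int (x $ i) \<le> 2 ^ (j + 1)" if "x \<in> dyadic_box j" for x :: "int^'n" and i j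
  proof -
    have "2 ^ j \<le> x $ i" "x $ i \<le> 2 ^ (j + 1)" using that by (auto simp: dyadic_box_def intro: less_imp_le)
    then have "real_of_int (2 ^ j) \<le> real_of_int (x $ i)" "real_of_int (x $ i) \<le> real_of_int (2 ^ (j + 1))"
      by (simp_all only: of_int_le_iff)
    then show "2 ^ j \<le> real_of_int (x $ i)" "real_of_int (x $ i) \<le> 2 ^ (j + 1)" by simp_all
  qed
  show lower: "2 ^ j \<le> znorm x" if "x \<in> dyadic_box j" for x :: "int^'n"
    \<comment> \<open>Here \<open>undefined\<close> is merely some coordinate; every index type has
      one.\<close>
    using nth(1)[OF that, of undefined] abs_nth_le_znorm[of x undefined] by linarith
  show "dyadic_box i \<inter> (dyadic_box j :: (int^'n) set) = {}" if "i \<noteq> j"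
  proof -
    have *: False if "x \<in> dyadic_box i" "x \<in> dyadic_box j" "i < j" for x :: "int^'n" and i j
    proof -
      have "x $ undefined < 2 ^ (i + 1)" "2 ^ j \<le> x $ undefined" using that by (auto simp: dyadic_box_def)
      moreover have "(2::int) ^ (i + 1) \<le> 2 ^ j" using that by (intro power_increasing) auto
      ultimately show False by linarith
    qed
    show ?thesis using *[of _ i j] *[of _ j i] that by (cases "i < j") auto
  qed
  have "1 / (2 * ?d) ^ CARD('n) = (\<Sum>x\<in>(dyadic_box j :: (int^'n) set). 1 / (?d * 2 ^ (j + 1)) ^ CARD('n))"
  proof -
    have "card (dyadic_box j :: (int^'n) set) = card {2 ^ j..<(2::int) ^ (j + 1)} ^ CARD('n)"
      unfolding dyadic_box_def by (rule card_vec_box(2)) simp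
    also have "card {2 ^ j..<(2::int) ^ (j + 1)} = 2 ^ j" by (simp add: nat_power_eq)
    finally have card: "card (dyadic_box j :: (int^'n) set) = (2 ^ j) ^ CARD('n)" .
    have "?d * 2 ^ (j + 1) = 2 ^ j * (2 * ?d)" by simp
    then have E: "(?d * 2 ^ (j + 1)) ^ CARD('n) = (2 ^ j) ^ CARD('n) * (2 * ?d) ^ CARD('n)"
      by (simp only: power_mult_distrib)
    have "(2 ^ j) ^ CARD('n) * (1 / ((2 ^ j) ^ CARD('n) * (2 * ?d) ^ CARD('n))) = 1 / (2 * ?d) ^ CARD('n)"
      by simp
    then show ?thesis unfolding sum_constant card E by simp
  qed
  also have "\<dots> \<le> (\<Sum>x\<in>(dyadic_box j :: (int^'n) set). znorm x powr (- ?d))"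
  proof (rule sum_mono)
    fix x :: "int^'n" assume x: "x \<in> dyadic_box j"
    have "znorm x \<le> (\<Sum>i\<in>UNIV. \<bar>real_of_int (x $ i)\<bar>)" by (rule znorm_le_sum_abs)
    also have "\<dots> \<le> (\<Sum>i\<in>(UNIV :: 'n set). 2 ^ (j + 1))"
    proof (rule sum_mono)
      fix i
      have "0 \<le> real_of_int (x $ i)" using nth(1)[OF x, of i] by (rule order_trans[rotated]) simp
      then show "\<bar>real_of_int (x $ i)\<bar> \<le> 2 ^ (j + 1)" using nth(2)[OF x, of i] by simp
    qed
    finally have "znorm x \<le> ?d * 2 ^ (j + 1)" by simp
    moreover have z: "0 < znorm x" using lower[OF x] zero_less_power[of "2::real" j] by linarith
    ultimately have "(?d * 2 ^ (j + 1)) powr (- ?d) \<le> znorm x powr (- ?d)" by (intro powr_mono2') auto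
    moreover have "(?d * 2 ^ (j + 1)) powr (- ?d) = 1 / (?d * 2 ^ (j + 1)) ^ CARD('n)"
      by (subst powr_minus_divide, subst powr_realpow) auto
    ultimately show "1 / (?d * 2 ^ (j + 1)) ^ CARD('n) \<le> znorm x powr (- ?d)" by simp
  qed
  finally show "1 / (2 * ?d) ^ CARD('n) \<le> (\<Sum>x\<in>(dyadic_box j :: (int^'n) set). znorm x powr (- ?d))" .
qed

text \<open>The first limit bounds the defect of the j-th cutoff, a linear mass over a squared
  logarithm linear in j; the second shows that the normalised cutoff tends to 1 at a fixed
  site.\<close>

lemma log_growth_tendsto_0:
  fixes a b c p :: real
  assumes "p \<noteq> 0"
  shows "(\<lambda>j. (a + b * real j) / (c + p * real j)\<^sup>2) \<longlonglongrightarrow> 0"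
    and "(\<lambda>j. (a + p * real j) / (c + p * real j)) \<longlonglongrightarrow> 1"
proof -
  have inv: "(\<lambda>j. inverse (real j)) \<longlonglongrightarrow> 0"
    by (rule filterlim_compose[OF tendsto_inverse_0_at_top filterlim_real_sequentially]) (simp add: filterlim_ident)
  have "(\<lambda>j. (a * inverse (real j) + b) / (c * inverse (real j) + p)\<^sup>2 * inverse (real j)) \<longlonglongrightarrow>
      (a * 0 + b) / (c * 0 + p)\<^sup>2 * 0"
    using assms by (intro tendsto_intros inv) auto
  then have 1: "(\<lambda>j. (a * inverse (real j) + b) / (c * inverse (real j) + p)\<^sup>2 * inverse (real j)) \<longlonglongrightarrow> 0" by simp
  have eq: "(a * inverse y + b) / (c * inverse y + p)\<^sup>2 * inverse y = (a + b * y) / (c + p * y)\<^sup>2"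
    "(a * inverse y + p) / (c * inverse y + p) = (a + p * y) / (c + p * y)" if y: "0 < y" for y :: real
  proof -
    have A: "a * inverse y + b = (a + b * y) * inverse y" and P: "a * inverse y + p = (a + p * y) * inverse y"
      and C: "c * inverse y + p = (c + p * y) * inverse y"
      using y by (simp_all add: field_simps)
    have i: "inverse y \<noteq> 0" using y by simp
    show "(a * inverse y + p) / (c * inverse y + p) = (a + p * y) / (c + p * y)"
      unfolding P C by (rule mult_divide_mult_cancel_right[OF i])
    have "(a + b * y) * inverse y / ((c + p * y) * inverse y)\<^sup>2 * inverse y =
        ((a + b * y) * (inverse y)\<^sup>2) / ((c + p * y)\<^sup>2 * (inverse y)\<^sup>2)"
      by (simp add: power2_eq_square)
    also have "\<dots> = (a + b * y) / (c + p * y)\<^sup>2"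
      by (rule mult_divide_mult_cancel_right) (use i in simp)
    finally show "(a * inverse y + b) / (c * inverse y + p)\<^sup>2 * inverse y = (a + b * y) / (c + p * y)\<^sup>2"
      unfolding A C .
  qed
  show "(\<lambda>j. (a + b * real j) / (c + p * real j)\<^sup>2) \<longlonglongrightarrow> 0"
    by (rule Lim_transform_eventually[OF 1 eventually_mono[OF eventually_gt_at_top[of 0]]]) (rule eq, simp)
  have "(\<lambda>j. (a * inverse (real j) + p) / (c * inverse (real j) + p)) \<longlonglongrightarrow> (a * 0 + p) / (c * 0 + p)"
    using assms by (intro tendsto_intros inv) auto
  then have 2: "(\<lambda>j. (a * inverse (real j) + p) / (c * inverse (real j) + p)) \<longlonglongrightarrow> 1" using assms by simp
  show "(\<lambda>j. (a + p * real j) / (c + p * real j)) \<longlonglongrightarrow> 1"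
    by (rule Lim_transform_eventually[OF 2 eventually_mono[OF eventually_gt_at_top[of 0]]]) (rule eq, simp)
qed

text \<open>The condition 2 * C2 / A2 \<le> r keeps the denominator above half of its main term; the
  numerator of the difference is then a combination of the two given errors, each smaller by
  r^(-2).\<close>

lemma quotient_asymptotics:
  fixes k1 k2 A1 A2 C1 C2 r a b :: real
  assumes A2: "0 < A2" and r: "1 \<le> r" "2 * C2 / A2 \<le> r" and C: "0 \<le> C1" "0 \<le> C2"
    and 1: "\<bar>k1 - A1 * r powr a\<bar> \<le> C1 * r powr (a - 2)"
    and 2: "\<bar>k2 - A2 * r powr b\<bar> \<le> C2 * r powr (b - 2)"
  shows "\<bar>k1 / k2 - A1 / A2 * r powr (a - b)\<bar> \<le> 2 * (C1 + \<bar>A1\<bar> / A2 * C2) / A2 * r powr (a - b - 2)"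
proof -
  have r0: "0 < r" using r by simp
  have "2 * C2 / A2 \<le> r\<^sup>2" using r self_le_power[of r 2] by simp
  then have "C2 \<le> A2 / 2 * r\<^sup>2" using A2 by (simp add: field_simps)
  then have "C2 * r powr (b - 2) \<le> A2 / 2 * r\<^sup>2 * r powr (b - 2)" by (intro mult_right_mono) auto
  also have "\<dots> = A2 / 2 * r powr b"
  proof -
    have "r\<^sup>2 * r powr (b - 2) = r powr 2 * r powr (b - 2)" using r0 by simp
    also have "\<dots> = r powr (2 + (b - 2))" by (simp only: powr_add)
    finally show ?thesis by simp
  qed
  finally have k2: "A2 / 2 * r powr b \<le> k2" using 2 by (simp add: abs_le_iff)
  have k2': "0 < A2 / 2 * r powr b" using A2 r0 by simp
  have s: "r powr (a - b) * r powr b = r powr a" "r powr (a - b) * r powr (b - 2) = r powr (a - 2)"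
    by (simp_all add: powr_add[symmetric])
  have "k1 / k2 - A1 / A2 * r powr (a - b) =
      ((k1 - A1 * r powr a) - A1 / A2 * r powr (a - b) * (k2 - A2 * r powr b)) / k2"
  proof -
    have "A1 / A2 * r powr (a - b) * (A2 * r powr b) = A1 * r powr a"
      using A2 s(1) by simp
    then have N: "(k1 - A1 * r powr a) - A1 / A2 * r powr (a - b) * (k2 - A2 * r powr b) =
        k1 - A1 / A2 * r powr (a - b) * k2" by (simp add: right_diff_distrib)
    show ?thesis unfolding N using k2 k2' by (simp add: diff_divide_distrib)
  qed
  then have "\<bar>k1 / k2 - A1 / A2 * r powr (a - b)\<bar> =
      \<bar>(k1 - A1 * r powr a) - A1 / A2 * r powr (a - b) * (k2 - A2 * r powr b)\<bar> / k2"
    using k2 k2' by simp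
  also have "\<dots> \<le> ((C1 + \<bar>A1\<bar> / A2 * C2) * r powr (a - 2)) / (A2 / 2 * r powr b)"
  proof (rule frac_le)
    have "\<bar>(k1 - A1 * r powr a) - A1 / A2 * r powr (a - b) * (k2 - A2 * r powr b)\<bar> \<le>
        \<bar>k1 - A1 * r powr a\<bar> + \<bar>A1 / A2 * r powr (a - b) * (k2 - A2 * r powr b)\<bar>" by (rule abs_triangle_ineq4)
    also have "\<bar>A1 / A2 * r powr (a - b) * (k2 - A2 * r powr b)\<bar> = \<bar>A1\<bar> / A2 * r powr (a - b) * \<bar>k2 - A2 * r powr b\<bar>"
      using A2 by (simp add: abs_mult)
    also have "\<bar>k1 - A1 * r powr a\<bar> + \<bar>A1\<bar> / A2 * r powr (a - b) * \<bar>k2 - A2 * r powr b\<bar> \<le>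
        C1 * r powr (a - 2) + \<bar>A1\<bar> / A2 * r powr (a - b) * (C2 * r powr (b - 2))"
      using A2 by (intro add_mono 1 mult_left_mono 2) auto
    also have "\<dots> = (C1 + \<bar>A1\<bar> / A2 * C2) * r powr (a - 2)"
      unfolding s(2)[symmetric] by (simp add: algebra_simps)
    finally show "\<bar>(k1 - A1 * r powr a) - A1 / A2 * r powr (a - b) * (k2 - A2 * r powr b)\<bar> \<le>
        (C1 + \<bar>A1\<bar> / A2 * C2) * r powr (a - 2)" .
  qed (use k2 k2' C A2 in auto)
  also have "\<dots> = 2 * (C1 + \<bar>A1\<bar> / A2 * C2) / A2 * (r powr (a - 2) / r powr b)"
    using A2 by simp
  also have "r powr (a - 2) / r powr b = r powr (a - b - 2)"
    using powr_diff[of r "a - 2" b] by (simp add: algebra_simps)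
  finally show ?thesis .
qed

section \<open>The ground state at \<alpha>_0\<close>

text \<open>The parameter \<open>dim\<close> carries no value; it fixes the index type whose
  cardinality is d. All later arguments live over the interpreted kernel locale.\<close>

locale hardy_ground_state =
  fixes \<sigma> \<alpha> :: real and dim :: "'n::finite itself"
  assumes \<sigma>: "0 < \<sigma>" "\<sigma> \<le> 1" "\<sigma> < real CARD('n) / 2"
  defines "\<alpha> \<equiv> (real CARD('n) / 2 + \<sigma>) / 2"
begin

abbreviation u :: "int^'n \<Rightarrow> real" where "u \<equiv> kappa (- \<alpha>)"
abbreviation f :: "int^'n \<Rightarrow> real" where "f \<equiv> kappa (\<sigma> - \<alpha>)"
abbreviation w :: "int^'n \<Rightarrow> real" where "w \<equiv> wsa \<sigma> \<alpha>"

lemma \<alpha>: "0 < \<alpha>" "\<sigma> < \<alpha>" "\<alpha> < real CARD('n) / 2" "0 < \<alpha> - \<sigma>" "\<alpha> - \<sigma> < real CARD('n) / 2"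
  using \<sigma> by (auto simp: \<alpha>_def)

lemma f_eq: "f = kappa (- (\<alpha> - \<sigma>))" by simp

sublocale symmetric_kernel "\<lambda>x y :: int^'n. kappa \<sigma> (x - y)"
  by (rule symmetric_kernel_kappa[OF \<sigma>(1,2)])

lemma u_pos: "0 < u x" by (rule kappa_uminus_pos[OF \<alpha>(1,3)])

lemma f_pos: "0 < f x" unfolding f_eq by (rule kappa_uminus_pos[OF \<alpha>(4,5)])

lemma generator_u: "generator u = f"
  by (rule ext) (rule generator_kappa_uminus[OF \<sigma>(1,2) \<alpha>(2,3)])

lemma w_eq: "w x = generator u x / u x"
  by (simp add: wsa_def generator_u)

lemma energy_eq_Qform: "energy = Qform \<sigma>"
  by (rule ext) (simp add: energy_def Qform_def)

text \<open>At \<alpha>_0 the exponents are -(d/2 - \<sigma>) for u and -(d/2 + \<sigma>) for f, and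
  they add up to -d.\<close>

lemma u_f_upper:
  obtains C where "0 < C" "\<And>x. x \<noteq> 0 \<Longrightarrow> f x * u x \<le> C * znorm x powr (- real CARD('n))"
    "\<And>x. x \<noteq> 0 \<Longrightarrow> u x \<le> C * znorm x powr (- (real CARD('n) / 2 - \<sigma>))"
proof -
  let ?d = "real CARD('n)"
  obtain C1 where C1: "0 < C1" "\<And>x::int^'n. x \<noteq> 0 \<Longrightarrow> kappa (- \<alpha>) x \<le> C1 * znorm x powr (2 * \<alpha> - ?d)"
    using kappa_upper[OF \<alpha>(1,3)] by blast
  obtain C2 where C2: "0 < C2" "\<And>x::int^'n. x \<noteq> 0 \<Longrightarrow> kappa (- (\<alpha> - \<sigma>)) x \<le> C2 * znorm x powr (2 * (\<alpha> - \<sigma>) - ?d)"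
    using kappa_upper[OF \<alpha>(4,5)] by blast
  show ?thesis
  proof (rule that[of "C1 + C1 * C2"])
    show "0 < C1 + C1 * C2" using C1 C2 by (simp add: add_pos_pos)
    fix x :: "int^'n" assume x: "x \<noteq> 0"
    have e: "2 * \<alpha> - ?d = - (?d / 2 - \<sigma>)" by (simp add: \<alpha>_def field_simps)
    have "u x \<le> C1 * znorm x powr (2 * \<alpha> - ?d)" by (rule C1(2)[OF x])
    also have "\<dots> \<le> (C1 + C1 * C2) * znorm x powr (2 * \<alpha> - ?d)" using C1 C2 by (intro mult_right_mono) auto
    finally show "u x \<le> (C1 + C1 * C2) * znorm x powr (- (?d / 2 - \<sigma>))" unfolding e .
    have "f x * u x \<le> (C2 * znorm x powr (2 * (\<alpha> - \<sigma>) - ?d)) * (C1 * znorm x powr (2 * \<alpha> - ?d))"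
      using C1 C2 x f_pos[of x] u_pos[of x] unfolding f_eq by (intro mult_mono) auto
    also have "\<dots> = (C1 * C2) * (znorm x powr (2 * (\<alpha> - \<sigma>) - ?d) * znorm x powr (2 * \<alpha> - ?d))" by simp
    also have "znorm x powr (2 * (\<alpha> - \<sigma>) - ?d) * znorm x powr (2 * \<alpha> - ?d) = znorm x powr (- ?d)"
      by (simp add: powr_add[symmetric] \<alpha>_def field_simps)
    also have "(C1 * C2) * znorm x powr (- ?d) \<le> (C1 + C1 * C2) * znorm x powr (- ?d)"
      using C1 by (intro mult_right_mono) auto
    finally show "f x * u x \<le> (C1 + C1 * C2) * znorm x powr (- ?d)" .
  qed
qed

lemma u_f_lower:
  obtains c R where "0 < c" "\<And>x. R \<le> znorm x \<Longrightarrow> c * znorm x powr (- real CARD('n)) \<le> f x * u x"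
proof -
  let ?d = "real CARD('n)"
  obtain c1 R1 where c1: "0 < c1" "1 \<le> R1" "\<And>x::int^'n. R1 \<le> znorm x \<Longrightarrow> c1 * znorm x powr (2 * \<alpha> - ?d) \<le> kappa (- \<alpha>) x"
    using kappa_lower[OF \<alpha>(1,3)] by blast
  obtain c2 R2 where c2: "0 < c2" "1 \<le> R2" "\<And>x::int^'n. R2 \<le> znorm x \<Longrightarrow> c2 * znorm x powr (2 * (\<alpha> - \<sigma>) - ?d) \<le> kappa (- (\<alpha> - \<sigma>)) x"
    using kappa_lower[OF \<alpha>(4,5)] by blast
  show ?thesis
  proof (rule that[of "c2 * c1" "max R1 R2"])
    show "0 < c2 * c1" using c1 c2 by simp
    fix x :: "int^'n" assume x: "max R1 R2 \<le> znorm x"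
    have "znorm x powr (2 * (\<alpha> - \<sigma>) - ?d) * znorm x powr (2 * \<alpha> - ?d) = znorm x powr (- ?d)"
      by (simp add: powr_add[symmetric] \<alpha>_def field_simps)
    then have "c2 * c1 * znorm x powr (- ?d) = (c2 * znorm x powr (2 * (\<alpha> - \<sigma>) - ?d)) * (c1 * znorm x powr (2 * \<alpha> - ?d))"
      by simp
    also have "\<dots> \<le> f x * u x"
      unfolding f_eq using c1 c2 x kappa_uminus_pos[OF \<alpha>(4,5), of x] by (intro mult_mono) auto
    finally show "c2 * c1 * znorm x powr (- ?d) \<le> f x * u x" .
  qed
qed

lemma u_bounded: obtains B where "0 < B" "\<And>x. u x \<le> B"
  using kappa_uminus_bounded[OF \<alpha>(1,3)] by blast

lemma fin_supp_sum:
  assumes "fin_supp \<phi>"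
  shows "(\<Sum>x | \<phi> x \<noteq> 0. fraclap \<sigma> \<phi> x * \<phi> x) = (\<Sum>x | \<phi> x \<noteq> 0. \<phi> x * generator \<phi> x)"
  using fraclap_eq_generator[OF \<sigma>(1,2) assms] by (simp add: mult.commute)

lemma w_hardy: "hardy_weight \<sigma> w"
  unfolding hardy_weight_def
proof (intro conjI allI impI)
  show "0 \<le> w x" for x
    using u_pos[of x] f_pos[of x] by (simp add: wsa_def)
  fix \<phi> :: "int^'n \<Rightarrow> real" assume \<phi>: "fin_supp \<phi>"
  let ?S = "{x. \<phi> x \<noteq> 0}"
  obtain B where B: "0 < B" "\<And>x. u x \<le> B" using u_bounded by blast
  have S: "finite ?S" "\<And>x. x \<notin> ?S \<Longrightarrow> \<phi> x = 0" using \<phi> by (auto simp: fin_supp_def)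
  have "(\<Sum>x\<in>?S. generator u x / u x * (\<phi> x)\<^sup>2) \<le> (\<Sum>x\<in>?S. \<phi> x * generator \<phi> x)"
    by (rule ground_state_transform[of u B ?S \<phi>, OF u_pos B(2) S]) (assumption, linarith)
  then show "(\<Sum>x\<in>?S. w x * (\<phi> x)\<^sup>2) \<le> (\<Sum>x\<in>?S. fraclap \<sigma> \<phi> x * \<phi> x)"
    unfolding fin_supp_sum[OF \<phi>] w_eq .
qed

text \<open>Cutting off at level l_j, of order 2^(-pj), costs a defect O(j) / j^2, because the mass
  of f u above the level is at most linear in j and the logarithm is of order j. Any surplus of w'
  at x0 is bounded by this defect, while the cutoffs tend to u at x0.\<close>

lemma w_critical:
  assumes w': "hardy_weight \<sigma> w'" "\<And>x. w x \<le> w' x"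
  shows "w' = w"
proof (rule ext)
  fix x0 :: "int^'n"
  define p where "p = real CARD('n) / 2 - \<sigma>"
  have p: "0 < p" using \<sigma> by (simp add: p_def)
  obtain C where C: "0 < C" "\<And>x. x \<noteq> 0 \<Longrightarrow> f x * u x \<le> C * znorm x powr (- real CARD('n))"
    "\<And>x. x \<noteq> 0 \<Longrightarrow> u x \<le> C * znorm x powr (- p)"
    using u_f_upper unfolding p_def by blast
  obtain B0 where B0: "0 < B0" "\<And>x. u x \<le> B0" using u_bounded by blast
  \<comment> \<open>Adding C to the bound of u keeps every level, which is at most C, strictly below
    B, so that the normalising logarithm is positive.\<close>
  define B where "B = B0 + C"
  have B: "0 < B" "C < B" "\<And>x. u x \<le> B" using B0 C(1) by (auto simp: B_def add_increasing2)
  define l where "l = (\<lambda>j::nat. C * 2 powr (- (p * real j)))"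
  have l: "0 < l j" "l j < B" for j
  proof -
    show "0 < l j" using C(1) by (simp add: l_def)
    have "2 powr (- (p * real j)) \<le> 2 powr 0" using p by (intro powr_mono) auto
    then have "l j \<le> C * 1" unfolding l_def using C(1) by (intro mult_left_mono) auto
    then show "l j < B" using B by simp
  qed
  have lnl: "ln (b / l j) = (ln b - ln C) + (p * ln 2) * real j" if "0 < b" for b j
    using that C(1) by (simp add: l_def ln_div ln_mult ln_powr)
  \<comment> \<open>The levels are calibrated to the decay C |x|^(-p) of u, so that the superlevel
    set lies in the ball of radius 2^j. The origin is separate because the decay bound excludes
    it.\<close>
  have level: "{x. l j < u x} \<subseteq> insert 0 {x. x \<noteq> 0 \<and> znorm x < 2 ^ j}" for j
  proof
    fix x assume x: "x \<in> {x. l j < u x}"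
    show "x \<in> insert 0 {x. x \<noteq> 0 \<and> znorm x < 2 ^ j}"
    proof (cases "x = 0")
      case False
      have "l j < C * znorm x powr (- p)" using x C(3)[OF False] by simp
      then have *: "2 powr (- (p * real j)) < znorm x powr (- p)" using C(1) by (simp add: l_def)
      have "znorm x < 2 ^ j"
      proof (rule ccontr)
        assume "\<not> znorm x < 2 ^ j"
        then have "znorm x powr (- p) \<le> (2 ^ j) powr (- p)" using p by (intro powr_mono2') auto
        also have "(2 ^ j :: real) powr (- p) = (2 powr real j) powr (- p)" by (simp add: powr_realpow)
        also have "\<dots> = 2 powr (- (p * real j))" by (simp only: powr_powr) (simp add: mult.commute)
        finally show False using * by simp
      qed
      then show ?thesis using False by simp
    qed simp
  qed
  have finA: "finite {x :: int^'n. x \<noteq> 0 \<and> znorm x < 2 ^ j}" for j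
    by (rule finite_subset[OF _ finite_znorm_ball[of j]]) auto
  have fin: "finite {x. l j < u x}" for j
    by (rule finite_subset[OF level]) (use finA in simp)
  define K where "K = C * 4 ^ CARD('n)"
  have mass: "(\<Sum>x | l j < u x. generator u x * u x) \<le> f 0 * u 0 + K * real j" for j
  proof -
    let ?A = "{x :: int^'n. x \<noteq> 0 \<and> znorm x < 2 ^ j}"
    have "(\<Sum>x | l j < u x. f x * u x) \<le> (\<Sum>x\<in>insert 0 ?A. f x * u x)"
      by (rule sum_mono2[OF _ level]) (use finA f_pos u_pos in \<open>auto intro: less_imp_le mult_pos_pos\<close>)
    also have "\<dots> = f 0 * u 0 + (\<Sum>x\<in>?A. f x * u x)"
      using finA by (subst sum.insert) auto
    also have "(\<Sum>x\<in>?A. f x * u x) \<le> (\<Sum>x\<in>?A. C * znorm x powr (- real CARD('n)))"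
      by (rule sum_mono) (use C(2) in auto)
    also have "\<dots> \<le> C * (4 ^ CARD('n) * real j)"
      unfolding sum_distrib_left[symmetric] using C(1) dyadic_sum_upper by (intro mult_left_mono) auto
    finally show ?thesis by (simp add: generator_u K_def mult.assoc)
  qed
  define \<phi> where "\<phi> = (\<lambda>j x. u x * (ln (max (u x) (l j) / l j) / ln (B / l j)))"
  have supp: "{x. \<phi> j x \<noteq> 0} = {x. l j < u x}" for j
  proof -
    have "0 < ln (B / l j)" using l[of j] by simp
    moreover have "ln (max (u x) (l j) / l j) \<noteq> 0 \<longleftrightarrow> l j < u x" for x
      using l(1)[of j] by (cases "l j < u x") (auto simp: max_def)
    ultimately show ?thesis using u_pos by (auto simp: \<phi>_def less_imp_neq[symmetric])
  qed
  \<comment> \<open>The Hardy inequality for w' bounds the whole weighted surplus by energy minus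
    the w-term, which is the defect of the cutoff; the single site x0 is part of that nonnegative
    sum.\<close>
  have ineq: "(w' x0 - w x0) * (\<phi> j x0)\<^sup>2 \<le> (f 0 * u 0 + K * real j) / (ln (B / l j))\<^sup>2" for j
  proof -
    let ?S = "{x. l j < u x}"
    have fs: "fin_supp (\<phi> j)" using fin supp by (simp add: fin_supp_def)
    have nn: "0 \<le> (w' x - w x) * (\<phi> j x)\<^sup>2" for x using w'(2)[of x] by simp
    have "(w' x0 - w x0) * (\<phi> j x0)\<^sup>2 \<le> (\<Sum>x\<in>?S. (w' x - w x) * (\<phi> j x)\<^sup>2)"
    proof (cases "x0 \<in> ?S")
      case True
      show ?thesis by (rule member_le_sum[OF True nn fin])
    next
      case False
      then have "\<phi> j x0 = 0" using supp[of j] by auto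
      then show ?thesis using nn by (simp add: sum_nonneg)
    qed
    also have "\<dots> = (\<Sum>x\<in>?S. w' x * (\<phi> j x)\<^sup>2) - (\<Sum>x\<in>?S. generator u x / u x * (\<phi> j x)\<^sup>2)"
      by (simp add: left_diff_distrib sum_subtractf w_eq)
    also have "(\<Sum>x\<in>?S. w' x * (\<phi> j x)\<^sup>2) \<le> (\<Sum>x\<in>?S. \<phi> j x * generator (\<phi> j) x)"
    proof -
      have "(\<Sum>x | \<phi> j x \<noteq> 0. w' x * (\<phi> j x)\<^sup>2) \<le> (\<Sum>x | \<phi> j x \<noteq> 0. fraclap \<sigma> (\<phi> j) x * \<phi> j x)"
        using w'(1) fs unfolding hardy_weight_def by blast
      then show ?thesis unfolding fin_supp_sum[OF fs] unfolding supp .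
    qed
    also have "(\<Sum>x\<in>?S. \<phi> j x * generator (\<phi> j) x) - (\<Sum>x\<in>?S. generator u x / u x * (\<phi> j x)\<^sup>2) \<le>
        (\<Sum>x\<in>?S. generator u x * u x) / (ln (B / l j))\<^sup>2"
      unfolding \<phi>_def by (rule log_cutoff[OF u_pos B(3) _ l fin]) (simp add: generator_u f_pos less_imp_le)
    also have "\<dots> \<le> (f 0 * u 0 + K * real j) / (ln (B / l j))\<^sup>2"
      by (intro divide_right_mono mass) simp
    finally show ?thesis by simp
  qed
  have pl: "p * ln 2 \<noteq> 0" using p by simp
  have rhs: "(\<lambda>j. (f 0 * u 0 + K * real j) / (ln (B / l j))\<^sup>2) \<longlonglongrightarrow> 0"
    unfolding lnl[OF B(1)] by (rule log_growth_tendsto_0(1)[OF pl])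
  have "(\<lambda>j. u x0 * (ln (u x0 / l j) / ln (B / l j))) \<longlonglongrightarrow> u x0 * 1"
    unfolding lnl[OF B(1)] lnl[OF u_pos] by (intro tendsto_mult tendsto_const log_growth_tendsto_0(2)[OF pl])
  moreover have "\<forall>\<^sub>F j in sequentially. u x0 * (ln (u x0 / l j) / ln (B / l j)) = \<phi> j x0"
  proof -
    have "(\<lambda>j. l j) \<longlonglongrightarrow> C * 0"
    proof -
      have "(\<lambda>j. 2 powr (- (p * real j))) = (\<lambda>j. (2 powr (- p)) ^ j)"
        by (rule ext) (simp add: powr_realpow[symmetric] powr_powr)
      moreover have "2 powr (- p) < 1" using p by (simp add: powr_less_one)
      ultimately have "(\<lambda>j. 2 powr (- (p * real j))) \<longlonglongrightarrow> 0" by (simp add: LIMSEQ_power_zero)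
      then show ?thesis unfolding l_def by (intro tendsto_mult tendsto_const)
    qed
    then have "\<forall>\<^sub>F j in sequentially. l j < u x0"
      using order_tendstoD(2)[of l 0 sequentially "u x0"] u_pos[of x0] by simp
    then show ?thesis by eventually_elim (simp add: \<phi>_def max_def)
  qed
  ultimately have "(\<lambda>j. \<phi> j x0) \<longlonglongrightarrow> u x0"
    using Lim_transform_eventually by force
  then have "(\<lambda>j. (w' x0 - w x0) * (\<phi> j x0)\<^sup>2) \<longlonglongrightarrow> (w' x0 - w x0) * (u x0)\<^sup>2"
    by (intro tendsto_intros)
  from LIMSEQ_le[OF this rhs] ineq have "(w' x0 - w x0) * (u x0)\<^sup>2 \<le> 0" by blast
  moreover have "0 < (u x0)\<^sup>2" using u_pos[of x0] by simp
  ultimately have "w' x0 - w x0 \<le> 0" by (simp add: mult_le_0_iff)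
  then show "w' x0 = w x0" using w'(2)[of x0] by simp
qed

text \<open>Once the boxes lie beyond R, each contributes at least the fixed amount \<delta>, and
  they are disjoint; finitely many exceed any supposed finite total.\<close>

lemma f_u_not_summable: "(\<integral>\<^sup>+ x. ennreal (f x * u x) \<partial>count_space UNIV) = \<infinity>"
proof (rule ccontr)
  assume "(\<integral>\<^sup>+ x. ennreal (f x * u x) \<partial>count_space UNIV) \<noteq> \<infinity>"
  then obtain T where T: "0 \<le> T" "(\<integral>\<^sup>+ x. ennreal (f x * u x) \<partial>count_space UNIV) = ennreal T"
    by (cases "\<integral>\<^sup>+ x. ennreal (f x * u x) \<partial>count_space UNIV") auto
  obtain c R where c: "0 < c" "\<And>x. R \<le> znorm x \<Longrightarrow> c * znorm x powr (- real CARD('n)) \<le> f x * u x"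
    using u_f_lower by blast
  note box = dyadic_box_lower[where 'n='n]
  obtain J where J: "R \<le> 2 ^ J" using real_arch_pow[of 2 R] by (auto intro: less_imp_le)
  define \<delta> where "\<delta> = c * (1 / (2 * real CARD('n)) ^ CARD('n))"
  have \<delta>: "0 < \<delta>" using c by (simp add: \<delta>_def)
  obtain N :: nat where N: "T / \<delta> < real N" using reals_Archimedean2 by blast
  let ?F = "\<Union>j\<in>{J..<J + N}. dyadic_box j :: (int^'n) set"
  have fin: "finite ?F" using box(1) by simp
  have "real N * \<delta> = (\<Sum>j\<in>{J..<J + N}. \<delta>)" by simp
  also have "\<dots> \<le> (\<Sum>j\<in>{J..<J + N}. \<Sum>x\<in>dyadic_box j. f x * u x)"
  proof (rule sum_mono)
    fix j assume j: "j \<in> {J..<J + N}"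
    have "\<delta> \<le> c * (\<Sum>x\<in>(dyadic_box j :: (int^'n) set). znorm x powr (- real CARD('n)))"
      unfolding \<delta>_def by (rule mult_left_mono[OF box(4)]) (use c in simp)
    also have "\<dots> = (\<Sum>x\<in>(dyadic_box j :: (int^'n) set). c * znorm x powr (- real CARD('n)))" by (rule sum_distrib_left)
    also have "\<dots> \<le> (\<Sum>x\<in>dyadic_box j. f x * u x)"
    proof (intro sum_mono c(2))
      fix x :: "int^'n" assume "x \<in> dyadic_box j"
      then have "2 ^ j \<le> znorm x" by (rule box(2))
      moreover have "(2::real) ^ J \<le> 2 ^ j" using j by (intro power_increasing) auto
      ultimately show "R \<le> znorm x" using J by linarith
    qed
    finally show "\<delta> \<le> (\<Sum>x\<in>dyadic_box j. f x * u x)" .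
  qed
  also have "\<dots> = (\<Sum>x\<in>?F. f x * u x)"
    by (rule sum.UNION_disjoint[symmetric]) (use box(1,3) in auto)
  finally have "real N * \<delta> \<le> (\<Sum>x\<in>?F. f x * u x)" .
  moreover have "ennreal (\<Sum>x\<in>?F. f x * u x) \<le> ennreal T"
  proof -
    have "ennreal (\<Sum>x\<in>?F. f x * u x) = (\<Sum>x\<in>?F. ennreal (f x * u x))"
      by (rule sum_ennreal[symmetric]) (use f_pos u_pos in \<open>auto intro: less_imp_le mult_pos_pos\<close>)
    also have "\<dots> = (\<integral>\<^sup>+ x. ennreal (f x * u x) \<partial>count_space ?F)"
      by (rule nn_integral_count_space_finite[symmetric, OF fin])
    also have "\<dots> = (\<integral>\<^sup>+ x. ennreal (f x * u x) * indicator ?F x \<partial>count_space UNIV)"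
      by (rule nn_integral_count_space_indicator) auto
    also have "\<dots> \<le> (\<integral>\<^sup>+ x. ennreal (f x * u x) \<partial>count_space UNIV)"
      by (intro nn_integral_mono) (auto simp: indicator_def)
    finally show ?thesis unfolding T(2) .
  qed
  then have "(\<Sum>x\<in>?F. f x * u x) \<le> T" using T(1) by simp
  ultimately have "real N * \<delta> \<le> T" by linarith
  then show False using N \<delta> by (simp add: field_simps)
qed

text \<open>Convergence in the form norm is first upgraded to convergence at every site, which
  Fatou's argument in \<open>defect_le_energy\<close> requires. Equality in the Hardy inequality
  then leaves no room for the defect.\<close>

lemma no_minimizer:
  assumes v: "v \<in> D0 \<sigma>" and eq: "Qform \<sigma> v = (\<integral>\<^sup>+ x. ennreal (w x * (v x)\<^sup>2) \<partial>count_space UNIV)"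
  shows "v = (\<lambda>_. 0)"
proof -
  obtain \<phi> where \<phi>: "\<And>n. fin_supp (\<phi> n)"
    and lim: "(\<lambda>n. Qform \<sigma> (\<lambda>x. v x - \<phi> n x) + ennreal ((v 0 - \<phi> n 0)\<^sup>2)) \<longlonglongrightarrow> 0"
    using v unfolding D0_def by auto
  have E: "(\<lambda>n. energy (\<lambda>x. v x - \<phi> n x)) \<longlonglongrightarrow> 0"
    unfolding energy_eq_Qform by (rule tendsto_sandwich[OF _ _ tendsto_const lim]) auto
  have "(\<lambda>n. ennreal ((v 0 - \<phi> n 0)\<^sup>2)) \<longlonglongrightarrow> 0"
    by (rule tendsto_sandwich[OF _ _ tendsto_const lim]) auto
  then have "(\<lambda>n. (v 0 - \<phi> n 0)\<^sup>2) \<longlonglongrightarrow> 0"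
    by (subst (asm) ennreal_0[symmetric], subst (asm) tendsto_ennreal_iff) auto
  then have "(\<lambda>n. sqrt ((v 0 - \<phi> n 0)\<^sup>2)) \<longlonglongrightarrow> sqrt 0" by (rule tendsto_real_sqrt)
  then have zero: "(\<lambda>n. v 0 - \<phi> n 0) \<longlonglongrightarrow> 0" by (simp add: tendsto_rabs_zero_iff)
  have nb: "0 < kappa \<sigma> ((x + axis i 1) - x)" "0 < kappa \<sigma> ((x - axis i 1) - x)" for x :: "int^'n" and i
    using kappa_nbrs_pos[OF \<sigma>(1,2), of "axis i 1" 0] by (simp_all add: kappa_minus nbrs_def)
  have pw: "(\<lambda>n. v x - \<phi> n x) \<longlonglongrightarrow> 0" for x
  proof (induction x rule: lattice_induct)
    case zero
    show ?case by fact
  next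
    case (plus x i)
    show ?case by (rule pointwise_limit_step[OF nb(1) E plus])
  next
    case (minus x i)
    show ?case by (rule pointwise_limit_step[OF nb(2) E minus])
  qed
  have lim': "(\<lambda>n. \<phi> n x) \<longlonglongrightarrow> v x" for x
    using tendsto_diff[OF tendsto_const[of "v x"] pw[of x]] by simp
  obtain B where B: "0 < B" "\<And>x. u x \<le> B" using u_bounded by blast
  have fs: "finite {x. \<phi> n x \<noteq> 0}" for n using \<phi>[of n] by (simp add: fin_supp_def)
  have gn: "0 \<le> generator u x" for x using f_pos[of x] by (simp add: generator_u)
  note D = defect_le_energy[of u B \<phi> v, OF u_pos B(2) gn fs E lim']
  have W: "(\<integral>\<^sup>+ x. ennreal (generator u x / u x * (v x)\<^sup>2) \<partial>count_space UNIV) = energy v"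
    unfolding energy_eq_Qform eq w_eq ..
  \<comment> \<open>The equality assumption turns \<open>defect_le_energy\<close> into defect plus
    energy \<le> energy; cancelling is legitimate because the energy of v is finite.\<close>
  have d0: "defect u v = 0"
  proof -
    have "defect u v + energy v \<le> 0 + energy v" using D(2) unfolding W by simp
    then show ?thesis using D(1) by (simp add: ennreal_add_left_cancel_le less_top[symmetric] add.commute)
  qed
  have const: "v x / u x = v y / u y" if "0 < kappa \<sigma> (x - y)" for x y
    by (rule defect_eq_0D[of u v, OF d0 u_pos that])
  define c where "c = v 0 / u 0"
  have "v x / u x = c" for x
  proof (induction x rule: lattice_induct)
    case (plus x i)
    then show ?case using const[OF nb(1)] by simp
  next
    case (minus x i)
    then show ?case using const[OF nb(2)] by simp
  qed (simp add: c_def)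
  then have vu: "v x = c * u x" for x using u_pos[of x] by (metis less_irrefl nonzero_eq_divide_eq)
  have "c = 0"
  proof (rule ccontr)
    assume "c \<noteq> 0"
    have "energy v = (\<integral>\<^sup>+ x. ennreal (c\<^sup>2) * ennreal (f x * u x) \<partial>count_space UNIV)"
      unfolding W[symmetric]
    proof (rule nn_integral_cong)
      fix x
      have "generator u x / u x * (v x)\<^sup>2 = c\<^sup>2 * (f x * u x)"
        using u_pos[of x] by (simp add: vu generator_u power2_eq_square)
      then show "ennreal (generator u x / u x * (v x)\<^sup>2) = ennreal (c\<^sup>2) * ennreal (f x * u x)"
        using f_pos[of x] u_pos[of x] by (simp add: ennreal_mult)
    qed
    also have "\<dots> = ennreal (c\<^sup>2) * \<infinity>"
      by (subst nn_integral_cmult) (simp_all add: f_u_not_summable)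
    also have "\<dots> = \<infinity>" using \<open>c \<noteq> 0\<close> by (simp add: ennreal_mult_top)
    finally show False using D(1) by simp
  qed
  then show ?thesis using vu by (simp add: fun_eq_iff)
qed

lemma w_optimal: "optimal_hardy_weight \<sigma> w"
  unfolding optimal_hardy_weight_def using w_hardy w_critical no_minimizer by blast

lemma w_asymptotics:
  "\<exists>C R. \<forall>x. R \<le> znorm x \<longrightarrow>
     \<bar>w x - (4 powr \<sigma> * Gamma (real CARD('n) / 4 + \<sigma> / 2)^2 / Gamma (real CARD('n) / 4 - \<sigma> / 2)^2)
         / znorm x powr (2 * \<sigma>)\<bar> \<le> C / znorm x powr (2 * \<sigma> + 2)"
proof -
  let ?d = "real CARD('n)"
  let ?A1 = "riesz_const ?d (\<alpha> - \<sigma>)" and ?A2 = "riesz_const ?d \<alpha>"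
  let ?G1 = "Gamma (?d / 4 + \<sigma> / 2)" and ?G2 = "Gamma (?d / 4 - \<sigma> / 2)"
  obtain C1 where C1: "0 < C1" "\<And>x::int^'n. x \<noteq> 0 \<Longrightarrow>
    \<bar>kappa (- (\<alpha> - \<sigma>)) x - ?A1 * znorm x powr (2 * (\<alpha> - \<sigma>) - ?d)\<bar> \<le> C1 * znorm x powr (2 * (\<alpha> - \<sigma>) - ?d - 2)"
    using kappa_asymptotics[OF \<alpha>(4,5)] by blast
  obtain C2 where C2: "0 < C2" "\<And>x::int^'n. x \<noteq> 0 \<Longrightarrow>
    \<bar>kappa (- \<alpha>) x - ?A2 * znorm x powr (2 * \<alpha> - ?d)\<bar> \<le> C2 * znorm x powr (2 * \<alpha> - ?d - 2)"
    using kappa_asymptotics[OF \<alpha>(1,3)] by blast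
  have A2: "0 < ?A2" by (rule riesz_const_pos[OF \<alpha>(1,3)])
  have ratio: "?A1 / ?A2 = 4 powr \<sigma> * ?G1^2 / ?G2^2"
  proof -
    \<comment> \<open>The parameters \<alpha> and \<alpha> - \<sigma> add up to d/2, so the two
      Riesz constants use the same pair of Gamma values in exchanged roles. The powers of pi cancel,
      the Gamma quotient is squared, and 4^\<sigma> is left over.\<close>
    have e: "?d / 2 - (\<alpha> - \<sigma>) = ?d / 4 + \<sigma> / 2" "\<alpha> - \<sigma> = ?d / 4 - \<sigma> / 2"
      "?d / 2 - \<alpha> = ?d / 4 - \<sigma> / 2" "\<alpha> = ?d / 4 + \<sigma> / 2"
      by (simp_all add: \<alpha>_def field_simps)
    have G: "0 < ?G1" "0 < ?G2" using \<sigma> by (auto intro!: Gamma_real_pos add_pos_pos)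
    have A1: "?A1 = ?G1 / (?G2 * pi powr (?d / 2) * 4 powr (\<alpha> - \<sigma>))"
      unfolding riesz_const_def e(1) e(2)[symmetric] ..
    have "?A2 = ?G2 / (?G1 * pi powr (?d / 2) * 4 powr \<alpha>)"
      unfolding riesz_const_def e(3) e(4)[symmetric] ..
    also have "(4::real) powr \<alpha> = 4 powr (\<alpha> - \<sigma>) * 4 powr \<sigma>" by (simp add: powr_add[symmetric])
    finally have A2': "?A2 = ?G2 / (?G1 * pi powr (?d / 2) * (4 powr (\<alpha> - \<sigma>) * 4 powr \<sigma>))" .
    have "(g1 / (g2 * P * q)) / (g2 / (g1 * P * (q * s))) = s * g1^2 / g2^2"
      if "0 < g1" "0 < g2" "0 < P" "0 < q" "0 < s" for g1 g2 P q s :: real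
      using that by (simp add: power2_eq_square)
    from this[OF G, of "pi powr (?d / 2)" "4 powr (\<alpha> - \<sigma>)" "4 powr \<sigma>"] show ?thesis
      unfolding A1 A2' by simp
  qed
  let ?C = "2 * (C1 + \<bar>?A1\<bar> / ?A2 * C2) / ?A2"
  have "\<bar>w x - (4 powr \<sigma> * ?G1^2 / ?G2^2) / znorm x powr (2 * \<sigma>)\<bar> \<le> ?C / znorm x powr (2 * \<sigma> + 2)"
    if x: "max 1 (2 * C2 / ?A2) \<le> znorm x" for x
  proof -
    have r: "1 \<le> znorm x" "2 * C2 / ?A2 \<le> znorm x" using x by auto
    then have x0: "x \<noteq> 0" by (auto simp: znorm_def zsqnorm_def)
    have e: "(2 * (\<alpha> - \<sigma>) - ?d) - (2 * \<alpha> - ?d) = - (2 * \<sigma>)" "- (2 * \<sigma>) - 2 = - (2 * \<sigma> + 2)" by simp_all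
    have "\<bar>f x / u x - ?A1 / ?A2 * znorm x powr ((2 * (\<alpha> - \<sigma>) - ?d) - (2 * \<alpha> - ?d))\<bar> \<le>
        ?C * znorm x powr ((2 * (\<alpha> - \<sigma>) - ?d) - (2 * \<alpha> - ?d) - 2)"
      unfolding f_eq
      by (rule quotient_asymptotics[OF A2 r _ _ C1(2)[OF x0] C2(2)[OF x0]]) (use C1 C2 in auto)
    then show ?thesis
      unfolding e ratio powr_minus_divide by (simp add: wsa_def)
  qed
  then show ?thesis by blast
qed

end

theorem theorem1p1:
  fixes \<sigma> :: real
  assumes "0 < \<sigma>" and "\<sigma> \<le> 1"
    and "CARD('n::finite) \<in> {1, 2} \<longrightarrow> \<sigma> < real CARD('n) / 2"
  shows "optimal_hardy_weight \<sigma> (wsa \<sigma> ((real CARD('n) / 2 + \<sigma>) / 2) :: int^'n \<Rightarrow> real) \<and>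
    (\<exists>C R. \<forall>x::int^'n. R \<le> znorm x \<longrightarrow>
       \<bar>wsa \<sigma> ((real CARD('n) / 2 + \<sigma>) / 2) x
         - (4 powr \<sigma> * Gamma (real CARD('n) / 4 + \<sigma> / 2)^2 / Gamma (real CARD('n) / 4 - \<sigma> / 2)^2)
           / znorm x powr (2 * \<sigma>)\<bar>
       \<le> C / znorm x powr (2 * \<sigma> + 2))"
proof -
  \<comment> \<open>In dimension at least 3 this is automatic, as \<sigma> \<le> 1 < 3/2.\<close>
  have "\<sigma> < real CARD('n) / 2"
  proof (cases "CARD('n) \<in> {1, 2}")
    case False
    then have "CARD('n) \<noteq> 1" "CARD('n) \<noteq> 2" by auto
    moreover have "0 < CARD('n)" by (rule zero_less_card_finite)
    ultimately have "3 \<le> CARD('n)" by linarith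
    then show ?thesis using assms by linarith
  qed (use assms in auto)
  then interpret hardy_ground_state \<sigma> "(real CARD('n) / 2 + \<sigma>) / 2" "TYPE('n)"
    by unfold_locales (use assms in auto)
  show ?thesis using w_optimal w_asymptotics by blast
qed

end
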